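(* Let $\Gamma$ be a countable group with (Kazhdan's) property (T), and let $\Gamma\curvearrowright(X,\mu)$ be an ergodic probability measure preserving Borel action on a diffuse standard probability space. Then the orbit equivalence relation $(\mathcal R_\Gamma,\mu)$ does not have property (H), and in particular it is not treeable.
   Context: $\mathcal R_\Gamma\subset X\times X$ is the set of pairs of points in the same $\Gamma$-orbit. It is a countable Borel groupoid $G=\mathcal R_\Gamma$ with unit space $X$ (identified with the diagonal), $r(x,y)=x$, $s(x,y)=y$, $(x,y)(y,z)=(x,z)$, $(x,y)^{-1}=(y,x)$, and $\mu$ is quasi-invariant for it, so $(\mathcal R_\Gamma,\mu)$ is a countable measured groupoid. For a countable measured groupoid $(G,\mu)$ with unit space $X$ put $G^x=r^{-1}(x)$ and $\int_GF\,d\nu=\int_X\sum_{s(\gamma)=x}F(\gamma)\,d\mu(x)$. **Property (H).** A Borel function $F:G\to\mathbb{C}$ is positive definite if there is a $\mu$-null set $N\subset X$ such that for all $x\notin N$ and $\gamma_1,\dots,\gamma_k\in G^x$ the matrix $[F(\gamma_i^{-1}\gamma_j)]$ is positive (semi-definite). $(G,\mu)$ has property (H) if there is a sequence $(F_n)$ of positive definite functions on $G$ with (i) $(F_n)_{|X}=1$ a.e.; (ii) $\nu(\{|F_n|>\varepsilon\})<+\infty$ for every $\varepsilon>0$; (iii) $\lim_nF_n=1$ a.e. **Treeability.** A treeing of a countable Borel groupoid $G$ is a Borel subset $Q\subset G$ with $Q=Q^{-1}$, $Q\cap X=\emptyset$, $\bigcup_{n\ge0}Q^n=G$ ($Q^0=X$,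 $Q^n$ the set of products of $n$ composable elements of $Q$), such that for every $x\in X$ the graph with vertex set $G^x$, in which $\gamma_1,\gamma_2$ are adjacent iff $\gamma_1^{-1}\gamma_2\in Q$, is a tree. $(G,\mu)$ is treeable if for some conull Borel $U\subset X$ the reduction $G_{|U}=\{\gamma:r(\gamma),s(\gamma)\in U\}$ has a treeing. *)

theory Defs
  imports
    "HOL-Probability.Probability"
    "HOL-Algebra.Group_Action"
    "HOL-Algebra.Module"
begin

section \<open>Complex Hilbert spaces and property (T)\<close>

text \<open>
  Hilbert spaces are given on explicit carriers: the vector space structure is a module over
  the field of complex numbers, and the inner product is linear in its first argument.
\<close>

definition complex_ring :: "complex ring" where
  "complex_ring = \<lparr>carrier = UNIV, mult = (*), one = 1, zero = 0, add = (+)\<rparr>"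

definition hnorm :: "('h \<Rightarrow> 'h \<Rightarrow> complex) \<Rightarrow> 'h \<Rightarrow> real" where
  "hnorm ip x = sqrt (Re (ip x x))"

locale complex_hilbert_space =
  Module.module complex_ring H
  for H :: "(complex, 'h) module" (structure) +
  fixes ip :: "'h \<Rightarrow> 'h \<Rightarrow> complex"
  assumes ip_add: "\<lbrakk>x \<in> carrier H; y \<in> carrier H; z \<in> carrier H\<rbrakk>
      \<Longrightarrow> ip (x \<oplus>\<^bsub>H\<^esub> y) z = ip x z + ip y z"
    and ip_smult: "\<lbrakk>x \<in> carrier H; z \<in> carrier H\<rbrakk> \<Longrightarrow> ip (c \<odot>\<^bsub>H\<^esub> x) z = c * ip x z"
    and ip_hermitian: "\<lbrakk>x \<in> carrier H; y \<in> carrier H\<rbrakk> \<Longrightarrow> ip y x = cnj (ip x y)"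
    and ip_pos: "\<lbrakk>x \<in> carrier H; x \<noteq> \<zero>\<^bsub>H\<^esub>\<rbrakk> \<Longrightarrow> 0 < Re (ip x x)"
    and complete: "\<lbrakk>\<And>n :: nat. v n \<in> carrier H;
        \<And>e. 0 < e \<Longrightarrow> \<exists>N. \<forall>m\<ge>N. \<forall>n\<ge>N. hnorm ip (v m \<ominus>\<^bsub>H\<^esub> v n) < e\<rbrakk>
      \<Longrightarrow> \<exists>l\<in>carrier H. (\<lambda>n. hnorm ip (v n \<ominus>\<^bsub>H\<^esub> l)) \<longlonglongrightarrow> 0"

locale unitary_representation =
  complex_hilbert_space H ip + group_action \<Gamma> "carrier H" \<pi>
  for \<Gamma> :: "('g, 'b) monoid_scheme"
    and H :: "(complex, 'h) module"
    and ip :: "'h \<Rightarrow> 'h \<Rightarrow> complex"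
    and \<pi> :: "'g \<Rightarrow> 'h \<Rightarrow> 'h" +
  assumes rep_add: "\<lbrakk>g \<in> carrier \<Gamma>; x \<in> carrier H; y \<in> carrier H\<rbrakk>
      \<Longrightarrow> \<pi> g (x \<oplus>\<^bsub>H\<^esub> y) = \<pi> g x \<oplus>\<^bsub>H\<^esub> \<pi> g y"
    and rep_smult: "\<lbrakk>g \<in> carrier \<Gamma>; x \<in> carrier H\<rbrakk>
      \<Longrightarrow> \<pi> g (c \<odot>\<^bsub>H\<^esub> x) = c \<odot>\<^bsub>H\<^esub> \<pi> g x"
    and rep_ip: "\<lbrakk>g \<in> carrier \<Gamma>; x \<in> carrier H; y \<in> carrier H\<rbrakk>
      \<Longrightarrow> ip (\<pi> g x) (\<pi> g y) = ip x y"

text \<open>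
  Kazhdan's property (T) for a countable discrete group: there is a Kazhdan pair, i.e. a finite
  set \<open>K\<close> and \<open>\<epsilon> > 0\<close> such that every unitary representation with a
  \<open>(K, \<epsilon>)\<close>-invariant vector has a nonzero invariant vector.

  HOL cannot quantify over all carrier types inside a definition.  The type
  \<open>nat \<Rightarrow> complex\<close> contains a carrier for every separable Hilbert space.  This loses
  nothing for countable groups: a \<open>(K, \<epsilon>)\<close>-invariant vector lies in the closed
  invariant subspace that it generates, which is separable.
\<close>

definition property_T :: "('g, 'b) monoid_scheme \<Rightarrow> bool" where
  "property_T \<Gamma> \<longleftrightarrow>
     (\<exists>K \<epsilon>. finite K \<and> K \<subseteq> carrier \<Gamma> \<and> (0::real) < \<epsilon> \<and>
       (\<forall>(H :: (complex, nat \<Rightarrow> complex) module) ip \<pi>.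
          unitary_representation \<Gamma> H ip \<pi> \<longrightarrow>
          (\<exists>\<xi>\<in>carrier H. \<xi> \<noteq> \<zero>\<^bsub>H\<^esub> \<and> (\<forall>g\<in>K. hnorm ip (\<pi> g \<xi> \<ominus>\<^bsub>H\<^esub> \<xi>) < \<epsilon> * hnorm ip \<xi>)) \<longrightarrow>
          (\<exists>\<eta>\<in>carrier H. \<eta> \<noteq> \<zero>\<^bsub>H\<^esub> \<and> (\<forall>g\<in>carrier \<Gamma>. \<pi> g \<eta> = \<eta>))))"


section \<open>Ergodic actions on standard probability spaces\<close>

definition standard_borel :: "'x measure \<Rightarrow> bool" where
  "standard_borel M \<longleftrightarrow>
     (\<exists>T. topspace T = space M \<and> completely_metrizable_space T \<and> second_countable T \<and>
          sets M = sigma_sets (space M) {U. openin T U})"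

definition diffuse :: "'x measure \<Rightarrow> bool" where
  "diffuse M \<longleftrightarrow> (\<forall>x\<in>space M. emeasure M {x} = 0)"

locale pmp_action =
  group_action \<Gamma> "space \<mu>" \<phi> + prob_space \<mu>
  for \<Gamma> :: "('g, 'b) monoid_scheme"
    and \<mu> :: "'x measure"
    and \<phi> :: "'g \<Rightarrow> 'x \<Rightarrow> 'x" +
  assumes action_measurable: "g \<in> carrier \<Gamma> \<Longrightarrow> \<phi> g \<in> \<mu> \<rightarrow>\<^sub>M \<mu>"
    and action_preserves: "g \<in> carrier \<Gamma> \<Longrightarrow> distr \<mu> \<mu> (\<phi> g) = \<mu>"

definition ergodic_action :: "('g, 'b) monoid_scheme \<Rightarrow> 'x measure \<Rightarrow> ('g \<Rightarrow> 'x \<Rightarrow> 'x) \<Rightarrow> bool" where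
  "ergodic_action \<Gamma> \<mu> \<phi> \<longleftrightarrow>
     (\<forall>A\<in>sets \<mu>. (\<forall>g\<in>carrier \<Gamma>. \<phi> g ` A = A) \<longrightarrow>
        emeasure \<mu> A = 0 \<or> emeasure \<mu> (space \<mu> - A) = 0)"


section \<open>Borel groupoids\<close>

text \<open>
  Arrows and units have separate types, and \<open>unit_arrow\<close> embeds the unit space into the
  arrows.  The field \<open>arrows\<close> carries the set of arrows and its Borel structure; only its
  space and its measurable sets are ever used, never its measure.
  The product \<open>comp G a b\<close> is meaningful when \<open>src G a = rng G b\<close>.
\<close>

record ('a, 'x) borel_groupoid =
  units :: "'x set"
  arrows :: "'a measure"
  rng :: "'a \<Rightarrow> 'x"
  src :: "'a \<Rightarrow> 'x"
  comp :: "'a \<Rightarrow> 'a \<Rightarrow> 'a"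
  arr_inv :: "'a \<Rightarrow> 'a"
  unit_arrow :: "'x \<Rightarrow> 'a"

definition rng_fibre :: "('a, 'x) borel_groupoid \<Rightarrow> 'x \<Rightarrow> 'a set" where
  "rng_fibre G x = {\<gamma> \<in> space (arrows G). rng G \<gamma> = x}"

definition src_fibre :: "('a, 'x) borel_groupoid \<Rightarrow> 'x \<Rightarrow> 'a set" where
  "src_fibre G x = {\<gamma> \<in> space (arrows G). src G \<gamma> = x}"

definition groupoid_integral ::
    "('a, 'x) borel_groupoid \<Rightarrow> 'x measure \<Rightarrow> ('a \<Rightarrow> ennreal) \<Rightarrow> ennreal" where
  "groupoid_integral G \<mu> F = (\<integral>\<^sup>+x. (\<integral>\<^sup>+\<gamma>. F \<gamma> \<partial>count_space (src_fibre G x)) \<partial>\<mu>)"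

definition groupoid_measure :: "('a, 'x) borel_groupoid \<Rightarrow> 'x measure \<Rightarrow> 'a set \<Rightarrow> ennreal" where
  "groupoid_measure G \<mu> A = groupoid_integral G \<mu> (indicator A)"

definition reduction :: "('a, 'x) borel_groupoid \<Rightarrow> 'x set \<Rightarrow> ('a, 'x) borel_groupoid" where
  "reduction G U = G\<lparr>units := units G \<inter> U,
     arrows := restrict_space (arrows G) {\<gamma>. rng G \<gamma> \<in> U \<and> src G \<gamma> \<in> U}\<rparr>"

definition orbit_groupoid ::
    "('g, 'b) monoid_scheme \<Rightarrow> 'x measure \<Rightarrow> ('g \<Rightarrow> 'x \<Rightarrow> 'x) \<Rightarrow> ('x \<times> 'x, 'x) borel_groupoid" where
  "orbit_groupoid \<Gamma> \<mu> \<phi> =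
     \<lparr>units = space \<mu>,
      arrows = restrict_space (\<mu> \<Otimes>\<^sub>M \<mu>) {(x, y). \<exists>C\<in>orbits \<Gamma> (space \<mu>) \<phi>. x \<in> C \<and> y \<in> C},
      rng = fst,
      src = snd,
      comp = (\<lambda>a b. (fst a, snd b)),
      arr_inv = prod.swap,
      unit_arrow = (\<lambda>x. (x, x))\<rparr>"


section \<open>Property (H)\<close>

definition positive_semidefinite_mat :: "nat \<Rightarrow> (nat \<Rightarrow> nat \<Rightarrow> complex) \<Rightarrow> bool" where
  "positive_semidefinite_mat k A \<longleftrightarrow>
     (\<forall>c :: nat \<Rightarrow> complex. (\<Sum>i<k. \<Sum>j<k. cnj (c i) * c j * A i j) \<in> \<real>\<^sub>\<ge>\<^sub>0)"

definition positive_definite_fun ::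
    "('a, 'x) borel_groupoid \<Rightarrow> 'x measure \<Rightarrow> ('a \<Rightarrow> complex) \<Rightarrow> bool" where
  "positive_definite_fun G \<mu> F \<longleftrightarrow>
     F \<in> borel_measurable (arrows G) \<and>
     (\<exists>N\<in>null_sets \<mu>. \<forall>x\<in>units G - N. \<forall>k. \<forall>\<gamma> :: nat \<Rightarrow> 'a.
        (\<forall>i<k. \<gamma> i \<in> rng_fibre G x) \<longrightarrow>
        positive_semidefinite_mat k (\<lambda>i j. F (comp G (arr_inv G (\<gamma> i)) (\<gamma> j))))"

definition property_H :: "('a, 'x) borel_groupoid \<Rightarrow> 'x measure \<Rightarrow> bool" where
  "property_H G \<mu> \<longleftrightarrow>
     (\<exists>F :: nat \<Rightarrow> 'a \<Rightarrow> complex.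
        (\<forall>n. positive_definite_fun G \<mu> (F n)) \<and>
        (\<forall>n. AE x in \<mu>. F n (unit_arrow G x) = 1) \<and>
        (\<forall>n. \<forall>\<epsilon>>0. groupoid_measure G \<mu> {\<gamma> \<in> space (arrows G). cmod (F n \<gamma>) > \<epsilon>} < \<infinity>) \<and>
        (\<exists>N\<in>sets (arrows G). groupoid_measure G \<mu> N = 0 \<and>
           (\<forall>\<gamma>\<in>space (arrows G) - N. (\<lambda>n. F n \<gamma>) \<longlonglongrightarrow> 1)))"


section \<open>Treeability\<close>

text \<open>
  A graph is a vertex set \<open>V\<close> with an adjacency relation on it.  A cycle is a list of at
  least three distinct vertices, cyclically adjacent.  (Trees of the library theory of digraphs
  do not fit, as \<open>a, b, a\<close> counts as a cycle there.)
\<close>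

definition tree_graph :: "'v set \<Rightarrow> ('v \<Rightarrow> 'v \<Rightarrow> bool) \<Rightarrow> bool" where
  "tree_graph V adj \<longleftrightarrow>
     V \<noteq> {} \<and>
     (\<forall>u\<in>V. \<not> adj u u) \<and>
     (\<forall>u\<in>V. \<forall>v\<in>V. adj u v \<longrightarrow> adj v u) \<and>
     (\<forall>u\<in>V. \<forall>v\<in>V. (u, v) \<in> {(a, b). a \<in> V \<and> b \<in> V \<and> adj a b}\<^sup>*) \<and>
     \<not> (\<exists>p. set p \<subseteq> V \<and> 3 \<le> length p \<and> distinct p \<and> successively adj p \<and> adj (last p) (hd p))"

primrec arrow_pow :: "('a, 'x) borel_groupoid \<Rightarrow> 'a set \<Rightarrow> nat \<Rightarrow> 'a set" where
  "arrow_pow G Q 0 = unit_arrow G ` units G"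
| "arrow_pow G Q (Suc n) = {comp G a b |a b. a \<in> arrow_pow G Q n \<and> b \<in> Q \<and> src G a = rng G b}"

definition treeing :: "('a, 'x) borel_groupoid \<Rightarrow> 'a set \<Rightarrow> bool" where
  "treeing G Q \<longleftrightarrow>
     Q \<in> sets (arrows G) \<and>
     arr_inv G ` Q = Q \<and>
     Q \<inter> unit_arrow G ` units G = {} \<and>
     (\<Union>n. arrow_pow G Q n) = space (arrows G) \<and>
     (\<forall>x\<in>units G. tree_graph (rng_fibre G x) (\<lambda>\<gamma>1 \<gamma>2. comp G (arr_inv G \<gamma>1) \<gamma>2 \<in> Q))"

definition treeable :: "('a, 'x) borel_groupoid \<Rightarrow> 'x measure \<Rightarrow> bool" where
  "treeable G \<mu> \<longleftrightarrow>
     (\<exists>U\<in>sets \<mu>. emeasure \<mu> (space \<mu> - U) = 0 \<and> (\<exists>Q. treeing (reduction G U) Q))"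

end

theory Submission
  imports Defs
begin

text \<open>
  Suppose that positive definite functions \<open>F n\<close> witness property (H).  Then
  \<open>g \<mapsto> \<integral> F n (g x, x) d\<mu>\<close> are positive definite on the group and tend to 1, so by
  property (T) the cyclic representation attached to one of them (realised on a sequence space
  through a Cholesky factorisation) has a nonzero invariant vector, and the averages of this
  function against finitely supported probabilities on the group stay away from 0.  But
  \<open>F n\<close> is small off finitely many graphs \<open>{(g x, x)}\<close>, up to small measure, and as almost
  all orbits are infinite there are probabilities \<open>p\<close> on the group whose images under
  \<open>g \<mapsto> g x\<close> have no large atoms: for these the averages tend to 0.

  A treeing gives property (H): weight its edges so that only boundedly many edges at a vertex
  have weight at most \<open>r\<close>, and take \<open>\<rho>\<close> to the power of the weighted tree distance with
  \<open>\<rho>\<close> tending to 1.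
\<close>

section \<open>Positive semidefinite kernels\<close>

text \<open>The action need not be free. Stabilisers can be infinite, so the functions that the
  \<open>F n\<close> induce on the group need not vanish at infinity, and property (T) cannot be
  played off against decay on the group. What survives is decay relative to coincidences: up to
  small measure, \<open>F n\<close> is large at \<open>(g x, x)\<close> only where
  \<open>g x\<close> agrees with one of finitely many fixed translates of \<open>x\<close>. Hence
  the averages must run over lists whose entries rarely coincide at a random point; distinct entries
  are not enough, and such lists come from an energy argument.

  \<open>property_T\<close> tests only Hilbert spaces carried by sequences. Factoring the Gram
  matrix, rather than completing a quotient space, produces such a carrier directly, and a
  triangular factor makes the orbit vectors finitely supported, so translations are computed
  coordinate by coordinate.

  A treeing may have infinite valency, and then powers of the plain graph distance can have level
  sets of infinite measure. The edge weights, read off from an enumeration of the group, repair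
  this.\<close>

definition psd_kernel :: "(nat \<Rightarrow> nat \<Rightarrow> complex) \<Rightarrow> bool" where
  "psd_kernel k \<longleftrightarrow> (\<forall>n c. (\<Sum>i<n. \<Sum>j<n. c i * cnj (c j) * k i j) \<in> \<real>\<^sub>\<ge>\<^sub>0)"

lemma psd_kernelD:
  assumes "psd_kernel k"
  shows "(\<Sum>i<n. \<Sum>j<n. c i * cnj (c j) * k i j) \<in> \<real>\<^sub>\<ge>\<^sub>0"
  using assms unfolding psd_kernel_def by blast

lemma psd_kernel_finite:
  assumes "psd_kernel k" "finite A"
  shows "(\<Sum>i\<in>A. \<Sum>j\<in>A. c i * cnj (c j) * k i j) \<in> \<real>\<^sub>\<ge>\<^sub>0"
proof -
  obtain n where n: "A \<subseteq> {..<n}" using assms(2) finite_nat_bounded by auto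
  let ?c = "\<lambda>i. if i \<in> A then c i else 0"
  have "(\<Sum>i<n. \<Sum>j<n. ?c i * cnj (?c j) * k i j) = (\<Sum>i\<in>A. \<Sum>j<n. ?c i * cnj (?c j) * k i j)"
    by (rule sum.mono_neutral_right) (use n in auto)
  also have "\<dots> = (\<Sum>i\<in>A. \<Sum>j\<in>A. ?c i * cnj (?c j) * k i j)"
    by (intro sum.cong refl sum.mono_neutral_right) (use n in auto)
  finally show ?thesis using psd_kernelD[OF assms(1), where n = n and c = ?c] by simp
qed

lemma psd_kernel_diag:
  assumes "psd_kernel k"
  shows "k i i \<in> \<real>\<^sub>\<ge>\<^sub>0"
  using psd_kernel_finite[OF assms, of "{i}" "\<lambda>_. 1"] by simp

text \<open>Lying in the nonnegative reals includes being real. The coefficients (1, 1) then compare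
  the imaginary parts of the two entries, and (1, \<open>\<i>\<close>) their real parts.\<close>

lemma psd_kernel_hermitian:
  assumes "psd_kernel k"
  shows "k j i = cnj (k i j)"
proof (cases "i = j")
  case True
  then show ?thesis using psd_kernel_diag[OF assms, of i] by (auto simp: complex_nonneg_Reals_iff complex_eq_iff)
next
  case False
  have 1: "Im (k i i) = 0" "Im (k j j) = 0"
    using psd_kernel_diag[OF assms] by (auto simp: complex_nonneg_Reals_iff)
  have "(\<Sum>a\<in>{i,j}. \<Sum>b\<in>{i,j}. (\<lambda>_. 1) a * cnj ((\<lambda>_. 1) b) * k a b) \<in> \<real>\<^sub>\<ge>\<^sub>0"
    by (rule psd_kernel_finite[OF assms]) auto
  then have 2: "Im (k i j) + Im (k j i) = 0" using False 1 by (simp add: complex_nonneg_Reals_iff)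
  have "(\<Sum>a\<in>{i,j}. \<Sum>b\<in>{i,j}. (\<lambda>x. if x = i then 1 else \<i>) a * cnj ((\<lambda>x. if x = i then 1 else \<i>) b) * k a b) \<in> \<real>\<^sub>\<ge>\<^sub>0"
    by (rule psd_kernel_finite[OF assms]) auto
  then have 3: "Re (k j i) = Re (k i j)" using False 1 by (simp add: complex_nonneg_Reals_iff split: if_splits)
  show ?thesis using 2 3 by (simp add: complex_eq_iff)
qed

lemma psd_kernel_zero:
  assumes "psd_kernel k" "k p p = 0"
  shows "k i p = 0"
proof (rule ccontr)
  assume nz: "k i p \<noteq> 0"
  then have ip: "i \<noteq> p" using assms(2) by auto
  \<comment> \<open>As \<open>k p p = 0\<close>, the form is affine in \<open>t\<close>; this choice
    makes its value \<open>- Re (k i i) - 2\<close>, which is negative.\<close>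
  define t where "t = - (Re (k i i) + 1) / (cmod (k i p))\<^sup>2"
  define c where "c = (\<lambda>x. if x = i then 1 else of_real t * k i p)"
  have "(\<Sum>a\<in>{i,p}. \<Sum>b\<in>{i,p}. c a * cnj (c b) * k a b) \<in> \<real>\<^sub>\<ge>\<^sub>0"
    by (rule psd_kernel_finite[OF assms(1)]) auto
  moreover have "(\<Sum>a\<in>{i,p}. \<Sum>b\<in>{i,p}. c a * cnj (c b) * k a b)
      = k i i + of_real t * (cnj (k i p) * k i p) + of_real t * (k i p * k p i)"
    using ip assms(2) by (simp add: c_def)
  moreover have "k p i = cnj (k i p)" by (rule psd_kernel_hermitian[OF assms(1)])
  moreover have "k i p * cnj (k i p) = of_real ((cmod (k i p))\<^sup>2)" by (rule complex_norm_square[symmetric])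
  ultimately have "k i i + of_real (2 * (t * (cmod (k i p))\<^sup>2)) \<in> \<real>\<^sub>\<ge>\<^sub>0"
    by (simp add: mult.commute[of "cnj (k i p)"] add.assoc)
  moreover have "t * (cmod (k i p))\<^sup>2 = - (Re (k i i) + 1)" using nz by (simp add: t_def)
  ultimately have "Re (k i i) - 2 * (Re (k i i) + 1) \<ge> 0" by (simp add: complex_nonneg_Reals_iff)
  moreover have "Re (k i i) \<ge> 0" using psd_kernel_diag[OF assms(1), of i] by (simp add: complex_nonneg_Reals_iff)
  ultimately show False by simp
qed

text \<open>For a Gram matrix this projects all vectors onto the orthogonal complement of the
  \<open>p\<close>-th. Positivity comes from completing the square: the new form at \<open>d\<close>
  is the old one at \<open>d\<close> with its coefficient at \<open>p\<close> shifted by the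
  minimising \<open>t\<close>. If \<open>k p p = 0\<close>, division by zero leaves the kernel
  unchanged.\<close>

lemma psd_kernel_schur:
  assumes k: "psd_kernel k"
  shows "psd_kernel (\<lambda>i j. k i j - k i p * k p j / k p p)"
proof (cases "k p p = 0")
  case True then show ?thesis using k by simp
next
  case nz: False
  show ?thesis unfolding psd_kernel_def
  proof (intro allI)
    let ?k = "\<lambda>i j. k i j - k i p * k p j / k p p"
    fix n and c :: "nat \<Rightarrow> complex"
    \<comment> \<open>\<open>p\<close> may lie outside \<open>{..<n}\<close>, but the shifted test
      vector needs a coordinate there.\<close>
    define A where "A = insert p {..<n}"
    define d where "d = (\<lambda>i. if i < n then c i else 0)"
    define S where "S = (\<Sum>i\<in>A. d i * k i p)"
    define t where "t = - S / k p p"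
    have fin: "finite A" "p \<in> A" by (auto simp: A_def)
    have herm: "k p j = cnj (k j p)" for j by (rule psd_kernel_hermitian[OF k])
    have real: "cnj (k p p) = k p p" using herm[of p] by simp
    have S': "(\<Sum>j\<in>A. cnj (d j) * k p j) = cnj S" by (simp add: S_def herm)
    have E0: "x + cnj t * S + t * cnj S + t * cnj t * k p p = x - S * cnj S / k p p" for x
      using nz real by (simp add: t_def field_simps)
    have "(\<Sum>i\<in>A. \<Sum>j\<in>A. (d i + t * of_bool (i = p)) * cnj (d j + t * of_bool (j = p)) * k i j)
       = (\<Sum>i\<in>A. \<Sum>j\<in>A. d i * cnj (d j) * k i j) + (\<Sum>i\<in>A. \<Sum>j\<in>A. d i * cnj (t * of_bool (j = p)) * k i j)
        + (\<Sum>i\<in>A. \<Sum>j\<in>A. t * of_bool (i = p) * cnj (d j) * k i j)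
        + (\<Sum>i\<in>A. \<Sum>j\<in>A. t * of_bool (i = p) * cnj (t * of_bool (j = p)) * k i j)"
      by (simp add: sum.distrib algebra_simps)
    also have "(\<Sum>i\<in>A. \<Sum>j\<in>A. d i * cnj (t * of_bool (j = p)) * k i j) = cnj t * S"
    proof -
      have "(\<Sum>i\<in>A. \<Sum>j\<in>A. d i * cnj (t * of_bool (j = p)) * k i j)
          = (\<Sum>i\<in>A. \<Sum>j\<in>A. if j = p then d i * cnj t * k i p else 0)"
        by (intro sum.cong refl) auto
      then show ?thesis using fin by (simp add: S_def sum_distrib_left algebra_simps)
    qed
    also have "(\<Sum>i\<in>A. \<Sum>j\<in>A. t * of_bool (i = p) * cnj (d j) * k i j) = t * cnj S"
    proof -
      have "(\<Sum>i\<in>A. \<Sum>j\<in>A. t * of_bool (i = p) * cnj (d j) * k i j)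
          = (\<Sum>i\<in>A. if i = p then t * (\<Sum>j\<in>A. cnj (d j) * k i j) else 0)"
        by (intro sum.cong refl) (simp add: sum_distrib_left algebra_simps)
      then show ?thesis using fin S' by simp
    qed
    also have "(\<Sum>i\<in>A. \<Sum>j\<in>A. t * of_bool (i = p) * cnj (t * of_bool (j = p)) * k i j) = t * cnj t * k p p"
    proof -
      have "(\<Sum>i\<in>A. \<Sum>j\<in>A. t * of_bool (i = p) * cnj (t * of_bool (j = p)) * k i j)
          = (\<Sum>i\<in>A. if i = p then (\<Sum>j\<in>A. if j = p then t * cnj t * k p p else 0) else 0)"
        by (intro sum.cong refl) (auto intro!: sum.cong sum.neutral)
      then show ?thesis using fin by simp
    qed
    finally have E: "(\<Sum>i\<in>A. \<Sum>j\<in>A. (d i + t * of_bool (i = p)) * cnj (d j + t * of_bool (j = p)) * k i j)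
      = (\<Sum>i\<in>A. \<Sum>j\<in>A. d i * cnj (d j) * k i j) - S * cnj S / k p p"
      by (simp only: E0)
    have "(\<Sum>i\<in>A. \<Sum>j\<in>A. d i * cnj (d j) * ?k i j)
       = (\<Sum>i\<in>A. \<Sum>j\<in>A. d i * cnj (d j) * k i j) - (\<Sum>i\<in>A. \<Sum>j\<in>A. (d i * k i p) * (cnj (d j) * k p j)) / k p p"
      by (simp add: sum_subtractf sum_divide_distrib algebra_simps)
    also have "(\<Sum>i\<in>A. \<Sum>j\<in>A. (d i * k i p) * (cnj (d j) * k p j)) = S * cnj S"
      by (simp add: sum_product[symmetric] S' S_def[symmetric])
    finally have "(\<Sum>i\<in>A. \<Sum>j\<in>A. d i * cnj (d j) * ?k i j) \<in> \<real>\<^sub>\<ge>\<^sub>0"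
      using E psd_kernel_finite[OF k fin(1), of "\<lambda>i. d i + t * of_bool (i = p)"] by simp
    moreover have "(\<Sum>i\<in>A. \<Sum>j\<in>A. d i * cnj (d j) * ?k i j)
       = (\<Sum>i<n. \<Sum>j\<in>A. d i * cnj (d j) * ?k i j)"
      by (rule sum.mono_neutral_right) (use fin in \<open>auto simp: A_def d_def\<close>)
    moreover have "\<dots> = (\<Sum>i<n. \<Sum>j<n. d i * cnj (d j) * ?k i j)"
      by (intro sum.cong refl sum.mono_neutral_right) (use fin in \<open>auto simp: A_def d_def\<close>)
    moreover have "\<dots> = (\<Sum>i<n. \<Sum>j<n. c i * cnj (c j) * ?k i j)"
      by (intro sum.cong refl) (auto simp: d_def)
    ultimately show "(\<Sum>i<n. \<Sum>j<n. c i * cnj (c j) * ?k i j) \<in> \<real>\<^sub>\<ge>\<^sub>0"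
      by simp
  qed
qed

fun schur_iterate :: "(nat \<Rightarrow> nat \<Rightarrow> complex) \<Rightarrow> nat \<Rightarrow> nat \<Rightarrow> nat \<Rightarrow> complex" where
  "schur_iterate k 0 i j = k i j"
| "schur_iterate k (Suc m) i j = schur_iterate k m i j
     - schur_iterate k m i m * schur_iterate k m m j / schur_iterate k m m m"

lemma psd_schur_iterate: "psd_kernel k \<Longrightarrow> psd_kernel (schur_iterate k m)"
proof (induction m)
  case 0
  moreover have "schur_iterate k 0 = k" by (intro ext) simp
  ultimately show ?case by simp
next
  case (Suc m)
  have "schur_iterate k (Suc m) = (\<lambda>i j. schur_iterate k m i j
     - schur_iterate k m i m * schur_iterate k m m j / schur_iterate k m m m)" by (intro ext) simp
  then show ?case using psd_kernel_schur[OF Suc.IH[OF Suc.prems]] by simp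
qed

text \<open>Stage \<open>p\<close> clears column \<open>p\<close>, by subtraction if the pivot is
  nonzero and by \<open>psd_kernel_zero\<close> otherwise. Later stages subtract multiples of
  entries of that column and so keep it zero.\<close>

lemma schur_iterate_zero:
  assumes k: "psd_kernel k" and "p < m"
  shows "schur_iterate k m i p = 0"
  using \<open>p < m\<close>
proof (induction m arbitrary: i)
  case (Suc m)
  note psd = psd_schur_iterate[OF k, of m]
  show ?case
  proof (cases "p = m")
    case True
    then show ?thesis using psd_kernel_zero[OF psd, of m i] by (cases "schur_iterate k m m m = 0") auto
  next
    case False
    then have "p < m" using Suc.prems by simp
    then show ?thesis using Suc.IH by simp
  qed
qed simp

text \<open>Iterated Schur complements; a zero pivot is harmless since \<open>x / 0 = 0\<close>.\<close>

lemma psd_kernel_cholesky: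
  assumes k: "psd_kernel k"
  obtains v :: "nat \<Rightarrow> nat \<Rightarrow> complex" where
    "\<And>i m. i < m \<Longrightarrow> v i m = 0"
    "\<And>i m. v m m = 0 \<Longrightarrow> v i m = 0"
    "\<And>i j n. i < n \<Longrightarrow> k i j = (\<Sum>m<n. v i m * cnj (v j m))"
proof
  define K where "K = schur_iterate k"
  \<comment> \<open>Column \<open>m\<close> of the factor, scaled so that
    \<open>v i m * cnj (v j m)\<close> is exactly the rank one term subtracted at stage
    \<open>m\<close>.\<close>
  define v where "v = (\<lambda>i m. K m i m / of_real (sqrt (Re (K m m m))))"
  note psd = psd_schur_iterate[OF k, folded K_def]
  have herm: "K m j i = cnj (K m i j)" for m i j by (rule psd_kernel_hermitian[OF psd])
  have zero: "K m i p = 0" "K m p i = 0" if "p < m" for m i p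
    using schur_iterate_zero[OF k that, folded K_def, of i] herm[of m i p] by auto
  have diag: "K m m m = of_real (Re (K m m m))" "Re (K m m m) \<ge> 0" for m
    using psd_kernel_diag[OF psd, of m m] by (auto simp: complex_nonneg_Reals_iff complex_eq_iff)
  show "v i m = 0" if "i < m" for i m using zero(2)[OF that] by (simp add: v_def)
  show "v i m = 0" if "v m m = 0" for i m
  proof (cases "K m m m = 0")
    case True then show ?thesis by (simp add: v_def)
  next
    case False
    then have "Re (K m m m) \<noteq> 0" using diag(1)[of m] by auto
    then show ?thesis using that False by (simp add: v_def)
  qed
  have vv: "v i m * cnj (v j m) = K m i m * K m m j / K m m m" for i j m
  proof -
    have "v i m * cnj (v j m) = K m i m * cnj (K m j m) / of_real (sqrt (Re (K m m m)) * sqrt (Re (K m m m)))"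
      by (simp only: v_def of_real_mult complex_cnj_divide complex_cnj_complex_of_real times_divide_times_eq)
    also have "sqrt (Re (K m m m)) * sqrt (Re (K m m m)) = Re (K m m m)" using diag(2)[of m] by simp
    finally show ?thesis by (simp only: diag(1)[of m, symmetric] herm[of m m j])
  qed
  have sum: "k i j = (\<Sum>m<n. v i m * cnj (v j m)) + K n i j" for i j n
    by (induction n) (auto simp: vv K_def)
  then show "k i j = (\<Sum>m<n. v i m * cnj (v j m))" if "i < n" for i j n
    using sum[of i j n] zero(2)[OF that, of j] by simp
qed

section \<open>The unitary representation of a positive definite function\<close>

definition ell2 :: "nat set \<Rightarrow> (nat \<Rightarrow> complex) set" where
  "ell2 M = {x. (\<forall>m. m \<notin> M \<longrightarrow> x m = 0) \<and> summable (\<lambda>m. (cmod (x m))\<^sup>2)}"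

definition l2ip :: "(nat \<Rightarrow> complex) \<Rightarrow> (nat \<Rightarrow> complex) \<Rightarrow> complex" where
  "l2ip x y = (\<Sum>m. x m * cnj (y m))"

definition ell2_module :: "nat set \<Rightarrow> (complex, nat \<Rightarrow> complex) module" where
  "ell2_module M = \<lparr>carrier = ell2 M, mult = (\<lambda>x y. undefined), one = undefined, zero = (\<lambda>m. 0),
     add = (\<lambda>x y m. x m + y m), smult = (\<lambda>c x m. c * x m)\<rparr>"

lemma ell2_module_simps [simp]:
  "carrier (ell2_module M) = ell2 M"
  "zero (ell2_module M) = (\<lambda>m. 0)"
  "add (ell2_module M) x y = (\<lambda>m. x m + y m)"
  "smult (ell2_module M) c x = (\<lambda>m. c * x m)"
  by (simp_all add: ell2_module_def)

lemma ell2_support: "x \<in> ell2 M \<Longrightarrow> m \<notin> M \<Longrightarrow> x m = 0"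
  by (simp add: ell2_def)

lemma ell2_summable: "x \<in> ell2 M \<Longrightarrow> summable (\<lambda>m. (cmod (x m))\<^sup>2)"
  by (simp add: ell2_def)

lemma cmod_mult_le: "cmod (a * cnj b) \<le> (cmod a)\<^sup>2 + (cmod b)\<^sup>2"
proof -
  have "0 \<le> (cmod a - cmod b)\<^sup>2" "0 \<le> cmod a * cmod b" by auto
  then have "cmod a * cmod b \<le> (cmod a)\<^sup>2 + (cmod b)\<^sup>2" by (simp only: power2_diff)
  then show ?thesis by (simp add: norm_mult)
qed

lemma summable_l2ip:
  assumes "summable (\<lambda>m. (cmod (x m))\<^sup>2)" "summable (\<lambda>m. (cmod (y m))\<^sup>2)"
  shows "summable (\<lambda>m. x m * cnj (y m))"
  by (rule summable_comparison_test'[OF summable_add[OF assms], of 0]) (simp add: cmod_mult_le)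

lemma ell2_add:
  assumes "x \<in> ell2 M" "y \<in> ell2 M"
  shows "(\<lambda>m. x m + y m) \<in> ell2 M"
proof -
  have "(cmod (x m + y m))\<^sup>2 \<le> 2 * ((cmod (x m))\<^sup>2 + (cmod (y m))\<^sup>2)" for m
  proof -
    have "(cmod (x m + y m))\<^sup>2 \<le> (cmod (x m) + cmod (y m))\<^sup>2"
      by (intro power_mono norm_triangle_ineq) auto
    moreover have "0 \<le> (cmod (x m) - cmod (y m))\<^sup>2" by simp
    ultimately show ?thesis by (simp add: power2_eq_square algebra_simps)
  qed
  then have "summable (\<lambda>m. (cmod (x m + y m))\<^sup>2)"
    by (intro summable_comparison_test'[OF summable_mult[OF summable_add[OF
        ell2_summable[OF assms(1)] ell2_summable[OF assms(2)]], of 2], of 0]) simp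
  then show ?thesis using assms by (simp add: ell2_def)
qed

lemma ell2_smult: "x \<in> ell2 M \<Longrightarrow> (\<lambda>m. c * x m) \<in> ell2 M"
  by (auto simp: ell2_def norm_mult power_mult_distrib intro: summable_mult)

lemma ell2_zero: "(\<lambda>m. 0) \<in> ell2 M"
  by (simp add: ell2_def)

lemma ell2_diff: "x \<in> ell2 M \<Longrightarrow> y \<in> ell2 M \<Longrightarrow> (\<lambda>m. x m - y m) \<in> ell2 M"
  using ell2_add[OF _ ell2_smult[of y M "-1"], of x] by simp

lemma ell2_finite_support:
  assumes "finite {m. x m \<noteq> 0}" "{m. x m \<noteq> 0} \<subseteq> M"
  shows "x \<in> ell2 M"
proof -
  have "summable (\<lambda>m. (cmod (x m))\<^sup>2)" by (rule summable_finite[OF assms(1)]) auto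
  then show ?thesis using assms(2) by (auto simp: ell2_def)
qed

lemma l2ip_self:
  assumes "summable (\<lambda>m. (cmod (x m))\<^sup>2)"
  shows "l2ip x x = of_real (\<Sum>m. (cmod (x m))\<^sup>2)"
  unfolding l2ip_def complex_norm_square[symmetric] by (rule suminf_of_real[OF assms, symmetric])

lemma hnorm_l2ip: "x \<in> ell2 M \<Longrightarrow> hnorm l2ip x = sqrt (\<Sum>m. (cmod (x m))\<^sup>2)"
  by (simp add: hnorm_def l2ip_self[OF ell2_summable])

lemma l2ip_cnj:
  assumes "summable (\<lambda>m. x m * cnj (y m))"
  shows "l2ip y x = cnj (l2ip x y)"
proof -
  have "(\<lambda>m. cnj (x m * cnj (y m))) sums cnj (l2ip x y)"
    using assms by (simp only: sums_cnj l2ip_def summable_sums)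
  then show ?thesis by (simp add: l2ip_def mult.commute sums_iff)
qed

lemma abelian_group_ell2: "abelian_group (ell2_module M)"
proof (rule abelian_groupI)
  fix x assume x: "x \<in> carrier (ell2_module M)"
  show "\<exists>y\<in>carrier (ell2_module M). y \<oplus>\<^bsub>ell2_module M\<^esub> x = \<zero>\<^bsub>ell2_module M\<^esub>"
    by (rule bexI[of _ "\<lambda>m. - 1 * x m"]) (use x ell2_smult[of x M "-1"] in auto)
qed (auto simp: ell2_add ell2_zero algebra_simps)

lemma ell2_minus [simp]:
  assumes "x \<in> ell2 M" "y \<in> ell2 M"
  shows "x \<ominus>\<^bsub>ell2_module M\<^esub> y = (\<lambda>m. x m - y m)"
proof -
  interpret abelian_group "ell2_module M" by (rule abelian_group_ell2)
  have "\<ominus>\<^bsub>ell2_module M\<^esub> y = (\<lambda>m. - 1 * y m)"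
    by (rule minus_equality) (use assms ell2_smult[of y M "-1"] in auto)
  then show ?thesis by (simp add: a_minus_def)
qed

lemma cring_complex: "cring complex_ring"
proof (rule cringI)
  show "abelian_group complex_ring"
  proof (rule abelian_groupI)
    fix x :: complex
    show "\<exists>y\<in>carrier complex_ring. y \<oplus>\<^bsub>complex_ring\<^esub> x = \<zero>\<^bsub>complex_ring\<^esub>"
      by (rule bexI[of _ "- x"]) (auto simp: complex_ring_def)
  qed (auto simp: complex_ring_def)
  show "comm_monoid complex_ring"
    by (rule comm_monoidI) (auto simp: complex_ring_def)
qed (auto simp: complex_ring_def algebra_simps)

lemma module_ell2: "Module.module complex_ring (ell2_module M)"
  by (rule moduleI[OF cring_complex abelian_group_ell2])
    (auto simp: ell2_add ell2_smult complex_ring_def algebra_simps)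

lemma ell2_complete:
  fixes v :: "nat \<Rightarrow> nat \<Rightarrow> complex"
  assumes v: "\<And>n. v n \<in> ell2 M"
    and C: "\<And>e. 0 < e \<Longrightarrow> \<exists>N. \<forall>m\<ge>N. \<forall>n\<ge>N. sqrt (\<Sum>i. (cmod (v m i - v n i))\<^sup>2) < e"
  shows "\<exists>l\<in>ell2 M. (\<lambda>n. sqrt (\<Sum>i. (cmod (v n i - l i))\<^sup>2)) \<longlonglongrightarrow> 0"
proof -
  have sm: "summable (\<lambda>i. (cmod (v m i - v n i))\<^sup>2)" for m n
    using ell2_summable[OF ell2_diff[OF v v]] .
  have coord: "cmod (v m i - v n i) \<le> sqrt (\<Sum>i. (cmod (v m i - v n i))\<^sup>2)" for m n i
  proof -
    have "(\<Sum>i\<in>{i}. (cmod (v m i - v n i))\<^sup>2) \<le> (\<Sum>i. (cmod (v m i - v n i))\<^sup>2)"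
      by (rule sum_le_suminf[OF sm]) auto
    then show ?thesis by (intro real_le_rsqrt) simp
  qed
  have "Cauchy (\<lambda>n. v n i)" for i
  proof (rule CauchyI)
    fix e :: real assume "0 < e"
    then obtain N where "\<forall>m\<ge>N. \<forall>n\<ge>N. sqrt (\<Sum>i. (cmod (v m i - v n i))\<^sup>2) < e" using C by blast
    then show "\<exists>N. \<forall>m\<ge>N. \<forall>n\<ge>N. cmod (v m i - v n i) < e"
      using coord by (meson le_less_trans)
  qed
  then have "\<exists>l. (\<lambda>n. v n i) \<longlonglongrightarrow> l" for i
    using Cauchy_convergent_iff convergent_def by blast
  then obtain l where l: "\<And>i. (\<lambda>n. v n i) \<longlonglongrightarrow> l i" by metis
  have tail: "\<exists>N. \<forall>n\<ge>N. summable (\<lambda>i. (cmod (v n i - l i))\<^sup>2) \<and> sqrt (\<Sum>i. (cmod (v n i - l i))\<^sup>2) \<le> e"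
    if e: "0 < e" for e
  proof -
    obtain N where N: "\<And>m n. m \<ge> N \<Longrightarrow> n \<ge> N \<Longrightarrow> sqrt (\<Sum>i. (cmod (v m i - v n i))\<^sup>2) < e"
      using C[OF e] by blast
    \<comment> \<open>Fatou for series: the bound on each finite partial sum passes to the
      coordinatewise limit in \<open>n\<close>.\<close>
    have part: "(\<Sum>i<k. (cmod (v m i - l i))\<^sup>2) \<le> e\<^sup>2" if m: "m \<ge> N" for m k
    proof (rule tendsto_upperbound)
      show "(\<lambda>n. \<Sum>i<k. (cmod (v m i - v n i))\<^sup>2) \<longlonglongrightarrow> (\<Sum>i<k. (cmod (v m i - l i))\<^sup>2)"
        by (intro tendsto_intros l)
      show "\<forall>\<^sub>F n in sequentially. (\<Sum>i<k. (cmod (v m i - v n i))\<^sup>2) \<le> e\<^sup>2"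
      proof (rule eventually_sequentiallyI[of N])
        fix n assume n: "n \<ge> N"
        have "(\<Sum>i<k. (cmod (v m i - v n i))\<^sup>2) \<le> (\<Sum>i. (cmod (v m i - v n i))\<^sup>2)"
          by (rule sum_le_suminf[OF sm]) auto
        also have "\<dots> \<le> e\<^sup>2"
          using N[OF m n] e by (meson less_imp_le real_sqrt_le_iff sqrt_le_D)
        finally show "(\<Sum>i<k. (cmod (v m i - v n i))\<^sup>2) \<le> e\<^sup>2" .
      qed
    qed simp
    have "summable (\<lambda>i. (cmod (v m i - l i))\<^sup>2)" if m: "m \<ge> N" for m
      by (rule summableI_nonneg_bounded[of _ "e\<^sup>2"]) (use part[OF m] in auto)
    moreover from this have "sqrt (\<Sum>i. (cmod (v m i - l i))\<^sup>2) \<le> e" if m: "m \<ge> N" for m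
      using suminf_le_const[OF _ part[OF m]] m e by (intro real_le_lsqrt) (auto intro: suminf_nonneg)
    ultimately show ?thesis by blast
  qed
  have "\<exists>n. summable (\<lambda>i. (cmod (v n i - l i))\<^sup>2)" using tail[of 1] by auto
  then obtain n where n: "summable (\<lambda>i. (cmod (v n i - l i))\<^sup>2)" by blast
  have lM: "l m = 0" if "m \<notin> M" for m
    using l[of m] LIMSEQ_unique[OF l[of m], of 0] ell2_support[OF v that] by simp
  have "(\<lambda>i. v n i - l i) \<in> ell2 M" using n lM ell2_support[OF v] by (simp add: ell2_def)
  from ell2_diff[OF v[of n] this] have "l \<in> ell2 M" by simp
  moreover have "(\<lambda>n. sqrt (\<Sum>i. (cmod (v n i - l i))\<^sup>2)) \<longlonglongrightarrow> 0"
  proof (rule LIMSEQ_I)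
    fix r :: real assume "0 < r"
    then obtain N where N: "\<forall>n\<ge>N. summable (\<lambda>i. (cmod (v n i - l i))\<^sup>2) \<and> sqrt (\<Sum>i. (cmod (v n i - l i))\<^sup>2) \<le> r / 2"
      using tail[of "r/2"] by auto
    then show "\<exists>N. \<forall>n\<ge>N. norm (sqrt (\<Sum>i. (cmod (v n i - l i))\<^sup>2) - 0) < r"
      using \<open>0 < r\<close> suminf_nonneg by (intro exI[of _ N]) fastforce
  qed
  ultimately show ?thesis by blast
qed

lemma complex_hilbert_space_ell2: "complex_hilbert_space (ell2_module M) l2ip"
proof -
  interpret Module.module complex_ring "ell2_module M" by (rule module_ell2)
  show ?thesis
  proof unfold_locales
    fix x y z assume "x \<in> carrier (ell2_module M)" "y \<in> carrier (ell2_module M)" "z \<in> carrier (ell2_module M)"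
    then show "l2ip (x \<oplus>\<^bsub>ell2_module M\<^esub> y) z = l2ip x z + l2ip y z"
      by (simp add: l2ip_def distrib_right suminf_add summable_l2ip ell2_summable)
  next
    fix x z c assume "x \<in> carrier (ell2_module M)" "z \<in> carrier (ell2_module M)"
    then show "l2ip (c \<odot>\<^bsub>ell2_module M\<^esub> x) z = c * l2ip x z"
      by (simp add: l2ip_def mult.assoc suminf_mult summable_l2ip ell2_summable)
  next
    fix x y assume "x \<in> carrier (ell2_module M)" "y \<in> carrier (ell2_module M)"
    then show "l2ip y x = cnj (l2ip x y)"
      by (intro l2ip_cnj summable_l2ip) (auto dest: ell2_summable)
  next
    fix x assume x: "x \<in> carrier (ell2_module M)" "x \<noteq> \<zero>\<^bsub>ell2_module M\<^esub>"
    then obtain i where "x i \<noteq> 0" by auto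
    then have "0 < (\<Sum>m. (cmod (x m))\<^sup>2)"
      using x by (intro suminf_pos2[of _ i]) (auto dest: ell2_summable)
    then show "0 < Re (l2ip x x)" using x by (simp add: l2ip_self ell2_summable)
  next
    fix v :: "nat \<Rightarrow> nat \<Rightarrow> complex"
    assume v: "\<And>n. v n \<in> carrier (ell2_module M)"
      and "\<And>e. 0 < e \<Longrightarrow> \<exists>N. \<forall>m\<ge>N. \<forall>n\<ge>N. hnorm l2ip (v m \<ominus>\<^bsub>ell2_module M\<^esub> v n) < e"
    moreover from v have "hnorm l2ip (\<lambda>i. v m i - v n i) = sqrt (\<Sum>i. (cmod (v m i - v n i))\<^sup>2)" for m n
      using hnorm_l2ip[OF ell2_diff, of "v m" M "v n"] by simp
    ultimately have "\<exists>l\<in>ell2 M. (\<lambda>n. sqrt (\<Sum>i. (cmod (v n i - l i))\<^sup>2)) \<longlonglongrightarrow> 0"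
      by (intro ell2_complete) auto
    then show "\<exists>l\<in>carrier (ell2_module M). (\<lambda>n. hnorm l2ip (v n \<ominus>\<^bsub>ell2_module M\<^esub> l)) \<longlonglongrightarrow> 0"
      using v hnorm_l2ip[OF ell2_diff, of "v _" M] by auto
  qed
qed

lemma l2ip_finite:
  assumes "finite A" "\<And>m. m \<notin> A \<Longrightarrow> y m = 0"
  shows "l2ip x y = (\<Sum>m\<in>A. x m * cnj (y m))"
  unfolding l2ip_def using assms by (intro suminf_finite) auto

text \<open>Pairing with a finitely supported vector makes sense for every sequence, so the
  translation operators can be handled before they are known to be bounded.\<close>

lemma summable_l2ip_finite:
  assumes "finite {m. y m \<noteq> 0}"
  shows "summable (\<lambda>m. x m * cnj (y m))"
  using assms by (rule summable_finite) auto

lemma l2ip_add_right: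
  assumes "summable (\<lambda>m. x m * cnj (y m))" "summable (\<lambda>m. x m * cnj (z m))"
  shows "l2ip x (\<lambda>m. y m + c * z m) = l2ip x y + cnj c * l2ip x z"
  using suminf_add[OF assms(1) summable_mult[OF assms(2), of "cnj c"]] suminf_mult[OF assms(2), of "cnj c"]
  by (simp add: l2ip_def algebra_simps)

lemma l2ip_add_left:
  assumes "summable (\<lambda>m. y m * cnj (x m))" "summable (\<lambda>m. z m * cnj (x m))"
  shows "l2ip (\<lambda>m. y m + c * z m) x = l2ip y x + c * l2ip z x"
  using suminf_add[OF assms(1) summable_mult[OF assms(2), of c]] suminf_mult[OF assms(2), of c]
  by (simp add: l2ip_def algebra_simps)

lemma l2ip_zero [simp]: "l2ip x (\<lambda>m. 0) = 0" "l2ip (\<lambda>m. 0) x = 0"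
  by (simp_all add: l2ip_def)

lemma l2ip_Cauchy_Schwarz:
  assumes x: "summable (\<lambda>m. (cmod (x m))\<^sup>2)" and y: "summable (\<lambda>m. (cmod (y m))\<^sup>2)"
  shows "(cmod (l2ip x y))\<^sup>2 \<le> (\<Sum>m. (cmod (x m))\<^sup>2) * (\<Sum>m. (cmod (y m))\<^sup>2)"
proof (rule tendsto_upperbound)
  show "(\<lambda>n. (cmod (\<Sum>m<n. x m * cnj (y m)))\<^sup>2) \<longlonglongrightarrow> (cmod (l2ip x y))\<^sup>2"
    unfolding l2ip_def by (intro tendsto_intros summable_LIMSEQ summable_l2ip x y)
  show "\<forall>\<^sub>F n in sequentially. (cmod (\<Sum>m<n. x m * cnj (y m)))\<^sup>2
      \<le> (\<Sum>m. (cmod (x m))\<^sup>2) * (\<Sum>m. (cmod (y m))\<^sup>2)"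
  proof (intro always_eventually allI)
    fix n
    have "cmod (\<Sum>m<n. x m * cnj (y m)) \<le> (\<Sum>m<n. cmod (x m) * cmod (y m))"
      by (rule order_trans[OF norm_sum]) (simp add: norm_mult)
    then have "(cmod (\<Sum>m<n. x m * cnj (y m)))\<^sup>2 \<le> (\<Sum>m<n. cmod (x m) * cmod (y m))\<^sup>2"
      by (intro power_mono) auto
    also have "\<dots> \<le> (\<Sum>m<n. (cmod (x m))\<^sup>2) * (\<Sum>m<n. (cmod (y m))\<^sup>2)"
      by (rule Cauchy_Schwarz_ineq_sum)
    also have "\<dots> \<le> (\<Sum>m. (cmod (x m))\<^sup>2) * (\<Sum>m. (cmod (y m))\<^sup>2)"
      by (intro mult_mono sum_le_suminf x y) (auto intro: sum_nonneg suminf_nonneg x)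
    finally show "(cmod (\<Sum>m<n. x m * cnj (y m)))\<^sup>2
      \<le> (\<Sum>m. (cmod (x m))\<^sup>2) * (\<Sum>m. (cmod (y m))\<^sup>2)" .
  qed
qed simp

text \<open>The vectors \<open>w g\<close> are finitely supported and span all finitely supported vectors on
  \<open>M\<close>; as left translation preserves their Gram matrix, it extends to a unitary
  representation on \<open>ell2 M\<close>.  The relation \<open>tr s y y'\<close> says that \<open>y'\<close> is
  the translate by \<open>s\<close> of the combination \<open>y\<close>.\<close>

inductive tr :: "('g, 'b) monoid_scheme \<Rightarrow> ('g \<Rightarrow> nat \<Rightarrow> complex) \<Rightarrow> 'g
    \<Rightarrow> (nat \<Rightarrow> complex) \<Rightarrow> (nat \<Rightarrow> complex) \<Rightarrow> bool"
  for \<Gamma> w s where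
  zero: "tr \<Gamma> w s (\<lambda>m. 0) (\<lambda>m. 0)"
| step: "tr \<Gamma> w s y y' \<Longrightarrow> g \<in> carrier \<Gamma> \<Longrightarrow>
    tr \<Gamma> w s (\<lambda>m. y m + c * w g m) (\<lambda>m. y' m + c * w (s \<otimes>\<^bsub>\<Gamma>\<^esub> g) m)"

lemma tr_add:
  assumes "tr \<Gamma> w s z z'" "tr \<Gamma> w s y y'"
  shows "tr \<Gamma> w s (\<lambda>m. y m + d * z m) (\<lambda>m. y' m + d * z' m)"
  using assms(1)
proof induction
  case zero
  then show ?case using assms(2) by simp
next
  case (step z z' g c)
  show ?case using tr.step[OF step.IH step.hyps(2), of "d * c"] by (simp add: algebra_simps)
qed

text \<open>Only the way \<open>y\<close> is built from the \<open>w g\<close> matters: the same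
  construction steps can be translated by \<open>s\<close> instead of \<open>t\<close>.\<close>

lemma tr_exists:
  assumes "tr \<Gamma> w t y y'"
  shows "\<exists>y'. tr \<Gamma> w s y y'"
  using assms by induction (blast intro: tr.intros)+

lemma tr_w: "g \<in> carrier \<Gamma> \<Longrightarrow> tr \<Gamma> w s (w g) (w (s \<otimes>\<^bsub>\<Gamma>\<^esub> g))"
  using tr.step[OF tr.zero, of g \<Gamma> w s 1] by simp

lemma tr_sum:
  assumes "finite F" "\<And>n. n \<in> F \<Longrightarrow> tr \<Gamma> w s (y n) (y' n)"
  shows "tr \<Gamma> w s (\<lambda>m. \<Sum>n\<in>F. c n * y n m) (\<lambda>m. \<Sum>n\<in>F. c n * y' n m)"
  using assms
proof (induction F)
  case empty
  then show ?case by (simp add: tr.zero)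
next
  case (insert a F)
  have "tr \<Gamma> w s (\<lambda>m. (\<Sum>n\<in>F. c n * y n m) + c a * y a m) (\<lambda>m. (\<Sum>n\<in>F. c n * y' n m) + c a * y' a m)"
    by (rule tr_add) (use insert in auto)
  then show ?case using insert.hyps by (simp add: add.commute)
qed

text \<open>In \<open>span\<close>, the relation \<open>tr\<close> at the unit expresses that a
  coordinate vector is a linear combination of the \<open>w g\<close>.\<close>

locale gram_family = group \<Gamma> for \<Gamma> :: "('g, 'b) monoid_scheme" (structure) +
  fixes w :: "'g \<Rightarrow> nat \<Rightarrow> complex" and M :: "nat set"
  assumes fin: "g \<in> carrier \<Gamma> \<Longrightarrow> finite {m. w g m \<noteq> 0}"
    and supp: "g \<in> carrier \<Gamma> \<Longrightarrow> m \<notin> M \<Longrightarrow> w g m = 0"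
    and invariant: "\<lbrakk>s \<in> carrier \<Gamma>; g \<in> carrier \<Gamma>; h \<in> carrier \<Gamma>\<rbrakk> \<Longrightarrow>
      l2ip (w (s \<otimes> g)) (w (s \<otimes> h)) = l2ip (w g) (w h)"
    and span: "m \<in> M \<Longrightarrow> \<exists>y. tr \<Gamma> w \<one> (\<lambda>n. of_bool (n = m)) y"
begin

lemma tr_fin:
  assumes "tr \<Gamma> w s y y'" "s \<in> carrier \<Gamma>"
  shows "finite {m. y m \<noteq> 0} \<and> finite {m. y' m \<noteq> 0} \<and> (\<forall>m. m \<notin> M \<longrightarrow> y m = 0 \<and> y' m = 0)"
  using assms(1)
proof induction
  case (step y y' g c)
  have "{m. y m + c * w g m \<noteq> 0} \<subseteq> {m. y m \<noteq> 0} \<union> {m. w g m \<noteq> 0}"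
    "{m. y' m + c * w (s \<otimes> g) m \<noteq> 0} \<subseteq> {m. y' m \<noteq> 0} \<union> {m. w (s \<otimes> g) m \<noteq> 0}" by auto
  then show ?case using step fin[of g] fin[of "s \<otimes> g"] supp[of g] supp[of "s \<otimes> g"] assms(2)
    by (simp add: finite_subset)
qed simp

lemma tr_l2ip_left:
  assumes y: "tr \<Gamma> w s y y'" and s: "s \<in> carrier \<Gamma>" and g: "g \<in> carrier \<Gamma>"
  shows "l2ip y' (w (s \<otimes> g)) = l2ip y (w g)"
  using y
proof induction
  case (step y y' h c)
  have "l2ip (\<lambda>m. y' m + c * w (s \<otimes> h) m) (w (s \<otimes> g)) = l2ip y' (w (s \<otimes> g)) + c * l2ip (w (s \<otimes> h)) (w (s \<otimes> g))"
    by (intro l2ip_add_left summable_l2ip_finite fin m_closed s g)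
  moreover have "l2ip (\<lambda>m. y m + c * w h m) (w g) = l2ip y (w g) + c * l2ip (w h) (w g)"
    by (intro l2ip_add_left summable_l2ip_finite fin g)
  ultimately show ?case by (simp only: step.IH invariant[OF s step.hyps(2) g])
qed (simp only: l2ip_zero)

lemma tr_l2ip:
  assumes y: "tr \<Gamma> w s y y'" and z: "tr \<Gamma> w s z z'" and s: "s \<in> carrier \<Gamma>"
  shows "l2ip y' z' = l2ip y z"
  using z
proof induction
  case (step z z' g c)
  note f = tr_fin[OF step.hyps(1) s]
  have "l2ip y' (\<lambda>m. z' m + c * w (s \<otimes> g) m) = l2ip y' z' + cnj c * l2ip y' (w (s \<otimes> g))"
    by (intro l2ip_add_right summable_l2ip_finite fin m_closed s step.hyps(2)) (use f in blast)
  moreover have "l2ip y (\<lambda>m. z m + c * w g m) = l2ip y z + cnj c * l2ip y (w g)"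
    by (intro l2ip_add_right summable_l2ip_finite fin m_closed s step.hyps(2)) (use f in blast)
  ultimately show ?case by (simp only: step.IH tr_l2ip_left[OF y s step.hyps(2)])
qed (simp only: l2ip_zero)

lemma tr_sqsum:
  assumes y: "tr \<Gamma> w s y y'" and s: "s \<in> carrier \<Gamma>"
  shows "(\<Sum>m. (cmod (y' m))\<^sup>2) = (\<Sum>m. (cmod (y m))\<^sup>2)"
proof -
  have "y \<in> ell2 M" "y' \<in> ell2 M"
    using tr_fin[OF y s] by (auto intro!: ell2_finite_support)
  then show ?thesis using tr_l2ip[OF y y s] by (simp add: l2ip_self ell2_summable)
qed

text \<open>A vector may be a combination of the \<open>w g\<close> in several ways, which is why
  \<open>tr\<close> is a relation. Two translates of one vector differ by a translate of zero, and
  translation preserves norms.\<close>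

lemma tr_unique:
  assumes "tr \<Gamma> w s y y'" "tr \<Gamma> w s y z" and s: "s \<in> carrier \<Gamma>"
  shows "y' = z"
proof -
  have d: "tr \<Gamma> w s (\<lambda>m. 0) (\<lambda>m. y' m - z m)"
    using tr_add[OF assms(2,1), of "-1"] by simp
  have 0: "(\<Sum>m. (cmod (y' m - z m))\<^sup>2) = 0" using tr_sqsum[OF d s] by simp
  have "(\<lambda>m. y' m - z m) \<in> ell2 M"
    using tr_fin[OF d s] by (auto intro!: ell2_finite_support)
  then have "\<forall>m. (cmod (y' m - z m))\<^sup>2 = 0"
    by (intro suminf_eq_zero_iff[THEN iffD1, OF _ _ 0] ell2_summable) auto
  then show ?thesis by (intro ext) simp
qed

text \<open>Column \<open>m\<close> of the matrix of translation by \<open>s\<close>. The choice is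
  harmless by \<open>tr_unique\<close>.\<close>

definition basis_tr :: "'g \<Rightarrow> nat \<Rightarrow> nat \<Rightarrow> complex" where
  "basis_tr s m = (SOME y. tr \<Gamma> w s (\<lambda>n. of_bool (n = m)) y)"

lemma tr_basis: "m \<in> M \<Longrightarrow> tr \<Gamma> w s (\<lambda>n. of_bool (n = m)) (basis_tr s m)"
  using someI_ex[of "tr \<Gamma> w s (\<lambda>n. of_bool (n = m))"] span[of m] tr_exists
  unfolding basis_tr_def by metis

lemma tr_finite_support:
  assumes "finite F" "F \<subseteq> M" "\<And>m. m \<notin> F \<Longrightarrow> y m = 0"
  shows "tr \<Gamma> w s y (\<lambda>m. \<Sum>n\<in>F. y n * basis_tr s n m)"
proof -
  have "tr \<Gamma> w s (\<lambda>m. \<Sum>n\<in>F. y n * of_bool (m = n)) (\<lambda>m. \<Sum>n\<in>F. y n * basis_tr s n m)"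
    by (rule tr_sum) (use assms tr_basis in auto)
  moreover have "(\<lambda>m. \<Sum>n\<in>F. y n * of_bool (m = n)) = y"
  proof
    fix m
    have "(\<Sum>n\<in>F. y n * of_bool (m = n)) = (\<Sum>n\<in>F. if n = m then y m else 0)"
      by (intro sum.cong refl) auto
    then show "(\<Sum>n\<in>F. y n * of_bool (m = n)) = y m" using assms by auto
  qed
  ultimately show ?thesis by simp
qed

text \<open>The matrix of the translation has finite rows, so it acts on arbitrary sequences.\<close>

definition rep :: "'g \<Rightarrow> (nat \<Rightarrow> complex) \<Rightarrow> nat \<Rightarrow> complex" where
  "rep s x = (\<lambda>n. if n \<in> M then l2ip x (basis_tr (inv s) n) else 0)"

text \<open>\<open>rep s\<close> is defined coordinatewise as the adjoint of translation by
  \<open>inv s\<close>. The identity extends from coordinate vectors to \<open>y\<close> because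
  only finitely many coordinates and columns are involved.\<close>

lemma rep_adjoint:
  assumes y: "tr \<Gamma> w (inv s) y y'" and s: "s \<in> carrier \<Gamma>"
  shows "l2ip (rep s x) y = l2ip x y'"
proof -
  define F where "F = {m. y m \<noteq> 0}"
  have F: "finite F" "F \<subseteq> M" "\<And>m. m \<notin> F \<Longrightarrow> y m = 0"
    using tr_fin[OF y] s by (auto simp: F_def)
  have y': "y' = (\<lambda>m. \<Sum>n\<in>F. y n * basis_tr (inv s) n m)"
    using tr_unique[OF y tr_finite_support[OF F]] s by simp
  have "finite (\<Union>n\<in>F. {m. basis_tr (inv s) n m \<noteq> 0})"
    using tr_fin[OF tr_basis] F s by (intro finite_UN_I) auto
  then have "l2ip x y' = (\<Sum>m\<in>(\<Union>n\<in>F. {m. basis_tr (inv s) n m \<noteq> 0}). x m * cnj (y' m))"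
    by (rule l2ip_finite) (auto simp: y' intro!: sum.neutral)
  also have "\<dots> = (\<Sum>m\<in>(\<Union>n\<in>F. {m. basis_tr (inv s) n m \<noteq> 0}). \<Sum>n\<in>F. cnj (y n) * (x m * cnj (basis_tr (inv s) n m)))"
    by (intro sum.cong refl) (simp add: y' sum_distrib_left mult.left_commute)
  also have "\<dots> = (\<Sum>n\<in>F. cnj (y n) * (\<Sum>m\<in>(\<Union>n\<in>F. {m. basis_tr (inv s) n m \<noteq> 0}). x m * cnj (basis_tr (inv s) n m)))"
    by (subst sum.swap) (simp add: sum_distrib_left)
  also have "\<dots> = (\<Sum>n\<in>F. cnj (y n) * l2ip x (basis_tr (inv s) n))"
  proof (intro sum.cong refl arg_cong2[where f = "(*)"] l2ip_finite[symmetric])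
    show "finite (\<Union>n\<in>F. {m. basis_tr (inv s) n m \<noteq> 0})" by fact
  qed auto
  also have "\<dots> = (\<Sum>n\<in>F. rep s x n * cnj (y n))"
    using F by (intro sum.cong refl) (auto simp: rep_def)
  also have "\<dots> = l2ip (rep s x) y"
    using F by (intro l2ip_finite[symmetric]) auto
  finally show ?thesis by simp
qed

lemma rep_w:
  assumes "s \<in> carrier \<Gamma>" "g \<in> carrier \<Gamma>"
  shows "l2ip (rep s x) (w g) = l2ip x (w (inv s \<otimes> g))"
  by (rule rep_adjoint[OF tr_w]) (use assms in auto)

text \<open>Coordinate vectors are combinations of the \<open>w g\<close>, so pairings with the
  \<open>w g\<close> determine a sequence on \<open>M\<close>. The algebraic laws of
  \<open>rep\<close> are all checked against these vectors.\<close>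

lemma eqI:
  assumes "\<And>m. m \<notin> M \<Longrightarrow> x m = 0" "\<And>m. m \<notin> M \<Longrightarrow> y m = 0"
    and e: "\<And>g. g \<in> carrier \<Gamma> \<Longrightarrow> l2ip x (w g) = l2ip y (w g)"
  shows "x = y"
proof
  fix m
  have *: "l2ip x z = l2ip y z" if "tr \<Gamma> w \<one> z z'" for z z'
    using that
  proof induction
    case (step z z' g c)
    note f = tr_fin[OF step.hyps(1) one_closed]
    have "l2ip v (\<lambda>m. z m + c * w g m) = l2ip v z + cnj c * l2ip v (w g)" for v
      by (intro l2ip_add_right summable_l2ip_finite fin step.hyps(2)) (use f in blast)
    then show ?case by (simp only: step.IH e[OF step.hyps(2)])
  qed (simp only: l2ip_zero)
  have d: "l2ip x (\<lambda>n. of_bool (n = m)) = x m" for x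
    by (subst l2ip_finite[of "{m}"]) auto
  show "x m = y m"
  proof (cases "m \<in> M")
    case True
    then show ?thesis using *[OF tr_basis[OF True]] by (simp add: d)
  qed (use assms in simp)
qed

text \<open>Duality: pair \<open>rep s x\<close> with its own truncation \<open>y\<close> and move
  the operator to the other side. Translation preserves the norm of \<open>y\<close>, so
  Cauchy-Schwarz gives \<open>A\<^sup>2\<close> at most the square norm of \<open>x\<close> times
  \<open>A\<close>.\<close>

lemma rep_bound:
  assumes x: "x \<in> ell2 M" and s: "s \<in> carrier \<Gamma>"
  shows "rep s x \<in> ell2 M" "(\<Sum>m. (cmod (rep s x m))\<^sup>2) \<le> (\<Sum>m. (cmod (x m))\<^sup>2)"
proof -
  have part: "(\<Sum>n<N. (cmod (rep s x n))\<^sup>2) \<le> (\<Sum>m. (cmod (x m))\<^sup>2)" for N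
  proof -
    define y where "y = (\<lambda>n. if n < N then rep s x n else 0)"
    define A where "A = (\<Sum>n<N. (cmod (rep s x n))\<^sup>2)"
    have yz: "y m = 0" if "m \<notin> M \<inter> {..<N}" for m using that by (auto simp: y_def rep_def)
    have "tr \<Gamma> w (inv s) y (\<lambda>m. \<Sum>n\<in>M \<inter> {..<N}. y n * basis_tr (inv s) n m)"
      by (rule tr_finite_support) (use yz in auto)
    then obtain y' where y': "tr \<Gamma> w (inv s) y y'" by blast
    have yl: "y \<in> ell2 M" "y' \<in> ell2 M"
      using tr_fin[OF y'] s by (auto intro!: ell2_finite_support)
    have "(\<Sum>m. (cmod (y m))\<^sup>2) = (\<Sum>n<N. (cmod (y n))\<^sup>2)"
      by (rule suminf_finite) (auto simp: y_def)
    then have A: "(\<Sum>m. (cmod (y m))\<^sup>2) = A" by (simp add: A_def y_def)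
    have "l2ip (rep s x) y = (\<Sum>n<N. rep s x n * cnj (y n))"
      by (rule l2ip_finite) (auto simp: y_def)
    also have "\<dots> = of_real A" by (simp add: A_def y_def complex_norm_square del: of_real_power)
    finally have "l2ip x y' = of_real A" using rep_adjoint[OF y' s] by simp
    then have "A\<^sup>2 \<le> (\<Sum>m. (cmod (x m))\<^sup>2) * (\<Sum>m. (cmod (y' m))\<^sup>2)"
      using l2ip_Cauchy_Schwarz[OF ell2_summable[OF x] ell2_summable[OF yl(2)]] by simp
    also have "(\<Sum>m. (cmod (y' m))\<^sup>2) = A" using tr_sqsum[OF y'] s A by simp
    finally have "A * A \<le> (\<Sum>m. (cmod (x m))\<^sup>2) * A" by (simp add: power2_eq_square)
    moreover have "0 \<le> A" by (auto simp: A_def intro: sum_nonneg)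
    moreover have "0 \<le> (\<Sum>m. (cmod (x m))\<^sup>2)" by (rule suminf_nonneg) (auto intro: ell2_summable[OF x])
    ultimately show ?thesis unfolding A_def[symmetric]
      by (metis less_eq_real_def mult_right_le_imp_le)
  qed
  have "summable (\<lambda>n. (cmod (rep s x n))\<^sup>2)"
    by (rule summableI_nonneg_bounded) (use part in auto)
  then show "(\<Sum>m. (cmod (rep s x m))\<^sup>2) \<le> (\<Sum>m. (cmod (x m))\<^sup>2)" "rep s x \<in> ell2 M"
    using part by (auto intro!: suminf_le_const simp: ell2_def rep_def)
qed

lemma w_in: "g \<in> carrier \<Gamma> \<Longrightarrow> w g \<in> ell2 M"
  using fin[of g] supp[of g] by (intro ell2_finite_support) auto

lemma rep_support: "m \<notin> M \<Longrightarrow> rep s x m = 0"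
  by (simp add: rep_def)

lemma rep_mult:
  assumes "s \<in> carrier \<Gamma>" "t \<in> carrier \<Gamma>"
  shows "rep s (rep t x) = rep (s \<otimes> t) x"
proof (rule eqI)
  fix g assume g: "g \<in> carrier \<Gamma>"
  have "inv (s \<otimes> t) \<otimes> g = inv t \<otimes> (inv s \<otimes> g)"
    using assms g by (simp add: inv_mult_group m_assoc)
  then show "l2ip (rep s (rep t x)) (w g) = l2ip (rep (s \<otimes> t) x) (w g)"
    using assms g by (simp only: rep_w m_closed inv_closed)
qed (simp_all add: rep_support)

lemma rep_one: "x \<in> ell2 M \<Longrightarrow> rep \<one> x = x"
proof (rule eqI)
  fix g assume "g \<in> carrier \<Gamma>"
  then show "l2ip (rep \<one> x) (w g) = l2ip x (w g)" using rep_w[of \<one> g x] by simp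
next
  fix m assume "x \<in> ell2 M" "m \<notin> M"
  then show "x m = 0" by (rule ell2_support)
qed (rule rep_support)

lemma rep_basis_w: "s \<in> carrier \<Gamma> \<Longrightarrow> g \<in> carrier \<Gamma> \<Longrightarrow> rep s (w g) = w (s \<otimes> g)"
proof (rule eqI)
  fix h assume "s \<in> carrier \<Gamma>" "g \<in> carrier \<Gamma>" "h \<in> carrier \<Gamma>"
  then show "l2ip (rep s (w g)) (w h) = l2ip (w (s \<otimes> g)) (w h)"
    using invariant[of s g "inv s \<otimes> h"] by (simp add: rep_w m_assoc[symmetric])
qed (auto simp: rep_support supp)

lemma rep_linear:
  assumes "x \<in> ell2 M" "y \<in> ell2 M" "s \<in> carrier \<Gamma>"
  shows "rep s (\<lambda>m. x m + c * y m) = (\<lambda>m. rep s x m + c * rep s y m)"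
proof (rule eqI)
  fix g assume g: "g \<in> carrier \<Gamma>"
  have "l2ip (rep s (\<lambda>m. x m + c * y m)) (w g) = l2ip (\<lambda>m. x m + c * y m) (w (inv s \<otimes> g))"
    by (rule rep_w[OF assms(3) g])
  also have "\<dots> = l2ip x (w (inv s \<otimes> g)) + c * l2ip y (w (inv s \<otimes> g))"
    by (intro l2ip_add_left summable_l2ip_finite fin) (use assms g in auto)
  also have "\<dots> = l2ip (rep s x) (w g) + c * l2ip (rep s y) (w g)"
    by (simp only: rep_w[OF assms(3) g])
  also have "\<dots> = l2ip (\<lambda>m. rep s x m + c * rep s y m) (w g)"
    by (intro l2ip_add_left[symmetric] summable_l2ip_finite fin g)
  finally show "l2ip (rep s (\<lambda>m. x m + c * y m)) (w g) = l2ip (\<lambda>m. rep s x m + c * rep s y m) (w g)" .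
qed (auto simp: rep_support)

text \<open>Both \<open>rep s\<close> and its inverse \<open>rep (inv s)\<close> are
  contractions.\<close>

lemma rep_norm:
  assumes "x \<in> ell2 M" "s \<in> carrier \<Gamma>"
  shows "(\<Sum>m. (cmod (rep s x m))\<^sup>2) = (\<Sum>m. (cmod (x m))\<^sup>2)"
proof -
  have "rep (inv s) (rep s x) = x"
    using assms(2) by (simp only: rep_mult inv_closed l_inv rep_one[OF assms(1)])
  then have "(\<Sum>m. (cmod (x m))\<^sup>2) \<le> (\<Sum>m. (cmod (rep s x m))\<^sup>2)"
    using rep_bound(2)[OF rep_bound(1)[OF assms] inv_closed[OF assms(2)]] by simp
  then show ?thesis by (rule order_antisym[OF rep_bound(2)[OF assms]])
qed

lemma rep_l2ip:
  assumes x: "x \<in> ell2 M" and y: "y \<in> ell2 M" and s: "s \<in> carrier \<Gamma>"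
  shows "l2ip (rep s x) (rep s y) = l2ip x y"
proof -
  have exp: "l2ip (\<lambda>m. a m + c * b m) (\<lambda>m. a m + c * b m)
      = l2ip a a + c * cnj c * l2ip b b + (c * cnj (l2ip a b) + cnj c * l2ip a b)"
    if a: "a \<in> ell2 M" and b: "b \<in> ell2 M" for a b c
  proof -
    note sm = summable_l2ip[OF ell2_summable ell2_summable]
    have "l2ip (\<lambda>m. a m + c * b m) (\<lambda>m. a m + c * b m)
        = l2ip a (\<lambda>m. a m + c * b m) + c * l2ip b (\<lambda>m. a m + c * b m)"
      by (intro l2ip_add_left sm[of _ M _ M] a b ell2_add ell2_smult)
    also have "l2ip a (\<lambda>m. a m + c * b m) = l2ip a a + cnj c * l2ip a b"
      by (intro l2ip_add_right sm[of _ M _ M] a b)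
    also have "l2ip b (\<lambda>m. a m + c * b m) = l2ip b a + cnj c * l2ip b b"
      by (intro l2ip_add_right sm[of _ M _ M] a b)
    also have "l2ip b a = cnj (l2ip a b)"
      by (intro l2ip_cnj sm[of _ M _ M] a b)
    finally show ?thesis by (simp add: distrib_left)
  qed
  have nrm: "l2ip (rep s a) (rep s a) = l2ip a a" if "a \<in> ell2 M" for a
    using rep_norm[OF that s] that rep_bound(1)[OF that s] by (simp add: l2ip_self ell2_summable)
  note rx = rep_bound(1)[OF x s] and ry = rep_bound(1)[OF y s]
  have "c * cnj (l2ip (rep s x) (rep s y)) + cnj c * l2ip (rep s x) (rep s y)
      = c * cnj (l2ip x y) + cnj c * l2ip x y" for c
    using nrm[OF ell2_add[OF x ell2_smult[OF y, of c]]]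
    unfolding rep_linear[OF x y s] exp[OF x y] exp[OF rx ry] nrm[OF x] nrm[OF y] by (rule add_left_imp_eq)
  \<comment> \<open>Polarisation: \<open>c = 1\<close> yields the real part and
    \<open>c = \<i>\<close> the imaginary part.\<close>
  from this[of 1] this[of \<i>] show ?thesis by (simp add: complex_eq_iff)
qed

text \<open>The restriction is there because the elements of \<open>BijGroup\<close> are extensional
  functions.\<close>

lemma unitary_rep:
  "unitary_representation \<Gamma> (ell2_module M) l2ip (\<lambda>s. restrict (rep s) (ell2 M))"
proof -
  let ?\<pi> = "\<lambda>s. restrict (rep s) (ell2 M)"
  interpret complex_hilbert_space "ell2_module M" l2ip by (rule complex_hilbert_space_ell2)
  have bij: "?\<pi> s \<in> Bij (ell2 M)" if s: "s \<in> carrier \<Gamma>" for s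
  proof -
    have "bij_betw (rep s) (ell2 M) (ell2 M)"
      by (rule bij_betw_byWitness[where f' = "rep (inv s)"])
        (use s in \<open>auto simp: rep_mult rep_one rep_bound\<close>)
    then show ?thesis by (simp add: Bij_def cong: bij_betw_cong)
  qed
  have act: "group_action \<Gamma> (carrier (ell2_module M)) ?\<pi>"
    unfolding group_action_def group_hom_def group_hom_axioms_def
  proof (intro conjI group_axioms group_BijGroup homI)
    fix s t assume "s \<in> carrier \<Gamma>" "t \<in> carrier \<Gamma>"
    then show "?\<pi> (s \<otimes> t) =
      ?\<pi> s \<otimes>\<^bsub>BijGroup (carrier (ell2_module M))\<^esub> ?\<pi> t"
      using bij by (auto simp: BijGroup_def compose_def rep_mult rep_bound restrict_def fun_eq_iff)
  qed (use bij in \<open>simp add: BijGroup_def\<close>)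
  interpret group_action \<Gamma> "carrier (ell2_module M)" ?\<pi> by (rule act)
  show ?thesis
  proof unfold_locales
    fix g x y assume "g \<in> carrier \<Gamma>" "x \<in> carrier (ell2_module M)" "y \<in> carrier (ell2_module M)"
    then show "?\<pi> g (x \<oplus>\<^bsub>ell2_module M\<^esub> y) =
      ?\<pi> g x \<oplus>\<^bsub>ell2_module M\<^esub> ?\<pi> g y"
      using rep_linear[of x y g 1] ell2_add[of x M y] by simp
  next
    fix g x c assume "g \<in> carrier \<Gamma>" "x \<in> carrier (ell2_module M)"
    \<comment> \<open>\<open>rep_linear\<close> covers this with first summand 0. That
      \<open>rep g\<close> fixes 0 is its instance with both vectors 0 and
      \<open>c = -1\<close>.\<close>
    then show "?\<pi> g (c \<odot>\<^bsub>ell2_module M\<^esub> x) =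
      c \<odot>\<^bsub>ell2_module M\<^esub> ?\<pi> g x"
      using rep_linear[OF ell2_zero, of x g c] rep_linear[OF ell2_zero ell2_zero, of g "-1"] ell2_smult[of x M c]
      by simp
  next
    fix g x y assume "g \<in> carrier \<Gamma>" "x \<in> carrier (ell2_module M)" "y \<in> carrier (ell2_module M)"
    then show "l2ip (?\<pi> g x) (?\<pi> g y) = l2ip x y"
      by (simp add: rep_l2ip)
  qed
qed

end

section \<open>Positive definite functions on the group and property (T)\<close>

lemma sum_list_swap:
  fixes f :: "'a \<Rightarrow> 'b \<Rightarrow> 'c::comm_monoid_add"
  shows "(\<Sum>x\<leftarrow>xs. \<Sum>y\<leftarrow>ys. f x y) = (\<Sum>y\<leftarrow>ys. \<Sum>x\<leftarrow>xs. f x y)"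
  by (induction xs) (simp_all add: sum_list_addf)

text \<open>The argument \<open>inv (g j) \<otimes> g i\<close> makes the matrix the Gram matrix of
  the orbit vectors at \<open>g i\<close> and \<open>g j\<close>, for an inner product linear in its
  first argument.\<close>

definition pos_def_group_fun :: "('g, 'b) monoid_scheme \<Rightarrow> ('g \<Rightarrow> complex) \<Rightarrow> bool" where
  "pos_def_group_fun \<Gamma> \<phi> \<longleftrightarrow>
     (\<forall>(n::nat) c g. (\<forall>i<n. g i \<in> carrier \<Gamma>) \<longrightarrow>
       (\<Sum>i<n. \<Sum>j<n. c i * cnj (c j) * \<phi> (inv\<^bsub>\<Gamma>\<^esub> (g j) \<otimes>\<^bsub>\<Gamma>\<^esub> g i)) \<in> \<real>\<^sub>\<ge>\<^sub>0)"

text \<open>Enumerate the group and factor the Gram matrix; the rows of the triangular factor are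
  the orbit vectors. Left invariance of the Gram matrix is the identity \<open>inv (s \<otimes> h)
  \<otimes> (s \<otimes> g) = inv h \<otimes> g\<close>.\<close>

lemma gram_family_of_pos_def:
  fixes \<Gamma> :: "('g, 'b) monoid_scheme" (structure)
  assumes "group \<Gamma>" "countable (carrier \<Gamma>)" "infinite (carrier \<Gamma>)" "pos_def_group_fun \<Gamma> \<phi>"
  obtains w M where "gram_family \<Gamma> w M"
    "\<And>g h. g \<in> carrier \<Gamma> \<Longrightarrow> h \<in> carrier \<Gamma> \<Longrightarrow> l2ip (w g) (w h) = \<phi> (inv h \<otimes> g)"
proof -
  interpret group \<Gamma> by fact
  \<comment> \<open>As the group is infinite, this enumeration is a bijection with the natural
    numbers, so each row belongs to exactly one element.\<close>
  define e where "e = from_nat_into (carrier \<Gamma>)"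
  define k where "k = (\<lambda>i j. \<phi> (inv (e j) \<otimes> e i))"
  have e: "e i \<in> carrier \<Gamma>" for i
    unfolding e_def by (rule from_nat_into) auto
  have psd: "psd_kernel k"
    using assms(4) e unfolding psd_kernel_def k_def pos_def_group_fun_def by blast
  obtain v :: "nat \<Rightarrow> nat \<Rightarrow> complex" where
    v1: "\<And>i m. i < m \<Longrightarrow> v i m = 0" and v2: "\<And>i m. v m m = 0 \<Longrightarrow> v i m = 0"
    and v3: "\<And>i j n. i < n \<Longrightarrow> k i j = (\<Sum>m<n. v i m * cnj (v j m))"
    by (rule psd_kernel_cholesky[OF psd]) (rule that)
  define w where "w = (\<lambda>g. v (to_nat_on (carrier \<Gamma>) g))"
  \<comment> \<open>Columns with zero pivot vanish, so all rows live on the coordinates with nonzero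
    pivot; these are the coordinates that the rows span.\<close>
  define M where "M = {m. v m m \<noteq> 0}"
  have ew: "w (e i) = v i" for i
    using assms(2,3) by (simp add: w_def e_def)
  have gram: "l2ip (w g) (w h) = \<phi> (inv h \<otimes> g)" if "g \<in> carrier \<Gamma>" "h \<in> carrier \<Gamma>" for g h
  proof -
    define i j where "i = to_nat_on (carrier \<Gamma>) g" and "j = to_nat_on (carrier \<Gamma>) h"
    have ij: "e i = g" "e j = h" using that assms(2) by (simp_all add: e_def i_def j_def)
    have "l2ip (v i) (v j) = (\<Sum>m<Suc (max i j). v i m * cnj (v j m))"
      by (rule l2ip_finite) (auto intro: v1)
    also have "\<dots> = k i j" by (rule v3[symmetric]) simp
    finally show ?thesis by (simp add: ij k_def ew flip: ij)
  qed
  \<comment> \<open>Triangular solving: row \<open>m\<close> is its pivot times the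
    \<open>m\<close>-th coordinate vector plus a combination of earlier coordinate vectors from
    \<open>M\<close>, and the pivot can be inverted.\<close>
  have span: "\<exists>y. tr \<Gamma> w \<one> (\<lambda>n. of_bool (n = m)) y" if "m \<in> M" for m
    using that
  proof (induction m rule: less_induct)
    case (less m)
    define F where "F = M \<inter> {..<m}"
    have "\<forall>j\<in>F. \<exists>y. tr \<Gamma> w \<one> (\<lambda>n. of_bool (n = j)) y" using less.IH by (auto simp: F_def)
    then obtain y where y: "\<And>j. j \<in> F \<Longrightarrow> tr \<Gamma> w \<one> (\<lambda>n. of_bool (n = j)) (y j)" by metis
    have 1: "tr \<Gamma> w \<one> (\<lambda>n. \<Sum>j\<in>F. v m j * of_bool (n = j)) (\<lambda>n. \<Sum>j\<in>F. v m j * y j n)"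
      by (rule tr_sum) (use y in \<open>auto simp: F_def\<close>)
    have 2: "tr \<Gamma> w \<one> (v m) (w (\<one> \<otimes> e m))" using tr_w[OF e, of w \<one> m] by (simp add: ew)
    have "\<exists>z. tr \<Gamma> w \<one> (\<lambda>n. 0 + 1 / v m m * (v m n + (-1) * (\<Sum>j\<in>F. v m j * of_bool (n = j)))) z"
      using tr_add[OF tr_add[OF 1 2] tr.zero] by blast
    moreover have "(\<lambda>n. 0 + 1 / v m m * (v m n + (-1) * (\<Sum>j\<in>F. v m j * of_bool (n = j)))) = (\<lambda>n. of_bool (n = m))"
    proof
      fix n
      have "(\<Sum>j\<in>F. v m j * of_bool (n = j)) = (\<Sum>j\<in>F. if j = n then v m n else 0)"
        by (intro sum.cong refl) auto
      also have "\<dots> = (if n \<in> F then v m n else 0)" by (simp add: F_def)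
      also have "\<dots> = (if n < m then v m n else 0)" using v2[of n m] by (auto simp: F_def M_def)
      finally show "0 + 1 / v m m * (v m n + (-1) * (\<Sum>j\<in>F. v m j * of_bool (n = j))) = of_bool (n = m)"
        using less.prems v1[of m n] by (auto simp: M_def)
    qed
    ultimately show ?case by simp
  qed
  have "gram_family \<Gamma> w M"
  proof
    fix g assume "g \<in> carrier \<Gamma>"
    show "finite {m. w g m \<noteq> 0}"
      by (rule finite_subset[of _ "{..to_nat_on (carrier \<Gamma>) g}"]) (auto simp: w_def intro: v1 leI)
  next
    fix g m assume "m \<notin> M" then show "w g m = 0" using v2 by (auto simp: M_def w_def)
  next
    fix s g h assume "s \<in> carrier \<Gamma>" "g \<in> carrier \<Gamma>" "h \<in> carrier \<Gamma>"
    moreover from this have "inv (s \<otimes> h) \<otimes> (s \<otimes> g) = inv h \<otimes> g"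
      by (simp add: inv_mult_group m_assoc) (simp add: m_assoc[symmetric])
    ultimately show "l2ip (w (s \<otimes> g)) (w (s \<otimes> h)) = l2ip (w g) (w h)"
      by (simp add: gram)
  qed (use span in auto)
  then show ?thesis using that gram by blast
qed

lemma (in gram_family) finite_sum_list:
  "set l \<subseteq> carrier \<Gamma> \<Longrightarrow> finite {m. (\<Sum>g\<leftarrow>l. w g m) \<noteq> 0}"
proof (induction l)
  case (Cons a l)
  have "{m. (\<Sum>g\<leftarrow>a # l. w g m) \<noteq> 0} \<subseteq> {m. w a m \<noteq> 0} \<union> {m. (\<Sum>g\<leftarrow>l. w g m) \<noteq> 0}" by auto
  moreover have "finite {m. w a m \<noteq> 0}" "finite {m. (\<Sum>g\<leftarrow>l. w g m) \<noteq> 0}"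
    using Cons fin[of a] by simp_all
  ultimately show ?case by (meson finite_UnI finite_subset)
qed simp

lemma (in gram_family) l2ip_sum_list_right:
  "set l \<subseteq> carrier \<Gamma> \<Longrightarrow> l2ip x (\<lambda>m. \<Sum>g\<leftarrow>l. w g m) = (\<Sum>g\<leftarrow>l. l2ip x (w g))"
proof (induction l)
  case (Cons a l)
  have "l2ip x (\<lambda>m. w a m + 1 * (\<Sum>g\<leftarrow>l. w g m)) = l2ip x (w a) + cnj 1 * l2ip x (\<lambda>m. \<Sum>g\<leftarrow>l. w g m)"
    by (intro l2ip_add_right summable_l2ip_finite fin finite_sum_list) (use Cons.prems in simp_all)
  then show ?case using Cons by simp
qed simp

lemma (in gram_family) l2ip_sum_list_left:
  assumes h: "h \<in> carrier \<Gamma>"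
  shows "set l \<subseteq> carrier \<Gamma> \<Longrightarrow> l2ip (\<lambda>m. \<Sum>g\<leftarrow>l. w g m) (w h) = (\<Sum>g\<leftarrow>l. l2ip (w g) (w h))"
proof (induction l)
  case (Cons a l)
  have "l2ip (\<lambda>m. w a m + 1 * (\<Sum>g\<leftarrow>l. w g m)) (w h) = l2ip (w a) (w h) + 1 * l2ip (\<lambda>m. \<Sum>g\<leftarrow>l. w g m) (w h)"
    by (intro l2ip_add_left summable_l2ip_finite fin h)
  then show ?case using Cons by simp
qed simp

text \<open>An invariant vector of the representation attached to \<open>\<phi>\<close> has a nonzero constant inner
  product with the orbit of the cyclic vector, so the averages of \<open>\<phi>\<close> cannot tend to 0.\<close>

lemma property_T_averages:
  fixes \<Gamma> :: "('g, 'b) monoid_scheme" (structure)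
  assumes "group \<Gamma>" "countable (carrier \<Gamma>)" "infinite (carrier \<Gamma>)" "property_T \<Gamma>"
  obtains K \<epsilon> where "finite K" "K \<subseteq> carrier \<Gamma>" "0 < (\<epsilon>::real)"
    "\<And>\<phi>. pos_def_group_fun \<Gamma> \<phi> \<Longrightarrow> \<phi> \<one> = 1 \<Longrightarrow> (\<And>g. g \<in> K \<Longrightarrow> 2 - 2 * Re (\<phi> g) < \<epsilon>\<^sup>2) \<Longrightarrow>
      \<exists>\<delta>>0. \<forall>l. set l \<subseteq> carrier \<Gamma> \<longrightarrow>
        \<delta> * (real (length l))\<^sup>2 \<le> Re (\<Sum>g\<leftarrow>l. \<Sum>h\<leftarrow>l. \<phi> (inv h \<otimes> g))"
proof -
  interpret group \<Gamma> by fact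
  obtain K \<epsilon> where K: "finite K" "K \<subseteq> carrier \<Gamma>" "0 < (\<epsilon>::real)"
    and T: "\<And>(H :: (complex, nat \<Rightarrow> complex) module) ip \<pi>. unitary_representation \<Gamma> H ip \<pi> \<Longrightarrow>
          (\<exists>\<xi>\<in>carrier H. \<xi> \<noteq> \<zero>\<^bsub>H\<^esub> \<and> (\<forall>g\<in>K. hnorm ip (\<pi> g \<xi> \<ominus>\<^bsub>H\<^esub> \<xi>) < \<epsilon> * hnorm ip \<xi>)) \<Longrightarrow>
          (\<exists>\<eta>\<in>carrier H. \<eta> \<noteq> \<zero>\<^bsub>H\<^esub> \<and> (\<forall>g\<in>carrier \<Gamma>. \<pi> g \<eta> = \<eta>))"
    using assms(4) unfolding property_T_def by metis
  show ?thesis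
  proof (rule that[OF K])
    fix \<phi> assume pd: "pos_def_group_fun \<Gamma> \<phi>" and one: "\<phi> \<one> = 1"
      and close: "\<And>g. g \<in> K \<Longrightarrow> 2 - 2 * Re (\<phi> g) < \<epsilon>\<^sup>2"
    obtain w M where wM: "gram_family \<Gamma> w M"
      and gram: "\<And>g h. g \<in> carrier \<Gamma> \<Longrightarrow> h \<in> carrier \<Gamma> \<Longrightarrow> l2ip (w g) (w h) = \<phi> (inv h \<otimes> g)"
      using gram_family_of_pos_def[OF assms(1-3) pd] by blast
    interpret gram_family \<Gamma> w M by (rule wM)
    have w1: "hnorm l2ip (w \<one>) = 1" by (simp add: hnorm_def gram one)
    have "w \<one> \<noteq> (\<lambda>m. 0)" using w1 by (auto simp: hnorm_def l2ip_zero)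
    \<comment> \<open>The square of this distance is \<open>2 - 2 * Re (\<phi> g)\<close>, so the
      hypothesis on \<open>K\<close> says that \<open>w \<one>\<close> is an almost invariant unit
      vector.\<close>
    moreover have "hnorm l2ip (\<lambda>m. w g m - w \<one> m) < \<epsilon>" if "g \<in> K" for g
    proof -
      have g: "g \<in> carrier \<Gamma>" using that K by auto
      note sm = summable_l2ip_finite[OF fin]
      have f: "finite {m. w g m + (-1) * w \<one> m \<noteq> 0}"
        by (rule finite_subset[of _ "{m. w g m \<noteq> 0} \<union> {m. w \<one> m \<noteq> 0}"]) (use fin g in auto)
      have "l2ip (\<lambda>m. w g m + (-1) * w \<one> m) (\<lambda>m. w g m + (-1) * w \<one> m)
         = l2ip (w g) (\<lambda>m. w g m + (-1) * w \<one> m) + (-1) * l2ip (w \<one>) (\<lambda>m. w g m + (-1) * w \<one> m)"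
        by (intro l2ip_add_left summable_l2ip_finite f)
      also have "l2ip (w g) (\<lambda>m. w g m + (-1) * w \<one> m) = l2ip (w g) (w g) + cnj (-1) * l2ip (w g) (w \<one>)"
        by (intro l2ip_add_right sm g one_closed)
      also have "l2ip (w \<one>) (\<lambda>m. w g m + (-1) * w \<one> m) = l2ip (w \<one>) (w g) + cnj (-1) * l2ip (w \<one>) (w \<one>)"
        by (intro l2ip_add_right sm g one_closed)
      also have "l2ip (w \<one>) (w g) = cnj (l2ip (w g) (w \<one>))"
        by (intro l2ip_cnj sm one_closed)
      finally have "Re (l2ip (\<lambda>m. w g m - w \<one> m) (\<lambda>m. w g m - w \<one> m)) = 2 - 2 * Re (\<phi> g)"
        using g by (simp add: gram one)
      then show ?thesis using close[OF that] K(3) by (simp add: hnorm_def real_less_lsqrt)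
    qed
    moreover have "restrict (rep g) (ell2 M) (w \<one>) = w g" if "g \<in> K" for g
      using that K by (auto simp: w_in rep_basis_w)
    ultimately have "\<exists>\<eta>\<in>carrier (ell2_module M). \<eta> \<noteq> \<zero>\<^bsub>ell2_module M\<^esub> \<and>
        (\<forall>g\<in>carrier \<Gamma>. restrict (rep g) (ell2 M) \<eta> = \<eta>)"
      using K w1 by (intro T[OF unitary_rep] bexI[of _ "w \<one>"]) (auto simp: w_in subset_iff)
    then obtain \<eta> where \<eta>: "\<eta> \<in> ell2 M" "\<eta> \<noteq> (\<lambda>m. 0)" "\<And>g. g \<in> carrier \<Gamma> \<Longrightarrow> rep g \<eta> = \<eta>" by auto
    define a where "a = l2ip \<eta> (w \<one>)"
    have a: "l2ip \<eta> (w g) = a" if "g \<in> carrier \<Gamma>" for g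
      using rep_w[of "inv g" \<one> \<eta>] \<eta>(3)[of "inv g"] that by (simp add: a_def)
    have "a \<noteq> 0"
    proof
      assume "a = 0"
      then have "\<eta> = (\<lambda>m. 0)"
        using a ell2_support[OF \<eta>(1)] by (intro eqI) (simp_all add: l2ip_zero)
      then show False using \<eta>(2) by simp
    qed
    define N where "N = (\<Sum>m. (cmod (\<eta> m))\<^sup>2)"
    \<comment> \<open>Cauchy-Schwarz for \<open>\<eta>\<close> and the sum \<open>z\<close> of the
      \<open>w g\<close> over \<open>l\<close>: the inner product is \<open>length l\<close> times
      \<open>a\<close>, and the square norm of \<open>z\<close> is the double sum of values of
      \<open>\<phi>\<close>.\<close>
    have le: "(cmod a)\<^sup>2 * (real (length l))\<^sup>2 \<le> N * Re (\<Sum>g\<leftarrow>l. \<Sum>h\<leftarrow>l. \<phi> (inv h \<otimes> g))"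
      if l: "set l \<subseteq> carrier \<Gamma>" for l
    proof -
      define z where "z = (\<lambda>m. \<Sum>g\<leftarrow>l. w g m)"
      have zf: "finite {m. z m \<noteq> 0}" unfolding z_def by (rule finite_sum_list[OF l])
      have z: "z \<in> ell2 UNIV" by (rule ell2_finite_support[OF zf]) simp
      have "l2ip \<eta> z = (\<Sum>g\<leftarrow>l. l2ip \<eta> (w g))" unfolding z_def by (rule l2ip_sum_list_right[OF l])
      also have "\<dots> = (\<Sum>g\<leftarrow>l. a)" using l a by (intro arg_cong[where f = sum_list] map_cong refl) auto
      also have "\<dots> = of_nat (length l) * a" by (simp add: sum_list_triv)
      finally have 1: "l2ip \<eta> z = of_nat (length l) * a" .
      have "l2ip z z = (\<Sum>h\<leftarrow>l. l2ip z (w h))" unfolding z_def by (rule l2ip_sum_list_right[OF l])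
      also have "\<dots> = (\<Sum>h\<leftarrow>l. \<Sum>g\<leftarrow>l. l2ip (w g) (w h))"
        using l l2ip_sum_list_left[OF _ l] unfolding z_def
        by (intro arg_cong[where f = sum_list] map_cong refl) auto
      also have "\<dots> = (\<Sum>h\<leftarrow>l. \<Sum>g\<leftarrow>l. \<phi> (inv h \<otimes> g))"
        using l gram by (intro arg_cong[where f = sum_list] map_cong refl) auto
      also have "\<dots> = (\<Sum>g\<leftarrow>l. \<Sum>h\<leftarrow>l. \<phi> (inv h \<otimes> g))" by (rule sum_list_swap)
      finally have 2: "l2ip z z = (\<Sum>g\<leftarrow>l. \<Sum>h\<leftarrow>l. \<phi> (inv h \<otimes> g))" .
      have "(cmod (l2ip \<eta> z))\<^sup>2 \<le> N * (\<Sum>m. (cmod (z m))\<^sup>2)"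
        unfolding N_def by (rule l2ip_Cauchy_Schwarz[OF ell2_summable[OF \<eta>(1)] ell2_summable[OF z]])
      also have "(\<Sum>m. (cmod (z m))\<^sup>2) = Re (l2ip z z)"
        by (simp add: l2ip_self[OF ell2_summable[OF z]])
      finally show ?thesis by (simp add: 1 2 norm_mult power_mult_distrib mult.commute)
    qed
    have "N * Re (\<phi> \<one>) \<ge> (cmod a)\<^sup>2" using le[of "[\<one>]"] by simp
    then have N: "0 < N" using one \<open>a \<noteq> 0\<close> by (simp add: order_less_le_trans[of 0 "(cmod a)\<^sup>2"])
    show "\<exists>\<delta>>0. \<forall>l. set l \<subseteq> carrier \<Gamma> \<longrightarrow>
        \<delta> * (real (length l))\<^sup>2 \<le> Re (\<Sum>g\<leftarrow>l. \<Sum>h\<leftarrow>l. \<phi> (inv h \<otimes> g))"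
    proof (intro exI[of _ "(cmod a)\<^sup>2 / N"] conjI allI impI)
      show "0 < (cmod a)\<^sup>2 / N" using N \<open>a \<noteq> 0\<close> by simp
      fix l assume "set l \<subseteq> carrier \<Gamma>"
      from le[OF this] show "(cmod a)\<^sup>2 / N * (real (length l))\<^sup>2 \<le> Re (\<Sum>g\<leftarrow>l. \<Sum>h\<leftarrow>l. \<phi> (inv h \<otimes> g))"
        using N by (simp add: field_simps)
    qed
  qed
qed

section \<open>Almost free averages over infinite orbits\<close>

text \<open>A list stands for the finitely supported probability that weights its entries by
  multiplicity, up to the factor \<open>length l\<close>. This is the mass of its image under
  \<open>f\<close> at \<open>y\<close>. Concatenation then averages probabilities.\<close>

definition hits :: "('g \<Rightarrow> 'x) \<Rightarrow> 'g list \<Rightarrow> 'x \<Rightarrow> real" where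
  "hits f l y = (\<Sum>g\<leftarrow>l. of_bool (f g = y))"

text \<open>The inner product of the two multiplicity functions \<open>hits f k\<close> and
  \<open>hits f l\<close>; this form avoids a sum over the points.\<close>

definition coincidences :: "('g \<Rightarrow> 'x) \<Rightarrow> 'g list \<Rightarrow> 'g list \<Rightarrow> real" where
  "coincidences f k l = (\<Sum>g\<leftarrow>k. hits f l (f g))"

lemma hits_simps [simp]:
  "hits f [] y = 0"
  "hits f (g # l) y = of_bool (f g = y) + hits f l y"
  "hits f (k @ l) y = hits f k y + hits f l y"
  by (simp_all add: hits_def)

lemma coincidences_simps [simp]:
  "coincidences f [] l = 0"
  "coincidences f (g # k) l = hits f l (f g) + coincidences f k l"
  "coincidences f (k @ k') l = coincidences f k l + coincidences f k' l"
  by (simp_all add: coincidences_def)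

lemma hits_bounds: "0 \<le> hits f l y" "hits f l y \<le> length l"
  by (induction l) auto

lemma coincidences_bounds: "0 \<le> coincidences f k l" "coincidences f k l \<le> real (length k * length l)"
proof (induction k)
  case (Cons g k)
  {
    case 1
    show ?case using Cons.IH(1) hits_bounds(1)[of f l "f g"] by simp
  next
    case 2
    show ?case using Cons.IH(2) hits_bounds(2)[of f l "f g"] by (simp add: algebra_simps)
  }
qed auto

lemma coincidences_eq_sum:
  assumes "finite Y" "f ` set k \<subseteq> Y"
  shows "coincidences f k l = (\<Sum>y\<in>Y. hits f k y * hits f l y)"
  using assms(2)
proof (induction k)
  case (Cons g k)
  have "(\<Sum>y\<in>Y. of_bool (f g = y) * hits f l y) = (\<Sum>y\<in>Y. if f g = y then hits f l y else 0)"
    by (intro sum.cong refl) auto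
  also have "\<dots> = hits f l (f g)" using assms(1) Cons.prems by simp
  finally show ?case using Cons by (simp add: distrib_right sum.distrib)
qed simp

lemma coincidences_commute: "coincidences f k l = coincidences f l k"
  using coincidences_eq_sum[of "f ` set k \<union> f ` set l" f k l]
    coincidences_eq_sum[of "f ` set k \<union> f ` set l" f l k] by (simp add: mult.commute)

text \<open>The right side is the squared l2 distance of the multiplicity functions, and a single
  point contributes only one of its terms.\<close>

lemma hits_diff_square_le:
  "(hits f k y - hits f l y)\<^sup>2 \<le> coincidences f k k + coincidences f l l - 2 * coincidences f k l"
proof -
  define Y where "Y = insert y (f ` set k \<union> f ` set l)"
  have Y: "finite Y" "f ` set k \<subseteq> Y" "f ` set l \<subseteq> Y" by (auto simp: Y_def)
  have "(\<Sum>z\<in>{y}. (hits f k z - hits f l z)\<^sup>2) \<le> (\<Sum>z\<in>Y. (hits f k z - hits f l z)\<^sup>2)"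
    by (rule sum_mono2) (auto simp: Y_def)
  also have "\<dots> = coincidences f k k + coincidences f l l - 2 * coincidences f k l"
    unfolding coincidences_eq_sum[OF Y(1,2)] coincidences_eq_sum[OF Y(1,3)]
    by (simp add: power2_eq_square algebra_simps sum.distrib sum_subtractf sum_distrib_left)
  finally show ?thesis by simp
qed

lemma sum_hits_le: "finite Y \<Longrightarrow> (\<Sum>y\<in>Y. hits f l y) \<le> length l"
proof (induction l)
  case (Cons g l)
  have "(\<Sum>y\<in>Y. of_bool (f g = y)) = (\<Sum>y\<in>Y. if f g = y then 1 else (0::real))"
    by (intro sum.cong refl) auto
  also have "\<dots> \<le> 1" using Cons.prems by simp
  finally show ?case using Cons by (simp add: sum.distrib)
qed simp

lemma map_hits: "hits f (map m l) y = hits (\<lambda>g. f (m g)) l y"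
  by (induction l) auto

lemma map_coincidences: "coincidences f (map m k) (map m l) = coincidences (\<lambda>g. f (m g)) k l"
  by (induction k) (auto simp: map_hits)

lemma hits_cong: "(\<And>g. g \<in> set l \<Longrightarrow> (f g = y) = (f' g = y')) \<Longrightarrow> hits f l y = hits f' l y'"
  by (induction l) auto

lemma coincidences_cong:
  assumes "\<And>g h. g \<in> set k \<Longrightarrow> h \<in> set l \<Longrightarrow> (f g = f h) = (f' g = f' h)"
  shows "coincidences f k l = coincidences f' k l"
  using assms
proof (induction k)
  case (Cons a k)
  have "hits f l (f a) = hits f' l (f' a)" by (rule hits_cong) (use Cons.prems in force)
  then show ?case using Cons by simp
qed simp

text \<open>A countable base works, since finite sets are closed in a metrizable space. Singletons
  \<open>C\<close> serve for measurability of the diagonal, finite orbits \<open>C\<close> for the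
  ergodicity argument.\<close>

lemma standard_borel_separating:
  assumes "standard_borel \<mu>"
  obtains \<B> where "countable \<B>" "\<B> \<subseteq> sets \<mu>"
    "\<And>C x. finite C \<Longrightarrow> C \<subseteq> space \<mu> \<Longrightarrow> x \<in> space \<mu> - C \<Longrightarrow> \<exists>B\<in>\<B>. x \<in> B \<and> B \<inter> C = {}"
proof -
  obtain T where T: "topspace T = space \<mu>" "completely_metrizable_space T" "second_countable T"
    "sets \<mu> = sigma_sets (space \<mu>) {U. openin T U}"
    using assms unfolding standard_borel_def by blast
  obtain \<B> where B: "countable \<B>" "\<And>V. V \<in> \<B> \<Longrightarrow> openin T V"
    "\<And>U x. openin T U \<Longrightarrow> x \<in> U \<Longrightarrow> \<exists>V\<in>\<B>. x \<in> V \<and> V \<subseteq> U"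
    using T(3) unfolding second_countable_def by metis
  have haus: "Hausdorff_space T"
    using T(2) completely_metrizable_imp_metrizable_space metrizable_imp_Hausdorff_space by blast
  show ?thesis
  proof (rule that[OF B(1)])
    show "\<B> \<subseteq> sets \<mu>" using B(2) T(4) by (auto intro: sigma_sets.Basic)
  next
    fix C x assume C: "finite C" "C \<subseteq> space \<mu>" "x \<in> space \<mu> - C"
    then have "closedin T C" using haus T(1) by (simp add: closedin_Hausdorff_finite)
    then have "openin T (space \<mu> - C)" using T(1) by (metis openin_diff openin_topspace)
    then show "\<exists>B\<in>\<B>. x \<in> B \<and> B \<inter> C = {}" using B(3)[OF _ C(3)] by blast
  qed
qed

section \<open>Measure preserving actions of countable groups\<close>

locale countable_borel_action = pmp_action \<Gamma> \<mu> \<phi>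
  for \<Gamma> :: "('g, 'b) monoid_scheme" (structure) and \<mu> :: "'x measure" and \<phi> :: "'g \<Rightarrow> 'x \<Rightarrow> 'x" +
  assumes countable_group: "countable (carrier \<Gamma>)"
    and standard: "standard_borel \<mu>"
begin

lemma group_\<Gamma>: "group \<Gamma>"
  using group_hom group_hom.axioms(1) by blast

sublocale \<Gamma>: group \<Gamma> by (rule group_\<Gamma>)

lemma act_closed: "g \<in> carrier \<Gamma> \<Longrightarrow> x \<in> space \<mu> \<Longrightarrow> \<phi> g x \<in> space \<mu>"
  using element_image by blast

lemma act_mult: "\<lbrakk>g \<in> carrier \<Gamma>; h \<in> carrier \<Gamma>; x \<in> space \<mu>\<rbrakk> \<Longrightarrow> \<phi> (g \<otimes> h) x = \<phi> g (\<phi> h x)"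
  using composition_rule by blast

lemma act_one: "x \<in> space \<mu> \<Longrightarrow> \<phi> \<one> x = x"
  using id_eq_one by (metis restrict_apply')

lemma act_inv: "\<lbrakk>g \<in> carrier \<Gamma>; x \<in> space \<mu>\<rbrakk> \<Longrightarrow> \<phi> (inv g) (\<phi> g x) = x"
  "\<lbrakk>g \<in> carrier \<Gamma>; x \<in> space \<mu>\<rbrakk> \<Longrightarrow> \<phi> g (\<phi> (inv g) x) = x"
  by (simp_all flip: act_mult add: act_one)

lemma act_eq_iff: "\<lbrakk>g \<in> carrier \<Gamma>; x \<in> space \<mu>; y \<in> space \<mu>\<rbrakk> \<Longrightarrow> \<phi> g x = \<phi> g y \<longleftrightarrow> x = y"
  by (metis act_inv(1))

text \<open>Two points are equal iff they lie in the same members of a countable separating family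
  of measurable sets.\<close>

lemma sets_pair_eq [measurable]:
  assumes f: "f \<in> N \<rightarrow>\<^sub>M \<mu>" and g: "g \<in> N \<rightarrow>\<^sub>M \<mu>"
  shows "{x \<in> space N. f x = g x} \<in> sets N"
proof -
  obtain \<B> where B: "countable \<B>" "\<B> \<subseteq> sets \<mu>"
    "\<And>C x. finite C \<Longrightarrow> C \<subseteq> space \<mu> \<Longrightarrow> x \<in> space \<mu> - C \<Longrightarrow> \<exists>B\<in>\<B>. x \<in> B \<and> B \<inter> C = {}"
    using standard_borel_separating[OF standard] by blast
  have "f x = g x \<longleftrightarrow> (\<forall>B\<in>\<B>. f x \<in> B \<longleftrightarrow> g x \<in> B)" if "x \<in> space N" for x
  proof
    assume *: "\<forall>B\<in>\<B>. f x \<in> B \<longleftrightarrow> g x \<in> B"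
    show "f x = g x"
    proof (rule ccontr)
      assume "f x \<noteq> g x"
      then have "\<exists>B\<in>\<B>. f x \<in> B \<and> B \<inter> {g x} = {}"
        using that f g by (intro B(3)) (auto dest: measurable_space)
      then show False using * by auto
    qed
  qed simp
  then have "{x \<in> space N. f x = g x} = {x \<in> space N. \<forall>B\<in>\<B>. f x \<in> B \<longleftrightarrow> g x \<in> B}" by blast
  also have "\<dots> \<in> sets N"
  proof (rule sets.sets_Collect_countable_All'[OF _ B(1)])
    fix B assume "B \<in> \<B>"
    then have "B \<in> sets \<mu>" using B(2) by auto
    then show "{x \<in> space N. (f x \<in> B) = (g x \<in> B)} \<in> sets N" using f g by measurable
  qed
  finally show ?thesis .
qed

lemma integral_act:
  fixes f :: "'x \<Rightarrow> 'c::{banach, second_countable_topology}"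
  assumes "g \<in> carrier \<Gamma>" "f \<in> borel_measurable \<mu>"
  shows "(\<integral>x. f (\<phi> g x) \<partial>\<mu>) = (\<integral>x. f x \<partial>\<mu>)"
  using integral_distr[OF action_measurable[OF assms(1)] assms(2)] action_preserves[OF assms(1)] by simp

lemma AE_act:
  assumes "g \<in> carrier \<Gamma>" "AE x in \<mu>. P x"
  shows "AE x in \<mu>. P (\<phi> g x)"
proof -
  have "AE x in distr \<mu> \<mu> (\<phi> g). P x" unfolding action_preserves[OF assms(1)] by (rule assms(2))
  then show ?thesis by (rule AE_distrD[OF action_measurable[OF assms(1)]])
qed

abbreviation translates :: "'x \<Rightarrow> 'g \<Rightarrow> 'x" where
  "translates x \<equiv> (\<lambda>g. \<phi> g x)"

abbreviation orbit_of :: "'x \<Rightarrow> 'x set" where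
  "orbit_of x \<equiv> (translates x) ` carrier \<Gamma>"

lemma measurable_hits [measurable]:
  assumes "set l \<subseteq> carrier \<Gamma>" "f \<in> \<mu> \<rightarrow>\<^sub>M \<mu>"
  shows "(\<lambda>x. hits (translates x) l (f x)) \<in> borel_measurable \<mu>"
  using assms(1)
proof (induction l)
  case (Cons g l)
  have "{x \<in> space \<mu>. \<phi> g x = f x} \<in> sets \<mu>"
    using Cons.prems by (intro sets_pair_eq action_measurable assms) auto
  then have "Measurable.pred \<mu> (\<lambda>x. \<phi> g x = f x)" by (simp add: pred_def)
  then have "(\<lambda>x. of_bool (\<phi> g x = f x) :: real) \<in> borel_measurable \<mu>" by measurable
  then show ?case using Cons by simp
qed simp

lemma measurable_coincidences [measurable]:
  assumes "set k \<subseteq> carrier \<Gamma>" "set l \<subseteq> carrier \<Gamma>"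
  shows "(\<lambda>x. coincidences (translates x) k l) \<in> borel_measurable \<mu>"
  using assms(1)
  by (induction k) (auto intro!: borel_measurable_add measurable_hits assms(2) action_measurable)

lemma integrable_hits:
  assumes "set l \<subseteq> carrier \<Gamma>" "f \<in> \<mu> \<rightarrow>\<^sub>M \<mu>"
  shows "integrable \<mu> (\<lambda>x. hits (translates x) l (f x))"
  by (intro integrable_const_bound[where B = "length l"] measurable_hits assms AE_I2)
    (simp add: hits_bounds)

lemma integrable_coincidences:
  assumes "set k \<subseteq> carrier \<Gamma>" "set l \<subseteq> carrier \<Gamma>"
  shows "integrable \<mu> (\<lambda>x. coincidences (translates x) k l)"
  by (intro integrable_const_bound[where B = "length k * length l"] measurable_coincidences assms AE_I2)
    (simp add: coincidences_bounds flip: of_nat_mult)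

text \<open>Divided by \<open>(length l)\<^sup>2\<close>, the energy of \<open>l\<close> with itself
  is the probability that two independent random entries of \<open>l\<close> send a random point to
  the same place.\<close>

definition energy :: "'g list \<Rightarrow> 'g list \<Rightarrow> real" where
  "energy k l = (\<integral>x. coincidences (translates x) k l \<partial>\<mu>)"

lemma energy_commute: "energy k l = energy l k"
  unfolding energy_def by (subst coincidences_commute) simp

lemma energy_append:
  assumes "set k \<subseteq> carrier \<Gamma>" "set k' \<subseteq> carrier \<Gamma>" "set l \<subseteq> carrier \<Gamma>"
  shows "energy (k @ k') l = energy k l + energy k' l"
  using assms by (simp add: energy_def integrable_coincidences)

text \<open>Left translation applies one injective map to all the points \<open>\<phi> g x\<close>,
  so the coincidences are unchanged at every \<open>x\<close>.\<close>

lemma energy_translate: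
  assumes s: "s \<in> carrier \<Gamma>" and "set k \<subseteq> carrier \<Gamma>" "set l \<subseteq> carrier \<Gamma>"
  shows "energy (map ((\<otimes>) s) k) (map ((\<otimes>) s) l) = energy k l"
  unfolding energy_def map_coincidences
proof (rule Bochner_Integration.integral_cong[OF refl], rule coincidences_cong)
  fix x g h assume "x \<in> space \<mu>" "g \<in> set k" "h \<in> set l"
  moreover from this have "g \<in> carrier \<Gamma>" "h \<in> carrier \<Gamma>" using assms by auto
  ultimately show "(\<phi> (s \<otimes> g) x = \<phi> (s \<otimes> h) x) = (\<phi> g x = \<phi> h x)"
    using s by (simp add: act_mult act_closed act_eq_iff)
qed

text \<open>Right translation replaces the base point by \<open>\<phi> s x\<close>. The coincidences
  at \<open>x\<close> may change, but their integral does not, as \<open>\<mu>\<close> is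
  invariant.\<close>

lemma energy_translate_right:
  assumes s: "s \<in> carrier \<Gamma>" and k: "set k \<subseteq> carrier \<Gamma>" and l: "set l \<subseteq> carrier \<Gamma>"
  shows "energy (map (\<lambda>g. g \<otimes> s) k) (map (\<lambda>g. g \<otimes> s) l) = energy k l"
proof -
  have "energy (map (\<lambda>g. g \<otimes> s) k) (map (\<lambda>g. g \<otimes> s) l)
      = (\<integral>x. coincidences (\<lambda>g. \<phi> g (\<phi> s x)) k l \<partial>\<mu>)"
    unfolding energy_def map_coincidences
    using assms by (intro Bochner_Integration.integral_cong[OF refl] coincidences_cong) (auto simp: act_mult subset_iff)
  also have "\<dots> = energy k l"
    unfolding energy_def by (rule integral_act[OF s measurable_coincidences[OF k l]])
  finally show ?thesis .
qed

lemma energy_le_mean: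
  assumes "set k \<subseteq> carrier \<Gamma>" "set l \<subseteq> carrier \<Gamma>"
  shows "2 * energy k l \<le> energy k k + energy l l"
proof -
  have "2 * energy k l = (\<integral>x. 2 * coincidences (translates x) k l \<partial>\<mu>)" by (simp add: energy_def)
  also have "\<dots> \<le> (\<integral>x. coincidences (translates x) k k + coincidences (translates x) l l \<partial>\<mu>)"
  proof (intro integral_mono Bochner_Integration.integrable_add integrable_mult_right integrable_coincidences assms)
    fix x
    \<comment> \<open>The point is arbitrary: all that enters is that the left side of
      \<open>hits_diff_square_le\<close> is nonnegative.\<close>
    have "0 \<le> (hits (translates x) k undefined - hits (translates x) l undefined)\<^sup>2" by simp
    also note hits_diff_square_le
    finally show "2 * coincidences (translates x) k l \<le> coincidences (translates x) k k + coincidences (translates x) l l"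
      by simp
  qed
  also have "\<dots> = energy k k + energy l l" by (simp add: energy_def integrable_coincidences assms)
  finally show ?thesis .
qed

end

text \<open>A bound on a square becomes one that is linear in \<open>d\<close> and can be
  integrated, which replaces Cauchy-Schwarz for integrals. It is sharpest when \<open>e\<close> is
  the square root of \<open>d\<close>.\<close>

lemma abs_le_of_square_le:
  fixes a e d :: real
  assumes "0 < e" "a\<^sup>2 \<le> d"
  shows "\<bar>a\<bar> \<le> e / 2 + d / (2 * e)"
proof -
  have "0 \<le> (\<bar>a\<bar> - e)\<^sup>2" by simp
  then have "2 * \<bar>a\<bar> * e \<le> e\<^sup>2 + d" using assms(2) unfolding power2_diff power2_abs by linarith
  then have "\<bar>a\<bar> \<le> (e\<^sup>2 + d) / (2 * e)" using assms(1) by (simp add: pos_le_divide_eq mult_ac)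
  also have "\<dots> = e / 2 + d / (2 * e)" using assms(1) by (simp add: add_divide_distrib power2_eq_square)
  finally show ?thesis .
qed

context countable_borel_action begin

text \<open>If a typical point has a finite orbit, a basic open set separates this orbit from any
  point outside it. The saturation of that set is invariant, hence null or conull, and either is
  impossible if both points are typical. So the finite orbit has full measure, contrary to
  diffuseness.\<close>

lemma AE_infinite_orbit:
  assumes diff: "diffuse \<mu>" and erg: "ergodic_action \<Gamma> \<mu> \<phi>"
  shows "AE x in \<mu>. infinite (orbit_of x)"
proof -
  obtain \<B> where B: "countable \<B>" "\<B> \<subseteq> sets \<mu>"
    "\<And>C x. finite C \<Longrightarrow> C \<subseteq> space \<mu> \<Longrightarrow> x \<in> space \<mu> - C \<Longrightarrow> \<exists>B\<in>\<B>. x \<in> B \<and> B \<inter> C = {}"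
    using standard_borel_separating[OF standard] by blast
  define sat where "sat = (\<lambda>B. {x \<in> space \<mu>. \<exists>g\<in>carrier \<Gamma>. \<phi> g x \<in> B})"
  have sat_sets: "sat B \<in> sets \<mu>" if "B \<in> \<B>" for B
    unfolding sat_def
  proof (rule sets.sets_Collect_countable_Ex'[OF _ countable_group])
    fix g assume "g \<in> carrier \<Gamma>"
    then have "\<phi> g -` B \<inter> space \<mu> \<in> sets \<mu>" using that B(2) by (auto intro: measurable_sets action_measurable)
    then show "{x \<in> space \<mu>. \<phi> g x \<in> B} \<in> sets \<mu>" by (simp add: vimage_def Int_def conj_commute)
  qed
  have sat_inv: "\<phi> g x \<in> sat B \<longleftrightarrow> x \<in> sat B" if g: "g \<in> carrier \<Gamma>" and x: "x \<in> space \<mu>" for g x B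
  proof
    assume "\<phi> g x \<in> sat B"
    then obtain h where "h \<in> carrier \<Gamma>" "\<phi> h (\<phi> g x) \<in> B" by (auto simp: sat_def)
    then show "x \<in> sat B" using g x by (auto simp: sat_def simp flip: act_mult)
  next
    assume "x \<in> sat B"
    then obtain h where h: "h \<in> carrier \<Gamma>" "\<phi> h x \<in> B" by (auto simp: sat_def)
    then have "\<phi> (h \<otimes> inv g) (\<phi> g x) \<in> B" using g x by (simp add: act_mult act_closed act_inv)
    then show "\<phi> g x \<in> sat B" using g x h by (auto simp: sat_def act_closed)
  qed
  have sat_image: "\<phi> g ` sat B = sat B" if g: "g \<in> carrier \<Gamma>" for g B
  proof
    have "x \<in> space \<mu>" if "x \<in> sat B" for x using that by (simp add: sat_def)
    then show "\<phi> g ` sat B \<subseteq> sat B" using g sat_inv by blast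
    show "sat B \<subseteq> \<phi> g ` sat B"
    proof
      fix x assume x: "x \<in> sat B"
      then have xs: "x \<in> space \<mu>" by (simp add: sat_def)
      then have "\<phi> (inv g) x \<in> sat B" using x g sat_inv by simp
      then show "x \<in> \<phi> g ` sat B" using act_inv(2)[OF g xs] by force
    qed
  qed
  \<comment> \<open>Outside \<open>N\<close> a point lies in the saturation of a member of
    \<open>\<B>\<close> iff that saturation is conull, so any two such points lie in the same
    saturations.\<close>
  define N where "N = (\<Union>B\<in>{B \<in> \<B>. emeasure \<mu> (sat B) = 0}. sat B) \<union>
    (\<Union>B\<in>{B \<in> \<B>. emeasure \<mu> (space \<mu> - sat B) = 0}. space \<mu> - sat B)"
  have "N \<in> null_sets \<mu>"
    unfolding N_def
  proof (intro null_sets.Un null_sets_UN')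
    show "countable {B \<in> \<B>. emeasure \<mu> (sat B) = 0}"
      "countable {B \<in> \<B>. emeasure \<mu> (space \<mu> - sat B) = 0}"
      by (rule countable_subset[OF _ B(1)], blast)+
  next
    fix B assume "B \<in> {B \<in> \<B>. emeasure \<mu> (sat B) = 0}"
    then show "sat B \<in> null_sets \<mu>" using sat_sets by (intro null_setsI) simp_all
  next
    fix B assume "B \<in> {B \<in> \<B>. emeasure \<mu> (space \<mu> - sat B) = 0}"
    then show "space \<mu> - sat B \<in> null_sets \<mu>" using sat_sets by (intro null_setsI) simp_all
  qed
  then have AEN: "AE x in \<mu>. x \<notin> N" by (rule AE_not_in)
  show ?thesis
  proof (rule ccontr)
    assume neg: "\<not> ?thesis"
    have "\<exists>x\<in>space \<mu>. x \<notin> N \<and> finite (orbit_of x)"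
    proof (rule ccontr)
      assume "\<not> (\<exists>x\<in>space \<mu>. x \<notin> N \<and> finite (orbit_of x))"
      then have "AE x in \<mu>. infinite (orbit_of x)" by (intro AE_mp[OF AEN, OF AE_I2]) auto
      then show False using neg by simp
    qed
    then obtain x where x: "x \<in> space \<mu>" "x \<notin> N" "finite (orbit_of x)" by blast
    have sub: "orbit_of x \<subseteq> space \<mu>" using x act_closed by auto
    have "y \<in> orbit_of x" if y: "y \<in> space \<mu>" "y \<notin> N" for y
    proof (rule ccontr)
      assume "y \<notin> orbit_of x"
      then obtain V where V: "V \<in> \<B>" "y \<in> V" "V \<inter> orbit_of x = {}"
        using B(3)[OF x(3) sub, of y] y by blast
      have "\<phi> \<one> y \<in> V" using act_one[OF y(1)] V(2) by simp
      then have "y \<in> sat V" using y(1) \<Gamma>.one_closed unfolding sat_def by blast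
      moreover have "x \<notin> sat V" using V(3) unfolding sat_def by blast
      moreover have "emeasure \<mu> (sat V) = 0 \<or> emeasure \<mu> (space \<mu> - sat V) = 0"
        using erg sat_sets[OF V(1)] sat_image unfolding ergodic_action_def by blast
      ultimately show False using x(1,2) y V(1) unfolding N_def by blast
    qed
    then have "AE y in \<mu>. y \<in> orbit_of x" by (intro AE_mp[OF AEN, OF AE_I2]) auto
    moreover have "AE y in \<mu>. y \<noteq> z" if "z \<in> orbit_of x" for z
    proof -
      have z: "z \<in> space \<mu>" using that sub by auto
      have "{y \<in> space \<mu>. y = z} \<in> sets \<mu>" by (rule sets_pair_eq) (use z in auto)
      moreover have "{y \<in> space \<mu>. y = z} = {z}" using z by auto
      ultimately have "{z} \<in> null_sets \<mu>" using diff z by (simp add: diffuse_def null_sets_def)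
      then show ?thesis by (rule AE_I') auto
    qed
    then have "AE y in \<mu>. \<forall>z\<in>orbit_of x. y \<noteq> z" using x(3) by (intro AE_finite_allI)
    ultimately have "AE y in \<mu>. False" by eventually_elim auto
    then show False by (simp add: AE_False)
  qed
qed

text \<open>Points with fewer than \<open>M\<close> distinct images under the first \<open>n\<close>
  group elements form a decreasing sequence of sets whose intersection is null, so continuity from
  above applies.\<close>

lemma exists_large_finite_orbit_part:
  assumes inf: "AE x in \<mu>. infinite (orbit_of x)" and "0 < (\<delta>::real)"
  obtains S where "finite S" "S \<subseteq> carrier \<Gamma>"
    "{x \<in> space \<mu>. card ((translates x) ` S) < M} \<in> sets \<mu>"
    "measure \<mu> {x \<in> space \<mu>. card ((translates x) ` S) < M} < \<delta>"
proof -
  define e where "e = from_nat_into (carrier \<Gamma>)"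
  have ne: "carrier \<Gamma> \<noteq> {}" using \<Gamma>.one_closed by blast
  have e: "range e = carrier \<Gamma>" unfolding e_def by (rule range_from_nat_into[OF ne countable_group])
  define c where "c = (\<lambda>n x. card ((translates x) ` e ` {..<n}))"
  define A where "A = (\<lambda>n. {x \<in> space \<mu>. c n x < M})"
  \<comment> \<open>The recursion reduces measurability of the cardinality to that of the sets where
    two translates agree.\<close>
  have c_Suc: "c (Suc n) x = (if \<exists>j\<in>{..<n}. \<phi> (e n) x = \<phi> (e j) x then c n x else Suc (c n x))" for n x
  proof -
    have "(translates x) ` e ` {..<Suc n} = insert (\<phi> (e n) x) ((translates x) ` e ` {..<n})"
      by (simp add: lessThan_Suc)
    then show ?thesis by (auto simp: c_def card_insert_if)
  qed
  have c_meas: "c n \<in> \<mu> \<rightarrow>\<^sub>M count_space UNIV" for n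
  proof (induction n)
    case (Suc n)
    have "{x \<in> space \<mu>. \<exists>j\<in>{..<n}. \<phi> (e n) x = \<phi> (e j) x} \<in> sets \<mu>"
      using e by (intro sets.sets_Collect_finite_Ex sets_pair_eq action_measurable) auto
    then have "Measurable.pred \<mu> (\<lambda>x. \<exists>j\<in>{..<n}. \<phi> (e n) x = \<phi> (e j) x)" by (simp add: pred_def)
    with Suc show ?case unfolding c_Suc[abs_def] by measurable
  qed (simp add: c_def)
  have A_sets: "A n \<in> sets \<mu>" for n
    unfolding A_def using c_meas[of n] by measurable
  have c_mono: "c m x \<le> c n x" if "m \<le> n" for m n x
    unfolding c_def by (intro card_mono image_mono) (use that in auto)
  have "decseq A" unfolding A_def decseq_def using c_mono by (auto intro: order_le_less_trans)
  then have "(\<lambda>n. measure \<mu> (A n)) \<longlonglongrightarrow> measure \<mu> (\<Inter>n. A n)"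
    by (intro finite_Lim_measure_decseq) (use A_sets in auto)
  moreover have "measure \<mu> (\<Inter>n. A n) = 0"
  proof -
    have "AE x in \<mu>. x \<notin> (\<Inter>n. A n)"
    proof (rule AE_mp[OF inf], intro AE_I2 impI)
      fix x assume "x \<in> space \<mu>" "infinite (orbit_of x)"
      then obtain F where F: "F \<subseteq> orbit_of x" "finite F" "card F = M"
        using infinite_arbitrarily_large by blast
      have "F \<subseteq> (\<lambda>i. \<phi> (e i) x) ` UNIV" using F(1) unfolding e[symmetric] image_image .
      then obtain I where I: "finite I" "F = (\<lambda>i. \<phi> (e i) x) ` I"
        using finite_subset_image[OF F(2)] by blast
      then obtain n where "I \<subseteq> {..<n}" using finite_nat_bounded by auto
      then have "F \<subseteq> (translates x) ` e ` {..<n}" using I by auto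
      then have "M \<le> c n x" unfolding c_def F(3)[symmetric] by (intro card_mono) auto
      then show "x \<notin> (\<Inter>n. A n)" by (auto simp: A_def intro!: exI[of _ n])
    qed
    moreover have "(\<Inter>n. A n) \<in> sets \<mu>" using A_sets by auto
    ultimately show ?thesis by (simp add: AE_iff_null_sets measure_eq_0_null_sets)
  qed
  ultimately have "(\<lambda>n. measure \<mu> (A n)) \<longlonglongrightarrow> 0" by simp
  then have "\<forall>\<^sub>F n in sequentially. measure \<mu> (A n) < \<delta>" using \<open>0 < \<delta>\<close> by (rule order_tendstoD(2))
  then have "\<exists>n. measure \<mu> (A n) < \<delta>" by (rule eventually_happens'[OF sequentially_bot])
  then obtain n where n: "measure \<mu> (A n) < \<delta>" by blast
  show ?thesis
  proof (rule that)
    show "finite (e ` {..<n})" "e ` {..<n} \<subseteq> carrier \<Gamma>" unfolding e[symmetric] by auto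
  qed (use n A_sets[of n] in \<open>unfold A_def c_def\<close>)
qed

text \<open>If \<open>l\<close> almost minimises \<open>energy l l / (length l)\<^sup>2\<close>, then concatenating it with
  a translate cannot lower this quotient much, so \<open>l\<close> is almost invariant under translations.
  Since orbits are infinite, an almost invariant distribution on an orbit has no large atoms.\<close>

lemma exists_small_energy:
  assumes inf: "AE x in \<mu>. infinite (orbit_of x)" and \<delta>: "0 < (\<delta>::real)"
  obtains l where "l \<noteq> []" "set l \<subseteq> carrier \<Gamma>" "energy l l \<le> \<delta> * (real (length l))\<^sup>2"
proof -
  \<comment> \<open>The bound on the mass at a point is split into three parts of size
    \<open>\<delta> / 3\<close>: spreading over \<open>M\<close> points, the exceptional set
    \<open>bad S\<close>, and the failure of invariance.\<close>
  define M where "M = nat \<lceil>3 / \<delta>\<rceil> + 1"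
  have M: "0 < M" "1 / real M \<le> \<delta> / 3"
  proof -
    show "0 < M" by (simp add: M_def)
    have "3 / \<delta> \<le> real M" unfolding M_def by linarith
    then show "1 / real M \<le> \<delta> / 3" using \<delta> \<open>0 < M\<close> by (simp add: field_simps)
  qed
  define bad where "bad = (\<lambda>S. {x \<in> space \<mu>. card ((translates x) ` S) < M})"
  obtain S where S: "finite S" "S \<subseteq> carrier \<Gamma>" "bad S \<in> sets \<mu>" "measure \<mu> (bad S) < \<delta> / 3"
    using exists_large_finite_orbit_part[OF inf, of "\<delta> / 3" M] \<delta> unfolding bad_def by auto
  \<comment> \<open>There is one error term of size \<open>\<eta>\<close> for each element of
    \<open>S\<close>, and one more when the mass at a translate is compared with the mass at the
    base point.\<close>
  define \<eta> where "\<eta> = \<delta> / (3 * (real (card S) + 1))"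
  have \<eta>: "0 < \<eta>" "\<eta> * (real (card S) + 1) = \<delta> / 3" using \<delta> by (auto simp: \<eta>_def field_simps add_pos_nonneg)
  define V where "V = {l. l \<noteq> [] \<and> set l \<subseteq> carrier \<Gamma>}"
  define q where "q = (\<lambda>l. energy l l / (real (length l))\<^sup>2)"
  define I where "I = Inf (q ` V)"
  have energy_nonneg: "0 \<le> energy k l" for k l
    unfolding energy_def by (intro integral_nonneg_AE AE_I2 coincidences_bounds)
  have bdd: "bdd_below (q ` V)" by (rule bdd_belowI[of _ 0]) (auto simp: q_def energy_nonneg)
  have "[\<one>] \<in> V" by (simp add: V_def)
  then have "q ` V \<noteq> {}" by blast
  \<comment> \<open>Concatenation doubles the length and so multiplies the lower bound
    \<open>I * n\<^sup>2\<close> by 4; the slack \<open>\<eta>\<^sup>2 / 4\<close> then turns into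
    \<open>\<eta>\<^sup>2\<close> in \<open>D\<close>.\<close>
  then obtain l where l: "l \<in> V" "q l < I + \<eta>\<^sup>2 / 4"
    using \<eta>(1) cInf_lessD[of "q ` V" "I + \<eta>\<^sup>2 / 4"] unfolding I_def by auto
  have lc: "set l \<subseteq> carrier \<Gamma>" "l \<noteq> []" using l by (auto simp: V_def)
  define n where "n = real (length l)"
  have n: "0 < n" using lc by (simp add: n_def)
  have El: "energy l l < (I + \<eta>\<^sup>2 / 4) * n\<^sup>2" using l(2) n by (simp add: q_def n_def[symmetric] field_simps)
  define T where "T = (\<lambda>t. map ((\<otimes>) t) l)"
  have Tc: "set (T t) \<subseteq> carrier \<Gamma>" if "t \<in> carrier \<Gamma>" for t using that lc by (auto simp: T_def)
  \<comment> \<open>Only the mass at the base point is followed. By \<open>hT\<close>, the mass of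
    \<open>l\<close> at \<open>\<phi> s x\<close> is the mass of a translate of \<open>l\<close> at
    \<open>x\<close>, so invariance of \<open>l\<close> compares masses at different points of an
    orbit.\<close>
  define h where "h = (\<lambda>k x. hits (translates x) k x)"
  have h_int: "integrable \<mu> (h k)" if "set k \<subseteq> carrier \<Gamma>" for k
    unfolding h_def by (rule integrable_hits[OF that]) simp
  have inv: "(\<integral>x. \<bar>h l x - h (T t) x\<bar> \<partial>\<mu>) \<le> \<eta> * n" if t: "t \<in> carrier \<Gamma>" for t
  proof -
    have ET: "energy (T t) (T t) = energy l l" unfolding T_def by (rule energy_translate[OF t lc(1,1)])
    have "l @ T t \<in> V" using Tc[OF t] lc by (auto simp: V_def)
    then have Iq: "I \<le> q (l @ T t)" unfolding I_def by (intro cInf_lower bdd) auto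
    have "energy (l @ T t) (l @ T t) = energy l (l @ T t) + energy (T t) (l @ T t)"
      using Tc[OF t] lc by (intro energy_append) auto
    also have "energy l (l @ T t) = energy l l + energy (T t) l"
      using Tc[OF t] lc by (subst energy_commute) (rule energy_append)
    also have "energy (T t) (l @ T t) = energy l (T t) + energy (T t) (T t)"
      using Tc[OF t] lc by (subst energy_commute) (rule energy_append)
    finally have "energy (l @ T t) (l @ T t) = 2 * energy l l + 2 * energy l (T t)"
      using ET energy_commute[of l "T t"] by simp
    moreover have "real (length (l @ T t)) = 2 * n" by (simp add: n_def T_def)
    ultimately have "I \<le> (2 * energy l l + 2 * energy l (T t)) / (2 * n)\<^sup>2"
      using Iq by (simp only: q_def)
    then have "4 * I * n\<^sup>2 \<le> 2 * energy l l + 2 * energy l (T t)" using n by (simp add: field_simps power2_eq_square)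
    then have D: "2 * (energy l l - energy l (T t)) \<le> \<eta>\<^sup>2 * n\<^sup>2" using El by (simp add: algebra_simps)
    define d where "d = (\<lambda>x. coincidences (translates x) l l + coincidences (translates x) (T t) (T t)
        - 2 * coincidences (translates x) l (T t))"
    note ci = integrable_coincidences[OF lc(1,1)] integrable_coincidences[OF Tc[OF t] Tc[OF t]]
      integrable_coincidences[OF lc(1) Tc[OF t]]
    have d_int: "integrable \<mu> d" unfolding d_def
      by (intro Bochner_Integration.integrable_add Bochner_Integration.integrable_diff integrable_mult_right ci)
    have "(\<integral>x. d x \<partial>\<mu>) = energy l l + energy (T t) (T t) - 2 * energy l (T t)"
      using ci by (simp add: d_def energy_def)
    then have d_le: "(\<integral>x. d x \<partial>\<mu>) \<le> \<eta>\<^sup>2 * n\<^sup>2" using D ET by simp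
    \<comment> \<open>With \<open>e = \<eta> * n\<close> both summands contribute
      \<open>\<eta> * n / 2\<close>.\<close>
    have "(\<integral>x. \<bar>h l x - h (T t) x\<bar> \<partial>\<mu>) \<le> (\<integral>x. \<eta> * n / 2 + d x / (2 * (\<eta> * n)) \<partial>\<mu>)"
    proof (rule integral_mono)
      show "integrable \<mu> (\<lambda>x. \<bar>h l x - h (T t) x\<bar>)"
        using h_int[OF lc(1)] h_int[OF Tc[OF t]] by auto
      show "integrable \<mu> (\<lambda>x. \<eta> * n / 2 + d x / (2 * (\<eta> * n)))" using d_int by simp
      fix x
      show "\<bar>h l x - h (T t) x\<bar> \<le> \<eta> * n / 2 + d x / (2 * (\<eta> * n))"
      proof (rule abs_le_of_square_le)
        show "(h l x - h (T t) x)\<^sup>2 \<le> d x" unfolding h_def d_def by (rule hits_diff_square_le)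
      qed (use \<eta>(1) n in simp)
    qed
    also have "\<dots> = \<eta> * n / 2 + (\<integral>x. d x \<partial>\<mu>) / (2 * (\<eta> * n))" using d_int by (simp add: prob_space)
    also have "\<dots> \<le> \<eta> * n / 2 + (\<eta>\<^sup>2 * n\<^sup>2) / (2 * (\<eta> * n))"
      using d_le \<eta>(1) n by (intro add_left_mono divide_right_mono) auto
    also have "\<dots> = \<eta> * n" using \<eta>(1) n by (simp add: power2_eq_square)
    finally show ?thesis .
  qed
  have hT: "hits (translates x) l (\<phi> s x) = h (T (inv s)) x" if s: "s \<in> carrier \<Gamma>" and x: "x \<in> space \<mu>" for s x
    unfolding h_def T_def map_hits
  proof (rule hits_cong)
    fix g assume "g \<in> set l"
    then have g: "g \<in> carrier \<Gamma>" using lc by auto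
    have "\<phi> (inv s \<otimes> g) x = x \<longleftrightarrow> \<phi> (inv s) (\<phi> g x) = \<phi> (inv s) (\<phi> s x)"
      using g s x by (simp add: act_mult act_inv)
    also have "\<dots> \<longleftrightarrow> \<phi> g x = \<phi> s x" using g s x by (intro act_eq_iff) (auto simp: act_closed)
    finally show "(\<phi> g x = \<phi> s x) = (\<phi> (inv s \<otimes> g) x = x)" by simp
  qed
  define c where "c = (\<integral>x. h l x \<partial>\<mu>)"
  define D where "D = (\<lambda>s x. \<bar>h l x - h (T (inv s)) x\<bar>)"
  have D_int: "integrable \<mu> (D s)" if "s \<in> carrier \<Gamma>" for s
    unfolding D_def using h_int[OF lc(1)] h_int[OF Tc, of "inv s"] that by auto
  have D_le: "(\<integral>x. D s x \<partial>\<mu>) \<le> \<eta> * n" if "s \<in> carrier \<Gamma>" for s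
    unfolding D_def using inv[of "inv s"] that by simp
  have "c \<le> (\<integral>x. n / real M + n * indicator (bad S) x + (\<Sum>s\<in>S. D s x) \<partial>\<mu>)"
    unfolding c_def
  proof (rule integral_mono[OF h_int[OF lc(1)]])
    show "integrable \<mu> (\<lambda>x. n / real M + n * indicator (bad S) x + (\<Sum>s\<in>S. D s x))"
      using S D_int by (intro Bochner_Integration.integrable_add integrable_mult_right Bochner_Integration.integrable_sum integrable_real_indicator) (auto simp: less_top[symmetric])
    fix x assume x: "x \<in> space \<mu>"
    have D0: "0 \<le> (\<Sum>s\<in>S. D s x)" by (intro sum_nonneg) (auto simp: D_def)
    show "h l x \<le> n / real M + n * indicator (bad S) x + (\<Sum>s\<in>S. D s x)"
    proof (cases "x \<in> bad S")
      case True
      have "h l x \<le> n" "0 \<le> n / real M" unfolding h_def n_def by (simp_all add: hits_bounds)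
      with True show ?thesis using D0 by simp
    next
      case False
      \<comment> \<open>Each of the at least \<open>M\<close> points of \<open>Y\<close> carries
        nearly the mass \<open>h l x\<close>, while the total mass is \<open>n\<close>; so
        \<open>h l x\<close> is at most \<open>n / M\<close> up to the errors.\<close>
      define Y where "Y = (translates x) ` S"
      have Y: "finite Y" "real M \<le> real (card Y)" using False S x by (auto simp: Y_def bad_def)
      have "h l x - (\<Sum>s\<in>S. D s x) \<le> hits (translates x) l y" if "y \<in> Y" for y
      proof -
        obtain s where s: "s \<in> S" "y = \<phi> s x" using \<open>y \<in> Y\<close> by (auto simp: Y_def)
        have "D s x \<le> (\<Sum>s\<in>S. D s x)" using S s by (intro member_le_sum) (auto simp: D_def)
        moreover have "h l x - D s x \<le> hits (translates x) l y"
          using s S hT[OF _ x] by (auto simp: D_def)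
        ultimately show ?thesis by simp
      qed
      then have "(\<Sum>y\<in>Y. h l x - (\<Sum>s\<in>S. D s x)) \<le> (\<Sum>y\<in>Y. hits (translates x) l y)" by (rule sum_mono)
      also have "\<dots> \<le> n" unfolding n_def by (rule sum_hits_le[OF Y(1)])
      finally have "real (card Y) * (h l x - (\<Sum>s\<in>S. D s x)) \<le> n" by simp
      then have "h l x - (\<Sum>s\<in>S. D s x) \<le> n / real (card Y)" using Y(2) M(1) by (simp add: field_simps)
      also have "\<dots> \<le> n / real M" using Y(2) M(1) n by (intro divide_left_mono) auto
      finally show ?thesis using False by simp
    qed
  qed
  also have "\<dots> = n / real M + n * measure \<mu> (bad S) + (\<Sum>s\<in>S. \<integral>x. D s x \<partial>\<mu>)"
  proof -
    have 1: "integrable \<mu> (\<lambda>x. n * indicator (bad S) x)"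
      using S by (intro integrable_mult_right integrable_real_indicator) (auto simp: less_top[symmetric])
    have 2: "integrable \<mu> (\<lambda>x. \<Sum>s\<in>S. D s x)"
      using S D_int by (intro Bochner_Integration.integrable_sum) auto
    have 3: "(\<integral>x. (\<Sum>s\<in>S. D s x) \<partial>\<mu>) = (\<Sum>s\<in>S. \<integral>x. D s x \<partial>\<mu>)"
      using S D_int by (intro Bochner_Integration.integral_sum) auto
    have "(\<integral>x. n / real M + n * indicator (bad S) x + (\<Sum>s\<in>S. D s x) \<partial>\<mu>)
        = (\<integral>x. n / real M + n * indicator (bad S) x \<partial>\<mu>) + (\<integral>x. (\<Sum>s\<in>S. D s x) \<partial>\<mu>)"
      by (intro Bochner_Integration.integral_add Bochner_Integration.integrable_add 1 2) simp
    also have "(\<integral>x. n / real M + n * indicator (bad S) x \<partial>\<mu>)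
        = (\<integral>x. n / real M \<partial>\<mu>) + (\<integral>x. n * indicator (bad S) x \<partial>\<mu>)"
      by (intro Bochner_Integration.integral_add 1) simp
    finally show ?thesis using S(3) unfolding 3 by (simp add: prob_space)
  qed
  also have "\<dots> \<le> n * (\<delta> / 3) + n * (\<delta> / 3) + (\<Sum>s\<in>S. \<eta> * n)"
  proof (intro add_mono sum_mono)
    show "n / real M \<le> n * (\<delta> / 3)" using mult_left_mono[OF M(2), of n] n by simp
    show "n * measure \<mu> (bad S) \<le> n * (\<delta> / 3)" using S(4) n by (intro mult_left_mono) auto
    show "(\<integral>x. D s x \<partial>\<mu>) \<le> \<eta> * n" if "s \<in> S" for s using S(2) D_le that by blast
  qed
  finally have c: "c + \<eta> * n \<le> \<delta> * n"
    using arg_cong[OF \<eta>(2), of "\<lambda>z. z * n"] by (simp add: algebra_simps)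
  \<comment> \<open>The energy adds up, over the entries \<open>g\<close> of \<open>l\<close>, the
    expected mass of \<open>l\<close> at \<open>\<phi> g x\<close>, which by almost invariance
    exceeds the mass at \<open>x\<close> by at most \<open>\<eta> * n\<close> on average.\<close>
  have "energy l l \<le> (\<Sum>g\<leftarrow>l. c + \<eta> * n)"
  proof -
    have part: "energy k l \<le> (\<Sum>g\<leftarrow>k. c + \<eta> * n)" if "set k \<subseteq> carrier \<Gamma>" for k
      using that
    proof (induction k)
      case (Cons g k)
      have g: "g \<in> carrier \<Gamma>" using Cons.prems by simp
      have "energy (g # k) l = energy [g] l + energy k l"
        using energy_append[of "[g]" k l] Cons.prems lc by simp
      moreover have "energy [g] l = (\<integral>x. h (T (inv g)) x \<partial>\<mu>)"
        unfolding energy_def using hT[OF g] by (intro Bochner_Integration.integral_cong) auto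
      moreover have "(\<integral>x. h (T (inv g)) x \<partial>\<mu>) \<le> (\<integral>x. h l x + D g x \<partial>\<mu>)"
        using h_int[OF lc(1)] h_int[OF Tc, of "inv g"] D_int[OF g] g
        by (intro integral_mono) (auto simp: D_def)
      moreover have "\<dots> = c + (\<integral>x. D g x \<partial>\<mu>)" using h_int[OF lc(1)] D_int[OF g] by (simp add: c_def)
      ultimately show ?case using Cons D_le[OF g] by simp
    qed (simp add: energy_def)
    show ?thesis by (rule part[OF lc(1)])
  qed
  also have "\<dots> = n * (c + \<eta> * n)" by (simp add: sum_list_triv n_def)
  also have "\<dots> \<le> \<delta> * n\<^sup>2" using mult_left_mono[OF c, of n] n by (simp add: power2_eq_square algebra_simps)
  finally have "energy l l \<le> \<delta> * (real (length l))\<^sup>2" unfolding n_def .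
  then show ?thesis by (rule that[OF lc(2,1)])
qed

end

section \<open>Property (T) excludes property (H)\<close>

text \<open>The Schur complement at \<open>p\<close> has the nonnegative diagonal entry
  \<open>1 - k i p * k p i\<close>.\<close>

lemma psd_kernel_norm_le_1:
  assumes "psd_kernel k" "k i i = 1" "k p p = 1"
  shows "cmod (k i p) \<le> 1"
proof -
  have "1 - k i p * k p i \<in> \<real>\<^sub>\<ge>\<^sub>0"
    using psd_kernel_diag[OF psd_kernel_schur[OF assms(1)], of p i] assms by (simp add: mult.commute)
  moreover have "k p i = cnj (k i p)" by (rule psd_kernel_hermitian[OF assms(1)])
  ultimately have "(cmod (k i p))\<^sup>2 \<le> 1"
    by (simp add: complex_nonneg_Reals_iff complex_norm_square[symmetric] del: of_real_power)
  then show ?thesis by (simp add: power_le_one_iff abs_square_le_1)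
qed

lemma Re_sum_list: "Re (sum_list l) = (\<Sum>x\<leftarrow>l. Re x)"
  by (induction l) auto

lemma sum_list_sum_swap:
  "(\<Sum>x\<leftarrow>l. \<Sum>i\<in>A. f x i) = (\<Sum>i\<in>A. \<Sum>x\<leftarrow>l. f x i)"
  by (induction l) (simp_all add: sum.distrib)

section \<open>The orbit relation as a measured groupoid\<close>

context countable_borel_action begin

abbreviation agreement where
  "agreement g h \<equiv> measure \<mu> {x \<in> space \<mu>. \<phi> g x = \<phi> h x}"

definition R where "R = orbit_groupoid \<Gamma> \<mu> \<phi>"

lemma R_simps [simp]:
  "units R = space \<mu>" "rng R = fst" "src R = snd" "comp R a b = (fst a, snd b)"
  "arr_inv R = prod.swap" "unit_arrow R x = (x, x)"
  by (simp_all add: R_def orbit_groupoid_def)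

lemma same_orbit_iff:
  "(\<exists>C\<in>orbits \<Gamma> (space \<mu>) \<phi>. x \<in> C \<and> y \<in> C) \<longleftrightarrow> x \<in> space \<mu> \<and> y \<in> orbit_of x"
proof
  assume "\<exists>C\<in>orbits \<Gamma> (space \<mu>) \<phi>. x \<in> C \<and> y \<in> C"
  then obtain z g h where z: "z \<in> space \<mu>" "g \<in> carrier \<Gamma>" "h \<in> carrier \<Gamma>" "x = \<phi> g z" "y = \<phi> h z"
    unfolding orbits_def orbit_def by auto
  then have "y = \<phi> (h \<otimes> inv g) x" by (simp add: act_mult act_closed act_inv)
  then show "x \<in> space \<mu> \<and> y \<in> orbit_of x" using z by (auto simp: act_closed)
next
  assume *: "x \<in> space \<mu> \<and> y \<in> orbit_of x"
  then have "x = \<phi> \<one> x" by (simp add: act_one)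
  then have "x \<in> orbit \<Gamma> \<phi> x" unfolding orbit_def by blast
  moreover have "y \<in> orbit \<Gamma> \<phi> x" using * unfolding orbit_def by blast
  moreover have "orbit \<Gamma> \<phi> x \<in> orbits \<Gamma> (space \<mu>) \<phi>" using * unfolding orbits_def by blast
  ultimately show "\<exists>C\<in>orbits \<Gamma> (space \<mu>) \<phi>. x \<in> C \<and> y \<in> C" by blast
qed

lemma arrows_R: "arrows R = restrict_space (\<mu> \<Otimes>\<^sub>M \<mu>) {(x, y). x \<in> space \<mu> \<and> y \<in> orbit_of x}"
  by (simp add: R_def orbit_groupoid_def same_orbit_iff)

lemma orbit_of_subset: "x \<in> space \<mu> \<Longrightarrow> orbit_of x \<subseteq> space \<mu>"
  using act_closed by auto

lemma space_arrows_R: "space (arrows R) = {(x, y). x \<in> space \<mu> \<and> y \<in> orbit_of x}"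
  using orbit_of_subset by (auto simp: arrows_R space_restrict_space space_pair_measure)

lemma orbit_pairs_sets: "{(x, y). x \<in> space \<mu> \<and> y \<in> orbit_of x} \<in> sets (\<mu> \<Otimes>\<^sub>M \<mu>)"
proof -
  have "{(x, y). x \<in> space \<mu> \<and> y \<in> orbit_of x} =
      (\<Union>g\<in>carrier \<Gamma>. {p \<in> space (\<mu> \<Otimes>\<^sub>M \<mu>). snd p = \<phi> g (fst p)})"
    using act_closed by (auto simp: space_pair_measure)
  also have "\<dots> \<in> sets (\<mu> \<Otimes>\<^sub>M \<mu>)"
    using action_measurable countable_group
    by (intro sets.countable_UN' sets_pair_eq measurable_compose[OF measurable_fst]) auto
  finally show ?thesis .
qed

lemma orbit_of_translate:
  assumes g: "g \<in> carrier \<Gamma>" "x \<in> space \<mu>"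
  shows "orbit_of (\<phi> g x) = orbit_of x"
proof
  show "orbit_of (\<phi> g x) \<subseteq> orbit_of x" using g by (auto simp flip: act_mult)
  show "orbit_of x \<subseteq> orbit_of (\<phi> g x)"
  proof
    fix y assume "y \<in> orbit_of x"
    then obtain h where h: "h \<in> carrier \<Gamma>" "y = \<phi> h x" by auto
    then have "y = \<phi> (h \<otimes> inv g) (\<phi> g x)" using g by (simp add: act_mult act_closed act_inv)
    then show "y \<in> orbit_of (\<phi> g x)" using g h by blast
  qed
qed

lemma mem_orbit_of: "x \<in> space \<mu> \<Longrightarrow> x \<in> orbit_of x"
  by (metis \<Gamma>.one_closed act_one image_eqI)

lemma translate_pair_in_R:
  assumes "a \<in> carrier \<Gamma>" "b \<in> carrier \<Gamma>" "x \<in> space \<mu>"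
  shows "(\<phi> a x, \<phi> b x) \<in> space (arrows R)"
  using assms by (simp add: space_arrows_R act_closed orbit_of_translate)

lemma measurable_translate_pair:
  assumes "a \<in> carrier \<Gamma>" "b \<in> carrier \<Gamma>"
  shows "(\<lambda>x. (\<phi> a x, \<phi> b x)) \<in> \<mu> \<rightarrow>\<^sub>M arrows R"
  unfolding arrows_R
proof (rule measurable_restrict_space2)
  show "(\<lambda>x. (\<phi> a x, \<phi> b x)) \<in> \<mu> \<rightarrow>\<^sub>M \<mu> \<Otimes>\<^sub>M \<mu>"
    using action_measurable assms by (intro measurable_Pair) auto
  show "(\<lambda>x. (\<phi> a x, \<phi> b x)) \<in> space \<mu> \<rightarrow> {(x, y). x \<in> space \<mu> \<and> y \<in> orbit_of x}"
    using translate_pair_in_R[OF assms] by (auto simp: space_arrows_R)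
qed

definition enum where "enum = from_nat_into (carrier \<Gamma>)"

lemma range_enum: "range enum = carrier \<Gamma>"
  unfolding enum_def using \<Gamma>.one_closed countable_group by (intro range_from_nat_into) auto

lemma enum_in [simp]: "enum i \<in> carrier \<Gamma>"
  using range_enum by auto

lemma finite_sum_le_count_space:
  fixes f :: "'c \<Rightarrow> ennreal"
  assumes "finite J" "J \<subseteq> A"
  shows "(\<Sum>\<gamma>\<in>J. f \<gamma>) \<le> (\<integral>\<^sup>+\<gamma>. f \<gamma> \<partial>count_space A)"
proof -
  have "(\<integral>\<^sup>+\<gamma>. f \<gamma> * indicator J \<gamma> \<partial>count_space A) = (\<Sum>\<gamma>\<in>J. f \<gamma> * indicator J \<gamma>)"
    by (rule nn_integral_count_space') (use assms in auto)
  also have "\<dots> = (\<Sum>\<gamma>\<in>J. f \<gamma>)" by (intro sum.cong) auto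
  finally have "(\<Sum>\<gamma>\<in>J. f \<gamma>) = (\<integral>\<^sup>+\<gamma>. f \<gamma> * indicator J \<gamma> \<partial>count_space A)" by simp
  also have "\<dots> \<le> (\<integral>\<^sup>+\<gamma>. f \<gamma> \<partial>count_space A)" by (intro nn_integral_mono) (auto simp: indicator_def)
  finally show ?thesis .
qed

text \<open>Disjoint pieces of \<open>E\<close>, one for each enumerated group element, have a
  summable total measure, so the pieces from some \<open>m\<close> on are negligible. Where the
  graph of \<open>g\<close> meets \<open>E\<close> outside them, \<open>g\<close> agrees with one of
  the first \<open>m\<close> elements. This is the substitute for decay at infinity on the
  group.\<close>

lemma finite_measure_arrows_tail:
  assumes E: "E \<in> sets (arrows R)" and fin: "groupoid_measure R \<mu> E < \<infinity>" and \<eta>: "0 < (\<eta>::real)"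
  obtains m where "\<And>g. g \<in> carrier \<Gamma> \<Longrightarrow> measure \<mu> {x \<in> space \<mu>. (\<phi> g x, x) \<in> E} \<le>
    \<eta> + (\<Sum>i<m. agreement g (enum i))"
proof -
  have one: "(\<lambda>x. (\<phi> g x, x)) \<in> \<mu> \<rightarrow>\<^sub>M arrows R" if "g \<in> carrier \<Gamma>" for g
  proof -
    have "(\<lambda>x. (\<phi> g x, \<phi> \<one> x)) \<in> \<mu> \<rightarrow>\<^sub>M arrows R" by (rule measurable_translate_pair[OF that]) simp
    then show ?thesis by (rule measurable_cong[THEN iffD1, rotated]) (simp add: act_one)
  qed
  define P where "P = (\<lambda>g. {x \<in> space \<mu>. (\<phi> g x, x) \<in> E})"
  have P: "P g \<in> sets \<mu>" if "g \<in> carrier \<Gamma>" for g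
    using measurable_sets[OF one[OF that] E] by (simp add: P_def vimage_def Int_def conj_commute)
  define Q where "Q = (\<lambda>g h. {x \<in> space \<mu>. \<phi> g x = \<phi> h x})"
  have Q: "Q g h \<in> sets \<mu>" if "g \<in> carrier \<Gamma>" "h \<in> carrier \<Gamma>" for g h
    unfolding Q_def using that by (intro sets_pair_eq action_measurable)
  \<comment> \<open>Points where an earlier element takes the same value are removed, so for fixed
    \<open>x\<close> the arrows counted by different indices are distinct.\<close>
  define u where "u = (\<lambda>i. P (enum i) - (\<Union>j<i. Q (enum j) (enum i)))"
  have u: "u i \<in> sets \<mu>" for i unfolding u_def using P Q by auto
  have part: "(\<Sum>i<n. emeasure \<mu> (u i)) \<le> groupoid_measure R \<mu> E" for n
  proof -
    have "(\<Sum>i<n. emeasure \<mu> (u i)) = (\<integral>\<^sup>+x. (\<Sum>i<n. indicator (u i) x) \<partial>\<mu>)"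
      using u by (simp add: nn_integral_sum)
    also have "\<dots> \<le> groupoid_measure R \<mu> E"
      unfolding groupoid_measure_def groupoid_integral_def
    proof (rule nn_integral_mono)
      fix x assume x: "x \<in> space \<mu>"
      define I where "I = {i. i < n \<and> x \<in> u i}"
      define J where "J = (\<lambda>i. (\<phi> (enum i) x, x)) ` I"
      have inj: "inj_on (\<lambda>i. (\<phi> (enum i) x, x)) I"
      proof (rule linorder_inj_onI)
        fix i j assume "i < j" "i \<in> I" "j \<in> I"
        then have "x \<notin> Q (enum i) (enum j)" unfolding I_def u_def by blast
        then show "(\<phi> (enum i) x, x) \<noteq> (\<phi> (enum j) x, x)" using x by (simp add: Q_def)
      qed auto
      have J: "finite J" "J \<subseteq> src_fibre R x" "J \<subseteq> E"
      proof -
        show "finite J" unfolding J_def I_def by simp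
        show "J \<subseteq> E" unfolding J_def I_def u_def P_def by blast
        then have "J \<subseteq> space (arrows R)" using sets.sets_into_space[OF E] by blast
        then show "J \<subseteq> src_fibre R x" unfolding src_fibre_def J_def by auto
      qed
      have "(\<Sum>i<n. indicator (u i) x :: ennreal) = (\<Sum>i\<in>I. 1)"
        by (rule sum.mono_neutral_cong_right) (auto simp: I_def indicator_def)
      also have "\<dots> = (\<Sum>\<gamma>\<in>J. 1)" unfolding J_def by (simp add: card_image[OF inj])
      also have "\<dots> = (\<Sum>\<gamma>\<in>J. indicator E \<gamma>)" using J(3) by (intro sum.cong) auto
      also have "\<dots> \<le> (\<integral>\<^sup>+\<gamma>. indicator E \<gamma> \<partial>count_space (src_fibre R x))"
        by (rule finite_sum_le_count_space[OF J(1,2)])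
      finally show "(\<Sum>i<n. indicator (u i) x) \<le> (\<integral>\<^sup>+\<gamma>. indicator E \<gamma> \<partial>count_space (src_fibre R x))" .
    qed
    finally show ?thesis .
  qed
  have "(\<Sum>i<n. measure \<mu> (u i)) \<le> enn2real (groupoid_measure R \<mu> E)" for n
  proof -
    have "ennreal (\<Sum>i<n. measure \<mu> (u i)) = (\<Sum>i<n. emeasure \<mu> (u i))"
      by (simp add: emeasure_eq_measure sum_ennreal)
    also have "\<dots> \<le> ennreal (enn2real (groupoid_measure R \<mu> E))" using part fin by simp
    finally show ?thesis by (simp add: ennreal_le_iff)
  qed
  then have sm: "summable (\<lambda>i. measure \<mu> (u i))"
    by (intro summableI_nonneg_bounded) auto
  then obtain m where m: "\<bar>\<Sum>i. measure \<mu> (u (i + m))\<bar> < \<eta>"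
    using suminf_exist_split[OF \<eta> sm] by auto
  have "measure \<mu> (\<Union>i. u (i + m)) \<le> (\<Sum>i. measure \<mu> (u (i + m)))"
    using u by (intro finite_measure_subadditive_countably summable_ignore_initial_segment[OF sm]) auto
  then have tail: "measure \<mu> (\<Union>i. u (i + m)) \<le> \<eta>" using m by linarith
  show ?thesis
  proof (rule that)
    fix g assume g: "g \<in> carrier \<Gamma>"
    have "P g \<subseteq> (\<Union>i<m. Q g (enum i)) \<union> (\<Union>i. u (i + m))"
    proof
      fix x assume x: "x \<in> P g"
      then have xs: "x \<in> space \<mu>" by (simp add: P_def)
      \<comment> \<open>The first enumerated element that agrees with \<open>g\<close> at
        \<open>x\<close>: either its index is below \<open>m\<close>, or \<open>x\<close> belongs to
        its piece \<open>u i\<close> in the tail.\<close>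
      define i where "i = (LEAST i. \<phi> (enum i) x = \<phi> g x)"
      have "\<exists>i. \<phi> (enum i) x = \<phi> g x" using g range_enum by (metis imageE)
      then have i: "\<phi> (enum i) x = \<phi> g x" unfolding i_def by (rule LeastI_ex)
      have less: "\<phi> (enum j) x \<noteq> \<phi> g x" if "j < i" for j using not_less_Least that unfolding i_def by blast
      show "x \<in> (\<Union>i<m. Q g (enum i)) \<union> (\<Union>i. u (i + m))"
      proof (cases "i < m")
        case True
        then show ?thesis using i xs by (auto simp: Q_def intro!: bexI[of _ i])
      next
        case False
        have "x \<in> u i" using x xs i less by (auto simp: u_def P_def Q_def)
        moreover have "i = (i - m) + m" using False by simp
        ultimately show ?thesis by (metis UNIV_I UN_I UnI2)
      qed
    qed
    then have "measure \<mu> (P g) \<le> measure \<mu> ((\<Union>i<m. Q g (enum i)) \<union> (\<Union>i. u (i + m)))"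
      using Q g u by (intro finite_measure_mono) auto
    also have "\<dots> \<le> measure \<mu> (\<Union>i<m. Q g (enum i)) + measure \<mu> (\<Union>i. u (i + m))"
      using Q g u by (intro measure_Un_le) auto
    also have "measure \<mu> (\<Union>i<m. Q g (enum i)) \<le> (\<Sum>i<m. measure \<mu> (Q g (enum i)))"
      using Q g by (intro finite_measure_subadditive_finite) auto
    finally show "measure \<mu> {x \<in> space \<mu>. (\<phi> g x, x) \<in> E} \<le>
      \<eta> + (\<Sum>i<m. agreement g (enum i))"
      using tail unfolding P_def Q_def by linarith
  qed
qed

lemma energy_eq_sum:
  assumes "set k \<subseteq> carrier \<Gamma>" "set l \<subseteq> carrier \<Gamma>"
  shows "energy k l = (\<Sum>g\<leftarrow>k. \<Sum>h\<leftarrow>l. agreement h g)"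
proof -
  have single: "energy [g] l = (\<Sum>h\<leftarrow>l. agreement h g)"
    if g: "g \<in> carrier \<Gamma>" and "set l \<subseteq> carrier \<Gamma>" for g l
    using that(2)
  proof (induction l)
    case Nil
    then show ?case by (simp add: energy_def)
  next
    case (Cons h l)
    have "energy [g] (h # l) = energy ([h] @ l) [g]" by (subst energy_commute) simp
    also have "\<dots> = energy [h] [g] + energy [g] l"
      using Cons.prems g by (subst energy_append) (auto simp: energy_commute)
    also have "energy [h] [g] = agreement h g"
    proof -
      have "energy [h] [g] = (\<integral>x. indicator {x \<in> space \<mu>. \<phi> h x = \<phi> g x} x \<partial>\<mu>)"
        unfolding energy_def by (intro Bochner_Integration.integral_cong) (auto simp: indicator_def)
      also have "{x \<in> space \<mu>. \<phi> h x = \<phi> g x} \<in> sets \<mu>"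
        using Cons.prems g by (intro sets_pair_eq action_measurable) auto
      then have "(\<integral>x. indicator {x \<in> space \<mu>. \<phi> h x = \<phi> g x} x \<partial>\<mu>) = agreement h g"
        by simp
      finally show ?thesis .
    qed
    finally show ?case using Cons by simp
  qed
  show ?thesis
    using assms(1)
  proof (induction k)
    case Nil
    then show ?case by (simp add: energy_def)
  next
    case (Cons g k)
    have "energy ([g] @ k) l = energy [g] l + energy k l"
      using Cons.prems assms(2) by (intro energy_append) auto
    then show ?case using Cons single[of g l] assms(2) by simp
  qed
qed

text \<open>The order \<open>F (y j, y i)\<close> passes from the convention of
  \<open>positive_semidefinite_mat\<close>, which conjugates the first coefficient, to that of
  \<open>psd_kernel\<close>, which conjugates the second.\<close>

definition pd_at :: "('x \<times> 'x \<Rightarrow> complex) \<Rightarrow> 'x \<Rightarrow> bool" where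
  "pd_at F x \<longleftrightarrow> F (x, x) = 1 \<and> (\<forall>y. range y \<subseteq> orbit_of x \<longrightarrow> psd_kernel (\<lambda>i j. F (y j, y i)))"

text \<open>Quantifying over all translates makes the exceptional set invariant. The normalisation
  on the diagonal is then available at every point of the orbit, as the bound by 1 on arrows between
  arbitrary translates requires.\<close>

lemma AE_pd_at:
  assumes pd: "positive_definite_fun R \<mu> F" and one: "AE x in \<mu>. F (x, x) = 1"
  shows "AE x in \<mu>. \<forall>g\<in>carrier \<Gamma>. pd_at F (\<phi> g x)"
proof -
  obtain N where N: "N \<in> null_sets \<mu>"
    and psd: "\<And>x k \<gamma>. x \<in> space \<mu> - N \<Longrightarrow> (\<And>i. i < k \<Longrightarrow> \<gamma> i \<in> rng_fibre R x) \<Longrightarrow>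
        positive_semidefinite_mat k (\<lambda>i j. F (comp R (arr_inv R (\<gamma> i)) (\<gamma> j)))"
    using pd unfolding positive_definite_fun_def R_simps(1) by blast
  have pd_x: "pd_at F x" if x: "x \<in> space \<mu>" "x \<notin> N" "F (x, x) = 1" for x
    unfolding pd_at_def
  proof (intro conjI allI impI)
    fix y :: "nat \<Rightarrow> 'x" assume y: "range y \<subseteq> orbit_of x"
    show "psd_kernel (\<lambda>i j. F (y j, y i))"
      unfolding psd_kernel_def
    proof (intro allI)
      fix n and c :: "nat \<Rightarrow> complex"
      have "positive_semidefinite_mat n (\<lambda>i j. F (comp R (arr_inv R (x, y i)) (x, y j)))"
        by (rule psd) (use x y in \<open>auto simp: rng_fibre_def space_arrows_R\<close>)
      then have "(\<Sum>i<n. \<Sum>j<n. cnj (c i) * c j * F (y i, y j)) \<in> \<real>\<^sub>\<ge>\<^sub>0"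
        by (simp add: positive_semidefinite_mat_def)
      moreover have "(\<Sum>i<n. \<Sum>j<n. cnj (c i) * c j * F (y i, y j)) = (\<Sum>i<n. \<Sum>j<n. c i * cnj (c j) * F (y j, y i))"
        by (subst sum.swap) (simp add: mult.commute)
      ultimately show "(\<Sum>i<n. \<Sum>j<n. c i * cnj (c j) * F (y j, y i)) \<in> \<real>\<^sub>\<ge>\<^sub>0" by simp
    qed
  qed (use x in simp)
  have "AE x in \<mu>. pd_at F x"
    using AE_not_in[OF N] one AE_space by eventually_elim (use pd_x in blast)
  then have "AE x in \<mu>. pd_at F (\<phi> g x)" if "g \<in> carrier \<Gamma>" for g
    by (rule AE_act[OF that])
  then show ?thesis by (simp add: AE_ball_countable[OF countable_group])
qed

lemma pd_at_norm_le_1: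
  assumes x: "x \<in> space \<mu>" and pd: "\<forall>g\<in>carrier \<Gamma>. pd_at F (\<phi> g x)"
    and a: "a \<in> carrier \<Gamma>" and b: "b \<in> carrier \<Gamma>"
  shows "cmod (F (\<phi> a x, \<phi> b x)) \<le> 1"
proof -
  define y where "y = (\<lambda>i::nat. if i = 0 then \<phi> b x else \<phi> a x)"
  have diag: "F (\<phi> g x, \<phi> g x) = 1" if "g \<in> carrier \<Gamma>" for g
    using pd that by (simp add: pd_at_def)
  have "range y \<subseteq> orbit_of (\<phi> \<one> x)" using x a b by (auto simp: y_def act_one)
  then have "psd_kernel (\<lambda>i j. F (y j, y i))" using pd \<Gamma>.one_closed unfolding pd_at_def by blast
  then have "cmod (F (y 1, y 0)) \<le> 1"
    by (rule psd_kernel_norm_le_1) (auto simp: y_def diag a b)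
  then show ?thesis by (simp add: y_def)
qed

section \<open>From positive definite functions on the relation to the group\<close>

definition coefficient :: "('x \<times> 'x \<Rightarrow> complex) \<Rightarrow> 'g \<Rightarrow> complex" where
  "coefficient F g = (\<integral>x. F (\<phi> g x, x) \<partial>\<mu>)"

lemma measurable_F:
  assumes "F \<in> borel_measurable (arrows R)" "a \<in> carrier \<Gamma>" "b \<in> carrier \<Gamma>"
  shows "(\<lambda>x. F (\<phi> a x, \<phi> b x)) \<in> borel_measurable \<mu>"
  by (rule measurable_compose[OF measurable_translate_pair[OF assms(2,3)] assms(1)])

lemma integrable_F:
  assumes F: "F \<in> borel_measurable (arrows R)"
    and pd: "AE x in \<mu>. \<forall>g\<in>carrier \<Gamma>. pd_at F (\<phi> g x)"
    and a: "a \<in> carrier \<Gamma>" and b: "b \<in> carrier \<Gamma>"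
  shows "integrable \<mu> (\<lambda>x. F (\<phi> a x, \<phi> b x))"
proof (rule integrable_const_bound)
  show "AE x in \<mu>. cmod (F (\<phi> a x, \<phi> b x)) \<le> 1"
    using pd AE_space by eventually_elim (rule pd_at_norm_le_1[OF _ _ a b])
qed (rule measurable_F[OF F a b])

text \<open>Invariance of \<open>\<mu>\<close> under \<open>b\<close> moves the base point, so
  \<open>a\<close> and \<open>b\<close> enter symmetrically, as two points of the orbit of
  \<open>x\<close>. Pointwise positivity can then be integrated.\<close>

lemma coefficient_eq:
  assumes F: "F \<in> borel_measurable (arrows R)" and a: "a \<in> carrier \<Gamma>" and b: "b \<in> carrier \<Gamma>"
  shows "coefficient F (inv a \<otimes> b) = (\<integral>x. F (\<phi> (inv a) x, \<phi> (inv b) x) \<partial>\<mu>)"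
proof -
  have "coefficient F (inv a \<otimes> b) = (\<integral>x. F (\<phi> (inv a) (\<phi> b x), \<phi> (inv b) (\<phi> b x)) \<partial>\<mu>)"
    unfolding coefficient_def
    by (rule Bochner_Integration.integral_cong[OF refl]) (simp add: a b act_mult act_inv)
  also have "\<dots> = (\<integral>x. F (\<phi> (inv a) x, \<phi> (inv b) x) \<partial>\<mu>)"
    by (rule integral_act[OF b measurable_F[OF F]]) (use a b in auto)
  finally show ?thesis .
qed

lemma integral_nonneg_Reals:
  assumes "integrable \<mu> f" "AE x in \<mu>. f x \<in> \<real>\<^sub>\<ge>\<^sub>0"
  shows "(\<integral>x. f x \<partial>\<mu>) \<in> (\<real>\<^sub>\<ge>\<^sub>0 :: complex set)"
proof -
  have "0 \<le> (\<integral>x. Re (f x) \<partial>\<mu>)"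
    by (rule integral_nonneg_AE) (use assms(2) in eventually_elim, simp add: complex_nonneg_Reals_iff)
  moreover have "(\<integral>x. Im (f x) \<partial>\<mu>) = 0"
    by (rule integral_eq_zero_AE) (use assms(2) in eventually_elim, simp add: complex_nonneg_Reals_iff)
  ultimately show ?thesis using assms(1) by (simp add: complex_nonneg_Reals_iff)
qed

lemma pos_def_coefficient:
  assumes F: "F \<in> borel_measurable (arrows R)"
    and pd: "AE x in \<mu>. \<forall>g\<in>carrier \<Gamma>. pd_at F (\<phi> g x)"
  shows "pos_def_group_fun \<Gamma> (coefficient F)"
  unfolding pos_def_group_fun_def
proof (intro allI impI)
  fix n :: nat and c g assume "\<forall>i<n. g i \<in> carrier \<Gamma>"
  then have g: "g i \<in> carrier \<Gamma>" if "i < n" for i using that by auto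
  \<comment> \<open>The default value \<open>x\<close> keeps the whole sequence inside the orbit, as
    \<open>pd_at\<close> demands.\<close>
  define y where "y = (\<lambda>x i. if i < n then \<phi> (inv (g i)) x else x)"
  let ?S = "\<lambda>x. \<Sum>i<n. \<Sum>j<n. c i * cnj (c j) * F (y x j, y x i)"
  have int: "integrable \<mu> (\<lambda>x. F (y x j, y x i))" if "i < n" "j < n" for i j
    using integrable_F[OF F pd, of "inv (g j)" "inv (g i)"] g that by (simp add: y_def)
  have "(\<Sum>i<n. \<Sum>j<n. c i * cnj (c j) * coefficient F (inv (g j) \<otimes> g i))
      = (\<Sum>i<n. \<Sum>j<n. \<integral>x. c i * cnj (c j) * F (y x j, y x i) \<partial>\<mu>)"
    by (intro sum.cong refl) (simp add: coefficient_eq[OF F] g y_def)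
  also have "\<dots> = (\<integral>x. ?S x \<partial>\<mu>)"
  proof -
    have "(\<Sum>j<n. \<integral>x. c i * cnj (c j) * F (y x j, y x i) \<partial>\<mu>) = (\<integral>x. (\<Sum>j<n. c i * cnj (c j) * F (y x j, y x i)) \<partial>\<mu>)"
      if "i < n" for i
      using int[OF that] by (intro Bochner_Integration.integral_sum[symmetric] integrable_mult_right) auto
    then have "(\<Sum>i<n. \<Sum>j<n. \<integral>x. c i * cnj (c j) * F (y x j, y x i) \<partial>\<mu>)
        = (\<Sum>i<n. \<integral>x. (\<Sum>j<n. c i * cnj (c j) * F (y x j, y x i)) \<partial>\<mu>)" by (intro sum.cong) auto
    also have "\<dots> = (\<integral>x. ?S x \<partial>\<mu>)"
      using int by (intro Bochner_Integration.integral_sum[symmetric] Bochner_Integration.integrable_sum integrable_mult_right) auto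
    finally show ?thesis .
  qed
  also have "\<dots> \<in> \<real>\<^sub>\<ge>\<^sub>0"
  proof (rule integral_nonneg_Reals)
    show "integrable \<mu> ?S"
      using int by (intro Bochner_Integration.integrable_sum integrable_mult_right) auto
    show "AE x in \<mu>. ?S x \<in> \<real>\<^sub>\<ge>\<^sub>0"
      using pd AE_space
    proof eventually_elim
      fix x assume p: "\<forall>g\<in>carrier \<Gamma>. pd_at F (\<phi> g x)" and x: "x \<in> space \<mu>"
      have "range (y x) \<subseteq> orbit_of x" using g x mem_orbit_of[OF x] by (auto simp: y_def)
      then have "psd_kernel (\<lambda>i j. F (y x j, y x i))"
        using p[rule_format, OF \<Gamma>.one_closed] x by (simp add: pd_at_def act_one)
      then show "?S x \<in> \<real>\<^sub>\<ge>\<^sub>0"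
        by (rule psd_kernelD)
    qed
  qed
  finally show "(\<Sum>i<n. \<Sum>j<n. c i * cnj (c j) * coefficient F (inv (g j) \<otimes> g i)) \<in> \<real>\<^sub>\<ge>\<^sub>0" .
qed

lemma norm_coefficient_le:
  assumes F: "F \<in> borel_measurable (arrows R)"
    and pd: "AE x in \<mu>. \<forall>g\<in>carrier \<Gamma>. pd_at F (\<phi> g x)" and g: "g \<in> carrier \<Gamma>" and "0 \<le> \<eta>"
  shows "cmod (coefficient F g) \<le> \<eta> + measure \<mu> {x \<in> space \<mu>. (\<phi> g x, x) \<in> {\<gamma> \<in> space (arrows R). cmod (F \<gamma>) > \<eta>}}"
proof -
  define A where "A = {x \<in> space \<mu>. cmod (F (\<phi> g x, \<phi> \<one> x)) > \<eta>}"
  have "(\<lambda>x. cmod (F (\<phi> g x, \<phi> \<one> x))) \<in> borel_measurable \<mu>"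
    using measurable_F[OF F g \<Gamma>.one_closed] by measurable
  then have A: "A \<in> sets \<mu>" unfolding A_def by measurable
  have "coefficient F g = (\<integral>x. F (\<phi> g x, \<phi> \<one> x) \<partial>\<mu>)"
    unfolding coefficient_def by (rule Bochner_Integration.integral_cong[OF refl]) (simp add: act_one)
  also have "cmod \<dots> \<le> (\<integral>x. cmod (F (\<phi> g x, \<phi> \<one> x)) \<partial>\<mu>)" by (rule integral_norm_bound)
  also have "\<dots> \<le> (\<integral>x. \<eta> + indicator A x \<partial>\<mu>)"
  proof (rule integral_mono_AE)
    show "integrable \<mu> (\<lambda>x. cmod (F (\<phi> g x, \<phi> \<one> x)))"
      using integrable_F[OF F pd g \<Gamma>.one_closed] by simp
    show "integrable \<mu> (\<lambda>x. \<eta> + indicator A x)"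
      using A by (intro Bochner_Integration.integrable_add integrable_real_indicator) (auto simp: less_top[symmetric])
    show "AE x in \<mu>. cmod (F (\<phi> g x, \<phi> \<one> x)) \<le> \<eta> + indicator A x"
      using pd AE_space
    proof eventually_elim
      fix x assume "\<forall>g\<in>carrier \<Gamma>. pd_at F (\<phi> g x)" "x \<in> space \<mu>"
      then have "cmod (F (\<phi> g x, \<phi> \<one> x)) \<le> 1" by (intro pd_at_norm_le_1 g \<Gamma>.one_closed)
      then show "cmod (F (\<phi> g x, \<phi> \<one> x)) \<le> \<eta> + indicator A x"
        using \<open>0 \<le> \<eta>\<close> \<open>x \<in> space \<mu>\<close> by (auto simp: A_def indicator_def)
    qed
  qed
  also have "\<dots> = (\<integral>x. \<eta> \<partial>\<mu>) + (\<integral>x. indicator A x \<partial>\<mu>)"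
    using A by (intro Bochner_Integration.integral_add integrable_real_indicator) (auto simp: less_top[symmetric])
  also have "\<dots> = \<eta> + measure \<mu> A" using A by (simp add: prob_space)
  also have "A = {x \<in> space \<mu>. (\<phi> g x, x) \<in> {\<gamma> \<in> space (arrows R). cmod (F \<gamma>) > \<eta>}}"
    using translate_pair_in_R[OF g \<Gamma>.one_closed] by (auto simp: A_def act_one)
  finally show ?thesis .
qed

lemma not_property_H:
  assumes T: "property_T \<Gamma>" and inf: "AE x in \<mu>. infinite (orbit_of x)"
  shows "\<not> property_H R \<mu>"
proof
  assume "property_H R \<mu>"
  then obtain F where pdf: "\<And>n. positive_definite_fun R \<mu> (F n)"
    and one: "\<And>n. AE x in \<mu>. F n (x, x) = 1"
    and fin: "\<And>n \<epsilon>. 0 < \<epsilon> \<Longrightarrow> groupoid_measure R \<mu> {\<gamma> \<in> space (arrows R). cmod (F n \<gamma>) > \<epsilon>} < \<infinity>"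
    and lim: "\<exists>N\<in>sets (arrows R). groupoid_measure R \<mu> N = 0 \<and>
           (\<forall>\<gamma>\<in>space (arrows R) - N. (\<lambda>n. F n \<gamma>) \<longlonglongrightarrow> 1)"
    unfolding property_H_def R_simps by blast
  have F: "F n \<in> borel_measurable (arrows R)" for n using pdf by (auto simp: positive_definite_fun_def)
  note pd = AE_pd_at[OF pdf one]
  have infc: "infinite (carrier \<Gamma>)"
  proof
    assume "finite (carrier \<Gamma>)"
    then have "AE x in \<mu>. False" using inf by simp
    then show False by (simp add: AE_False)
  qed
  obtain K \<epsilon> where K: "finite K" "K \<subseteq> carrier \<Gamma>" "0 < (\<epsilon>::real)"
    and TK: "\<And>f. pos_def_group_fun \<Gamma> f \<Longrightarrow> f \<one> = 1 \<Longrightarrow> (\<And>g. g \<in> K \<Longrightarrow> 2 - 2 * Re (f g) < \<epsilon>\<^sup>2) \<Longrightarrow>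
      \<exists>\<delta>>0. \<forall>l. set l \<subseteq> carrier \<Gamma> \<longrightarrow>
        \<delta> * (real (length l))\<^sup>2 \<le> Re (\<Sum>g\<leftarrow>l. \<Sum>h\<leftarrow>l. f (inv h \<otimes> g))"
    using property_T_averages[OF group_\<Gamma> countable_group infc T] by blast
  have conv: "(\<lambda>n. coefficient (F n) g) \<longlonglongrightarrow> 1" if g: "g \<in> carrier \<Gamma>" for g
  proof -
    obtain N where N: "N \<in> sets (arrows R)" "groupoid_measure R \<mu> N = 0"
      and limN: "\<And>\<gamma>. \<gamma> \<in> space (arrows R) - N \<Longrightarrow> (\<lambda>n. F n \<gamma>) \<longlonglongrightarrow> 1" using lim by blast
    have Fg: "coefficient (F n) g = (\<integral>x. F n (\<phi> g x, \<phi> \<one> x) \<partial>\<mu>)" for n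
      unfolding coefficient_def by (rule Bochner_Integration.integral_cong[OF refl]) (simp add: act_one)
    \<comment> \<open>The arrow \<open>(\<phi> g x, x)\<close> is one term of the sum over the
      source fibre of \<open>x\<close>, so the set of \<open>x\<close> for which it lies in
      \<open>N\<close> has measure at most that of \<open>N\<close>.\<close>
    have NA: "AE x in \<mu>. (\<phi> g x, \<phi> \<one> x) \<notin> N"
    proof -
      have ms: "(\<lambda>x. (\<phi> g x, \<phi> \<one> x)) -` N \<inter> space \<mu> \<in> sets \<mu>" (is "?A \<in> _")
        by (rule measurable_sets[OF measurable_translate_pair[OF g \<Gamma>.one_closed] N(1)])
      have "emeasure \<mu> ?A = (\<integral>\<^sup>+x. indicator ?A x \<partial>\<mu>)" using ms by simp
      also have "\<dots> \<le> groupoid_measure R \<mu> N"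
        unfolding groupoid_measure_def groupoid_integral_def
      proof (rule nn_integral_mono)
        fix x assume x: "x \<in> space \<mu>"
        have "f (\<phi> g x, \<phi> \<one> x) \<le> (\<integral>\<^sup>+\<gamma>. f \<gamma> \<partial>count_space (src_fibre R x))" for f
          using finite_sum_le_count_space[of "{(\<phi> g x, \<phi> \<one> x)}" "src_fibre R x" f] x
            translate_pair_in_R[OF g \<Gamma>.one_closed x] by (simp add: src_fibre_def act_one)
        moreover have "indicator ?A x = (indicator N (\<phi> g x, \<phi> \<one> x) :: ennreal)"
          using x by (simp add: indicator_def)
        ultimately show "indicator ?A x \<le> (\<integral>\<^sup>+\<gamma>. indicator N \<gamma> \<partial>count_space (src_fibre R x))"
          by (simp only:)
      qed
      finally have "?A \<in> null_sets \<mu>" using N(2) ms by auto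
      then show ?thesis by (rule AE_I') auto
    qed
    have "(\<lambda>n. \<integral>x. F n (\<phi> g x, \<phi> \<one> x) \<partial>\<mu>) \<longlonglongrightarrow> (\<integral>x. 1 \<partial>\<mu>)"
    proof (rule integral_dominated_convergence[where w = "\<lambda>_. 1"])
      show "AE x in \<mu>. (\<lambda>n. F n (\<phi> g x, \<phi> \<one> x)) \<longlonglongrightarrow> 1"
        using NA AE_space by eventually_elim (use limN translate_pair_in_R[OF g \<Gamma>.one_closed] in auto)
      show "AE x in \<mu>. cmod (F n (\<phi> g x, \<phi> \<one> x)) \<le> 1" for n
        using pd[of n] AE_space by eventually_elim (rule pd_at_norm_le_1[OF _ _ g \<Gamma>.one_closed])
    qed (use measurable_F[OF F g \<Gamma>.one_closed] in auto)
    then show ?thesis by (simp add: Fg prob_space)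
  qed
  have "\<forall>\<^sub>F n in sequentially. \<forall>g\<in>K. 2 - 2 * Re (coefficient (F n) g) < \<epsilon>\<^sup>2"
  proof (rule eventually_ball_finite[OF K(1)], rule ballI)
    fix g assume "g \<in> K"
    then have "(\<lambda>n. 2 - 2 * Re (coefficient (F n) g)) \<longlonglongrightarrow> 2 - 2 * Re 1"
      using K(2) by (intro tendsto_intros conv) auto
    then show "\<forall>\<^sub>F n in sequentially. 2 - 2 * Re (coefficient (F n) g) < \<epsilon>\<^sup>2"
      using K(3) by (intro order_tendstoD(2)) auto
  qed
  then obtain n where n: "\<And>g. g \<in> K \<Longrightarrow> 2 - 2 * Re (coefficient (F n) g) < \<epsilon>\<^sup>2"
    using eventually_happens'[OF sequentially_bot] by blast
  have "coefficient (F n) \<one> = (\<integral>x. 1 \<partial>\<mu>)"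
    unfolding coefficient_def
  proof (rule integral_cong_AE)
    have "(\<lambda>x. F n (\<phi> \<one> x, \<phi> \<one> x)) \<in> borel_measurable \<mu>" by (rule measurable_F[OF F]) auto
    then show "(\<lambda>x. F n (\<phi> \<one> x, x)) \<in> borel_measurable \<mu>"
      by (rule measurable_cong[THEN iffD1, rotated]) (simp add: act_one)
    show "AE x in \<mu>. F n (\<phi> \<one> x, x) = 1"
      using one[of n] AE_space by eventually_elim (simp add: act_one)
  qed simp
  then have "coefficient (F n) \<one> = 1" by (simp add: prob_space)
  from TK[OF pos_def_coefficient[OF F pd] this n]
  obtain \<delta> where \<delta>: "0 < \<delta>" and lower: "\<And>l. set l \<subseteq> carrier \<Gamma> \<Longrightarrow>
      \<delta> * (real (length l))\<^sup>2 \<le> Re (\<Sum>g\<leftarrow>l. \<Sum>h\<leftarrow>l. coefficient (F n) (inv h \<otimes> g))"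
    by blast
  \<comment> \<open>The upper bound collects \<open>\<eta>\<close> three times: from small values of
    \<open>F n\<close>, from the tail of \<open>E\<close>, and from coincidences. The total
    \<open>3 / 4 * \<delta> * N\<close> contradicts the lower bound.\<close>
  define \<eta> where "\<eta> = \<delta> / 4"
  have \<eta>: "0 < \<eta>" using \<delta> by (simp add: \<eta>_def)
  define E where "E = {\<gamma> \<in> space (arrows R). cmod (F n \<gamma>) > \<eta>}"
  have E: "E \<in> sets (arrows R)" unfolding E_def using F[of n] by measurable
  obtain m where m: "\<And>g. g \<in> carrier \<Gamma> \<Longrightarrow> measure \<mu> {x \<in> space \<mu>. (\<phi> g x, x) \<in> E} \<le>
    \<eta> + (\<Sum>i<m. agreement g (enum i))"
    using finite_measure_arrows_tail[OF E _ \<eta>] fin[OF \<eta>, of n] unfolding E_def by blast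
  have up: "cmod (coefficient (F n) g) \<le> 2 * \<eta> + (\<Sum>i<m. agreement g (enum i))"
    if "g \<in> carrier \<Gamma>" for g
    using norm_coefficient_le[OF F pd that, of \<eta> n] m[OF that] \<eta> unfolding E_def by linarith
  \<comment> \<open>The energy occurs once for each of the \<open>m\<close> agreement terms;
    dividing by \<open>m + 1\<close> keeps their sum below \<open>\<eta> * N\<close> and also covers
    \<open>m = 0\<close>.\<close>
  obtain l where l: "l \<noteq> []" "set l \<subseteq> carrier \<Gamma>" "energy l l \<le> \<eta> / (real m + 1) * (real (length l))\<^sup>2"
    using exists_small_energy[OF inf, of "\<eta> / (real m + 1)"] \<eta> by auto
  define N where "N = (real (length l))\<^sup>2"
  have N: "0 < N" using l(1) by (simp add: N_def)
  \<comment> \<open>\<open>inv h \<otimes> g\<close> agrees with \<open>enum i\<close> at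
    \<open>x\<close> iff \<open>g\<close> agrees with \<open>h \<otimes> enum i\<close>. The sum is
    thus the energy of \<open>l\<close> against a right translate of itself, and a right translate
    has the same self-energy.\<close>
  have en: "(\<Sum>g\<leftarrow>l. \<Sum>h\<leftarrow>l. agreement (inv h \<otimes> g) (enum i)) \<le> energy l l" for i
  proof -
    have sub: "set (map (\<lambda>h. h \<otimes> enum i) l) \<subseteq> carrier \<Gamma>" using l(2) by auto
    have iff: "\<phi> (inv h \<otimes> g) x = \<phi> (enum i) x \<longleftrightarrow> \<phi> (h \<otimes> enum i) x = \<phi> g x"
      if "g \<in> carrier \<Gamma>" "h \<in> carrier \<Gamma>" "x \<in> space \<mu>" for g h x
    proof -
      have "\<phi> (inv h \<otimes> g) x = \<phi> (enum i) x \<longleftrightarrow> \<phi> h (\<phi> (inv h \<otimes> g) x) = \<phi> h (\<phi> (enum i) x)"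
        using that by (subst act_eq_iff) (auto simp: act_closed)
      also have "\<dots> \<longleftrightarrow> \<phi> g x = \<phi> (h \<otimes> enum i) x"
        using that by (simp add: act_mult act_closed act_inv)
      finally show ?thesis by auto
    qed
    have "(\<Sum>g\<leftarrow>l. \<Sum>h\<leftarrow>l. agreement (inv h \<otimes> g) (enum i))
        = (\<Sum>g\<leftarrow>l. \<Sum>h\<leftarrow>l. agreement (h \<otimes> enum i) g)"
      using l(2) iff by (intro arg_cong[where f = sum_list] map_cong refl arg_cong[where f = "measure \<mu>"]) blast
    also have "\<dots> = energy l (map (\<lambda>h. h \<otimes> enum i) l)"
      using energy_eq_sum[OF l(2) sub] by (simp add: o_def)
    also have "\<dots> \<le> energy l l"
      using energy_le_mean[OF l(2) sub] energy_translate_right[OF enum_in l(2,2), of i] by simp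
    finally show ?thesis .
  qed
  have "\<delta> * N \<le> Re (\<Sum>g\<leftarrow>l. \<Sum>h\<leftarrow>l. coefficient (F n) (inv h \<otimes> g))"
    unfolding N_def by (rule lower[OF l(2)])
  also have "\<dots> = (\<Sum>g\<leftarrow>l. \<Sum>h\<leftarrow>l. Re (coefficient (F n) (inv h \<otimes> g)))"
    by (simp add: Re_sum_list o_def)
  also have "\<dots> \<le> (\<Sum>g\<leftarrow>l. \<Sum>h\<leftarrow>l. 2 * \<eta> + (\<Sum>i<m. agreement (inv h \<otimes> g) (enum i)))"
  proof (intro sum_list_mono)
    fix g h assume "g \<in> set l" "h \<in> set l"
    then have "inv h \<otimes> g \<in> carrier \<Gamma>" using l(2) by auto
    from order_trans[OF complex_Re_le_cmod up[OF this]]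
    show "Re (coefficient (F n) (inv h \<otimes> g)) \<le>
        2 * \<eta> + (\<Sum>i<m. agreement (inv h \<otimes> g) (enum i))" .
  qed
  also have "\<dots> = 2 * \<eta> * N + (\<Sum>i<m. \<Sum>g\<leftarrow>l. \<Sum>h\<leftarrow>l. agreement (inv h \<otimes> g) (enum i))"
    by (simp add: sum_list_addf sum_list_triv sum_list_sum_swap N_def power2_eq_square)
  also have "\<dots> \<le> 2 * \<eta> * N + (\<Sum>i<m. energy l l)" by (intro add_left_mono sum_mono en)
  also have "\<dots> \<le> 2 * \<eta> * N + real m * (\<eta> / (real m + 1) * N)" 
    using mult_left_mono[OF l(3), of "real m"] by (simp add: N_def)
  also have "\<dots> \<le> 2 * \<eta> * N + \<eta> * N"
  proof -
    have "real m * (\<eta> / (real m + 1)) \<le> \<eta>" using \<eta> by (simp add: field_simps)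
    then have "real m * (\<eta> / (real m + 1)) * N \<le> \<eta> * N" using N by (intro mult_right_mono) auto
    then show ?thesis unfolding mult.assoc by linarith
  qed
  finally show False using N \<delta> by (simp add: \<eta>_def)
qed

end

section \<open>Positive definite kernels on forests\<close>

text \<open>Walks without backtracking. The condition is local, so along a fixed list of group
  elements it cuts out a measurable set of base points.\<close>

fun reduced_walk :: "('v \<Rightarrow> 'v \<Rightarrow> bool) \<Rightarrow> 'v list \<Rightarrow> bool" where
  "reduced_walk adj [] \<longleftrightarrow> False"
| "reduced_walk adj [x] \<longleftrightarrow> True"
| "reduced_walk adj [x, y] \<longleftrightarrow> adj x y"
| "reduced_walk adj (x # y # z # p) \<longleftrightarrow> adj x y \<and> x \<noteq> z \<and> reduced_walk adj (y # z # p)"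

fun walk_weight :: "('v \<Rightarrow> 'v \<Rightarrow> nat) \<Rightarrow> 'v list \<Rightarrow> nat" where
  "walk_weight c (x # y # p) = c x y + walk_weight c (y # p)"
| "walk_weight c _ = 0"

lemma reduced_walk_Cons:
  "reduced_walk adj p \<Longrightarrow> adj x (hd p) \<Longrightarrow> (tl p \<noteq> [] \<Longrightarrow> x \<noteq> hd (tl p)) \<Longrightarrow> reduced_walk adj (x # p)"
  by (cases "(adj, p)" rule: reduced_walk.cases) auto

lemma reduced_walk_tl: "reduced_walk adj (x # p) \<Longrightarrow> p \<noteq> [] \<Longrightarrow> reduced_walk adj p"
  by (cases "(adj, x # p)" rule: reduced_walk.cases) auto

lemma reduced_walk_adj: "reduced_walk adj (x # y # p) \<Longrightarrow> adj x y"
  by (cases p) auto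

lemma reduced_walk_append:
  "reduced_walk adj (p @ [y]) \<Longrightarrow> reduced_walk adj (y # q) \<Longrightarrow>
    (p \<noteq> [] \<Longrightarrow> q \<noteq> [] \<Longrightarrow> last p \<noteq> hd q) \<Longrightarrow> reduced_walk adj (p @ y # q)"
proof (induction p)
  case (Cons x p)
  have "reduced_walk adj (p @ [y])" by (rule reduced_walk_tl) (use Cons.prems(1) in auto)
  then have r: "reduced_walk adj (p @ y # q)" using Cons by (cases p) auto
  have a: "adj x (hd (p @ [y]))"
    using Cons.prems(1) by (cases p) (auto dest: reduced_walk_adj)
  show ?case
  proof (cases p)
    case Nil
    then show ?thesis using r a Cons.prems(3) by (cases q) auto
  next
    case (Cons b p')
    then show ?thesis using r a Cons.prems(1) by (cases p') auto
  qed
qed simp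

lemma reduced_walk_prefix: "reduced_walk adj (p @ q) \<Longrightarrow> p \<noteq> [] \<Longrightarrow> reduced_walk adj p"
  by (induction adj p rule: reduced_walk.induct) (auto dest: reduced_walk_adj)

lemma reduced_walk_successively: "reduced_walk adj p \<Longrightarrow> successively adj p"
  by (induction adj p rule: reduced_walk.induct) auto

lemma reduced_walk_rev:
  assumes sym: "\<And>x y. adj x y \<Longrightarrow> adj y x"
  shows "reduced_walk adj p \<Longrightarrow> reduced_walk adj (rev p)"
proof (induction p)
  case (Cons x p)
  show ?case
  proof (cases "\<exists>y z q. p = y # z # q")
    case True
    then obtain y z q where p: "p = y # z # q" by blast
    have "reduced_walk adj p" using Cons.prems p by simp
    then have "reduced_walk adj ((rev q @ [z]) @ [y])" using Cons.IH p by simp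
    then have "reduced_walk adj ((rev q @ [z]) @ y # [x])"
      by (rule reduced_walk_append) (use Cons.prems p sym[of x y] in auto)
    then show ?thesis using p by simp
  next
    case False
    then have "p = [] \<or> (\<exists>y. p = [y])" by (metis list.exhaust)
    then show ?thesis using Cons.prems sym[of x] by auto
  qed
qed simp

lemma walk_weight_append: "walk_weight c (p @ [y, x]) = walk_weight c (p @ [y]) + c y x"
proof (induction p)
  case (Cons a p)
  then show ?case by (cases p) auto
qed simp

lemma walk_weight_rev:
  assumes "\<And>x y. c x y = c y x"
  shows "walk_weight c (rev p) = walk_weight c p"
proof (induction p)
  case (Cons x p)
  show ?case
  proof (cases p)
    case (Cons y q)
    have "walk_weight c (rev (x # y # q)) = walk_weight c (rev q @ [y]) + c y x"
      using walk_weight_append[of c "rev q" y x] by simp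
    also have "walk_weight c (rev q @ [y]) = walk_weight c p" using Cons.IH Cons by simp
    finally show ?thesis using assms[of y x] Cons by simp
  qed simp
qed simp

locale forest =
  fixes adj :: "'v \<Rightarrow> 'v \<Rightarrow> bool" and c :: "'v \<Rightarrow> 'v \<Rightarrow> nat"
  assumes adj_sym: "adj x y \<Longrightarrow> adj y x"
    and adj_irrefl: "\<not> adj x x"
    and acyclic: "\<not> (3 \<le> length p \<and> distinct p \<and> successively adj p \<and> adj (last p) (hd p))"
    and c_sym: "c x y = c y x"
begin

text \<open>In a shortest counterexample the first and the last vertex are the only repetition.
  Dropping the last leaves a closed walk through distinct vertices: a cycle if there are at least
  three, a backtracking step if there are two, a loop if there is one.\<close>

lemma reduced_walk_distinct: "reduced_walk adj p \<Longrightarrow> distinct p"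
proof (induction "length p" arbitrary: p rule: less_induct)
  case less
  show ?case
  proof (rule ccontr)
    assume nd: "\<not> distinct p"
    obtain x q where p: "p = x # q" using nd by (cases p) auto
    with nd have "q \<noteq> []" by auto
    note p = p this
    define b where "b = butlast p"
    have pb: "p = b @ [last p]" "b \<noteq> []" using p by (auto simp: b_def)
    have "reduced_walk adj q" using less.prems p by (auto intro: reduced_walk_tl)
    then have "distinct q" using less.hyps[of q] p by simp
    have rb: "reduced_walk adj b" using less.prems pb reduced_walk_prefix by metis
    then have db: "distinct b" using less.hyps[of b] p by (simp add: b_def)
    have "x \<in> set q" using \<open>distinct q\<close> nd p by simp
    moreover have "x \<notin> set (butlast q)" using db p by (auto simp: b_def)
    moreover have "set q = insert (last q) (set (butlast q))"
      using arg_cong[OF append_butlast_last_id[OF p(2)], of set] by simp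
    ultimately have last: "x = last p" using p by auto
    have hd: "hd b = x" using p by (auto simp: b_def)
    have suc: "successively adj (b @ [x])" using reduced_walk_successively[OF less.prems] pb(1) last by simp
    then have a: "adj (last b) (hd b)" "successively adj b" using pb(2) hd by (simp_all add: successively_append_iff)
    have "length b < 3" using acyclic[of b] a db by auto
    moreover have "length b \<noteq> 1" using a(1) adj_irrefl by (cases b) auto
    moreover have "length b \<noteq> 2"
    proof
      assume "length b = 2"
      then obtain u v where "b = [u, v]" by (auto simp: numeral_2_eq_2 length_Suc_conv)
      then show False using less.prems pb(1) last hd by (metis append_Cons append_Nil list.sel(1) reduced_walk.simps(4))
    qed
    moreover have "length b \<noteq> 0" using pb(2) by simp
    ultimately show False by linarith
  qed
qed

text \<open>Where two such walks first diverge, the reverse of one followed by the other is again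
  reduced, but it visits the common endpoint twice.\<close>

lemma reduced_walk_unique:
  "reduced_walk adj p \<Longrightarrow> reduced_walk adj q \<Longrightarrow> hd p = hd q \<Longrightarrow> last p = last q \<Longrightarrow> p = q"
proof (induction p arbitrary: q)
  case (Cons y p)
  obtain q' where q: "q = y # q'" using Cons.prems by (cases q) auto
  have closed: "r = [hd r]" if "reduced_walk adj r" "hd r = last r" for r
    using reduced_walk_distinct[OF that(1)] that by (cases r) (auto split: if_splits)
  show ?case
  proof (cases "p = [] \<or> q' = []")
    case True
    then have "hd (y # p) = last (y # p)" "hd q = last q" using Cons.prems q by auto
    then show ?thesis using closed[of "y # p"] closed[of q] Cons.prems by metis
  next
    case False
    then obtain a p' b q'' where pq: "p = a # p'" "q' = b # q''" by (meson neq_Nil_conv)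
    have rp: "reduced_walk adj p" "reduced_walk adj q'"
      using Cons.prems False q by (auto intro: reduced_walk_tl)
    show ?thesis
    proof (cases "a = b")
      case True
      then show ?thesis using Cons.IH[OF rp] Cons.prems(4) pq q by simp
    next
      case neq: False
      have "reduced_walk adj (rev (y # p))" using adj_sym Cons.prems(1) by (rule reduced_walk_rev)
      then have "reduced_walk adj (rev p @ y # q')"
        by (rule_tac reduced_walk_append) (use Cons.prems(2) q neq pq in auto)
      then have d: "distinct (rev p @ y # q')" by (rule reduced_walk_distinct)
      have "last p = last q'" using False Cons.prems(4) q by auto
      then have "last p \<in> set p \<inter> set q'" using False last_in_set[of p] last_in_set[of q'] by simp
      then show ?thesis using d by auto
    qed
  qed
qed simp

text \<open>A new first edge either extends the reduced walk or cancels against its first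
  edge.\<close>

lemma reduced_walk_exists:
  assumes "(x, y) \<in> {(a, b). adj a b}\<^sup>*"
  shows "\<exists>p. reduced_walk adj p \<and> hd p = x \<and> last p = y"
  using assms
proof (induction rule: converse_rtrancl_induct)
  case base
  show ?case by (rule exI[of _ "[y]"]) simp
next
  case (step x z)
  then obtain p where p: "reduced_walk adj p" "hd p = z" "last p = y" by blast
  have ne: "p \<noteq> []" using p(1) by auto
  show ?case
  proof (cases "tl p \<noteq> [] \<and> hd (tl p) = x")
    case True
    then have "reduced_walk adj (tl p)" using p(1) ne by (metis list.collapse reduced_walk_tl)
    then show ?thesis using True p(3) ne by (metis last_tl)
  next
    case False
    then have "reduced_walk adj (x # p)" using p step.hyps(1) by (intro reduced_walk_Cons) auto
    then show ?thesis using p(3) ne by (metis last_ConsR list.sel(1))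
  qed
qed

section \<open>Weighted tree distance and its exponential kernel\<close>

definition geodesic :: "'v \<Rightarrow> 'v \<Rightarrow> 'v list" where
  "geodesic x y = (THE p. reduced_walk adj p \<and> hd p = x \<and> last p = y)"

definition tree_dist :: "'v \<Rightarrow> 'v \<Rightarrow> nat" where
  "tree_dist x y = walk_weight c (geodesic x y)"

lemma geodesic_eq: "reduced_walk adj p \<Longrightarrow> geodesic (hd p) (last p) = p"
  unfolding geodesic_def by (rule the_equality) (auto intro: reduced_walk_unique)

lemma tree_dist_eq: "reduced_walk adj p \<Longrightarrow> tree_dist (hd p) (last p) = walk_weight c p"
  by (simp add: tree_dist_def geodesic_eq)

lemma tree_dist_self: "tree_dist x x = 0"
  using tree_dist_eq[of "[x]"] by simp

text \<open>Gluing a leaf \<open>v\<close> to a finite subtree multiplies its kernel values by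
  \<open>\<rho> ^ c v u\<close>, so a Gram representation extends by one coordinate.\<close>

definition gram_subtree :: "real \<Rightarrow> 'v set \<Rightarrow> bool" where
  "gram_subtree \<rho> W \<longleftrightarrow> finite W \<and>
     (\<forall>x\<in>W. \<forall>y\<in>W. \<exists>p. reduced_walk adj p \<and> hd p = x \<and> last p = y \<and> set p \<subseteq> W) \<and>
     (\<exists>a :: 'v \<Rightarrow> 'v \<Rightarrow> real. \<forall>x\<in>W. \<forall>y\<in>W. \<rho> ^ tree_dist x y = (\<Sum>w\<in>W. a w x * a w y))"

lemma gram_subtree_singleton: "gram_subtree \<rho> {x}"
  unfolding gram_subtree_def
  by (auto simp: tree_dist_self intro!: exI[of _ "[x]"] exI[of _ "\<lambda>_ _. 1"])

lemma gram_subtree_insert: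
  assumes W: "gram_subtree \<rho> W" and u: "u \<in> W" and v: "v \<notin> W" and uv: "adj u v"
    and \<rho>: "0 \<le> \<rho>" "\<rho> \<le> 1"
  shows "gram_subtree \<rho> (insert v W)"
proof -
  have fin: "finite W" using W by (simp add: gram_subtree_def)
  have walk: "\<exists>p. reduced_walk adj p \<and> hd p = x \<and> last p = y \<and> set p \<subseteq> W" if "x \<in> W" "y \<in> W" for x y
    using W that by (simp add: gram_subtree_def)
  obtain a :: "'v \<Rightarrow> 'v \<Rightarrow> real" where a: "\<And>x y. x \<in> W \<Longrightarrow> y \<in> W \<Longrightarrow> \<rho> ^ tree_dist x y = (\<Sum>w\<in>W. a w x * a w y)"
    using W unfolding gram_subtree_def by blast
  have ext: "\<exists>p. reduced_walk adj (v # p) \<and> last (v # p) = y \<and> set p \<subseteq> W \<and> reduced_walk adj p \<and> hd p = u \<and> last p = y"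
    if y: "y \<in> W" for y
  proof -
    obtain p where p: "reduced_walk adj p" "hd p = u" "last p = y" "set p \<subseteq> W" using walk[OF u y] by blast
    have ne: "p \<noteq> []" using p(1) by auto
    have "v \<noteq> hd (tl p)" if "tl p \<noteq> []" using that v p(4) by (metis hd_in_set list.set_sel(2) ne subsetD)
    then have "reduced_walk adj (v # p)" using p adj_sym[OF uv] by (intro reduced_walk_Cons) auto
    then show ?thesis using p ne by auto
  qed
  have dist: "tree_dist v y = c v u + tree_dist u y" "tree_dist y v = c v u + tree_dist u y" if y: "y \<in> W" for y
  proof -
    obtain p where p: "reduced_walk adj (v # p)" "last (v # p) = y" "reduced_walk adj p" "hd p = u" "last p = y"
      using ext[OF y] by blast
    obtain p' where p': "p = u # p'" using p(3,4) by (cases p) auto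
    have w: "walk_weight c (v # p) = c v u + walk_weight c p" using p' by simp
    show "tree_dist v y = c v u + tree_dist u y"
      using tree_dist_eq[OF p(1)] tree_dist_eq[OF p(3)] p w by simp
    have "reduced_walk adj (rev (v # p))" using adj_sym p(1) by (rule reduced_walk_rev)
    moreover have "hd (rev (v # p)) = y" "last (rev (v # p)) = v" unfolding hd_rev by (simp_all add: p(2) del: last.simps)
    ultimately have "tree_dist y v = walk_weight c (rev (v # p))"
      using tree_dist_eq by metis
    also have "\<dots> = walk_weight c (v # p)" using c_sym by (rule walk_weight_rev)
    finally show "tree_dist y v = c v u + tree_dist u y" using tree_dist_eq[OF p(3)] p w by simp
  qed
  have "\<exists>p. reduced_walk adj p \<and> hd p = x \<and> last p = y \<and> set p \<subseteq> insert v W"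
    if xy: "x \<in> insert v W" "y \<in> insert v W" for x y
  proof -
    consider "x \<in> W" "y \<in> W" | "x = v" "y = v" | "x = v" "y \<in> W" | "x \<in> W" "y = v" using xy by blast
    then show ?thesis
    proof cases
      case 1
      then show ?thesis using walk[of x y] by blast
    next
      case 2
      then show ?thesis by (intro exI[of _ "[v]"]) simp
    next
      case 3
      then obtain p where "reduced_walk adj (v # p)" "last (v # p) = y" "set p \<subseteq> W" using ext by blast
      then show ?thesis using 3 by (intro exI[of _ "v # p"]) auto
    next
      case 4
      then obtain p where p: "reduced_walk adj (v # p)" "last (v # p) = x" "set p \<subseteq> W" using ext by blast
      have "reduced_walk adj (rev (v # p))" using adj_sym p(1) by (rule reduced_walk_rev)
      then show ?thesis using 4 p by (intro exI[of _ "rev (v # p)"]) (auto simp: hd_rev)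
    qed
  qed
  moreover have "\<exists>a :: 'v \<Rightarrow> 'v \<Rightarrow> real. \<forall>x\<in>insert v W. \<forall>y\<in>insert v W.
      \<rho> ^ tree_dist x y = (\<Sum>w\<in>insert v W. a w x * a w y)"
  proof -
    define s where "s = \<rho> ^ c v u"
    have s: "0 \<le> s" "s \<le> 1" using \<rho> by (auto simp: s_def power_le_one)
    \<comment> \<open>The new vector is \<open>s\<close> times the vector of \<open>u\<close> plus
      \<open>sqrt (1 - s * s)\<close> times the new coordinate: again a unit vector, with all inner
      products against the old ones scaled by \<open>s\<close>.\<close>
    define b where "b = (\<lambda>w x. if w = v then (if x = v then sqrt (1 - s * s) else 0)
        else if x = v then s * a w u else a w x)"
    have sum: "(\<Sum>w\<in>insert v W. b w x * b w y) = b v x * b v y + (\<Sum>w\<in>W. b w x * b w y)" for x y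
      using fin v by simp
    have sumW: "(\<Sum>w\<in>W. b w x * b w y) = (\<Sum>w\<in>W. (if x = v then s * a w u else a w x) * (if y = v then s * a w u else a w y))" for x y
      using v by (intro sum.cong) (auto simp: b_def)
    have "s * s \<le> 1" using s by (simp add: mult_le_one)
    then have sq: "b v v * b v v = 1 - s * s" by (simp add: b_def)
    have uu: "(\<Sum>w\<in>W. a w u * a w u) = 1" using a[OF u u] by (simp add: tree_dist_self)
    have "\<rho> ^ tree_dist x y = (\<Sum>w\<in>insert v W. b w x * b w y)"
      if xy: "x \<in> insert v W" "y \<in> insert v W" for x y
    proof -
      consider "x \<in> W" "y \<in> W" | "x = v" "y = v" | "x = v" "y \<in> W" | "x \<in> W" "y = v" using xy by blast
      then show ?thesis
      proof cases
        case 1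
        then have "x \<noteq> v" "y \<noteq> v" using v by auto
        then show ?thesis using 1 by (simp add: sum sumW a) (simp add: b_def)
      next
        case 2
        have "(\<Sum>w\<in>W. (s * a w u) * (s * a w u)) = s * s * (\<Sum>w\<in>W. a w u * a w u)"
          by (simp add: sum_distrib_left mult_ac)
        then show ?thesis using 2 by (simp add: sum sumW sq uu tree_dist_self)
      next
        case 3
        then have "y \<noteq> v" using v by auto
        then have "(\<Sum>w\<in>insert v W. b w x * b w y) = s * (\<Sum>w\<in>W. a w u * a w y)"
          using 3 by (simp add: sum sumW sum_distrib_left mult_ac) (simp add: b_def)
        then show ?thesis using 3 dist(1)[of y] a[OF u, of y] by (simp add: s_def power_add)
      next
        case 4
        then have "x \<noteq> v" using v by auto
        then have "(\<Sum>w\<in>insert v W. b w x * b w y) = s * (\<Sum>w\<in>W. a w u * a w x)"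
          using 4 by (simp add: sum sumW sum_distrib_left mult_ac) (simp add: b_def)
        then show ?thesis using 4 dist(2)[of x] a[OF u, of x] by (simp add: s_def power_add)
      qed
    qed
    then show ?thesis by blast
  qed
  ultimately show ?thesis using fin by (simp add: gram_subtree_def)
qed

text \<open>Vertices are glued on in the order of the walk, so each new one is a leaf at its
  predecessor; vertices already in the subtree change nothing.\<close>

lemma gram_subtree_walk:
  assumes \<rho>: "0 \<le> \<rho>" "\<rho> \<le> 1"
  shows "successively adj p \<Longrightarrow> p \<noteq> [] \<Longrightarrow> gram_subtree \<rho> W \<Longrightarrow> hd p \<in> W \<Longrightarrow>
    \<exists>W'. gram_subtree \<rho> W' \<and> W \<subseteq> W' \<and> set p \<subseteq> W'"
proof (induction p arbitrary: W)
  case (Cons x p)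
  show ?case
  proof (cases p)
    case Nil
    then show ?thesis using Cons.prems by auto
  next
    case (Cons y q)
    then have "adj x y" "successively adj p" using Cons.prems(1) by auto
    then have "gram_subtree \<rho> (insert y W)"
      using gram_subtree_insert[OF Cons.prems(3) _ _ _ \<rho>, of x y] Cons.prems(3,4)
      by (cases "y \<in> W") (auto simp: insert_absorb)
    then obtain W' where "gram_subtree \<rho> W'" "insert y W \<subseteq> W'" "set p \<subseteq> W'"
      using Cons.IH[of "insert y W"] \<open>successively adj p\<close> Cons by auto
    then show ?thesis using Cons.prems(4) by auto
  qed
qed simp

lemma gram_subtree_finite:
  assumes \<rho>: "0 \<le> \<rho>" "\<rho> \<le> 1" and "finite A" "\<And>y. y \<in> A \<Longrightarrow> (x, y) \<in> {(a, b). adj a b}\<^sup>*"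
  shows "\<exists>W. gram_subtree \<rho> W \<and> x \<in> W \<and> A \<subseteq> W"
  using assms(3,4)
proof (induction A)
  case empty
  then show ?case using gram_subtree_singleton by auto
next
  case (insert y A)
  then obtain W where W: "gram_subtree \<rho> W" "x \<in> W" "A \<subseteq> W" by auto
  obtain p where p: "reduced_walk adj p" "hd p = x" "last p = y"
    using reduced_walk_exists[OF insert.prems[of y]] by auto
  have "p \<noteq> []" using p(1) by auto
  then obtain W' where "gram_subtree \<rho> W'" "W \<subseteq> W'" "set p \<subseteq> W'"
    using gram_subtree_walk[OF \<rho> reduced_walk_successively[OF p(1)]] W p by blast
  moreover have "y \<in> set p" using \<open>p \<noteq> []\<close> p(3) by auto
  ultimately show ?case using W by auto
qed

lemma tree_kernel_positive_semidefinite: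
  assumes \<rho>: "0 \<le> \<rho>" "\<rho> \<le> 1" and y: "\<And>i. i < k \<Longrightarrow> (x, y i) \<in> {(a, b). adj a b}\<^sup>*"
  shows "positive_semidefinite_mat k (\<lambda>i j. of_real (\<rho> ^ tree_dist (y i) (y j)))"
  unfolding positive_semidefinite_mat_def
proof
  fix d :: "nat \<Rightarrow> complex"
  obtain W where W: "gram_subtree \<rho> W" "y ` {..<k} \<subseteq> W"
    using gram_subtree_finite[OF \<rho>, of "y ` {..<k}" x] y by auto
  then obtain a :: "'v \<Rightarrow> 'v \<Rightarrow> real" where
    a: "\<And>x y. x \<in> W \<Longrightarrow> y \<in> W \<Longrightarrow> \<rho> ^ tree_dist x y = (\<Sum>w\<in>W. a w x * a w y)"
    unfolding gram_subtree_def by blast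
  have "(\<Sum>i<k. \<Sum>j<k. cnj (d i) * d j * of_real (\<rho> ^ tree_dist (y i) (y j)))
      = (\<Sum>i<k. \<Sum>j<k. \<Sum>w\<in>W. cnj (d i * of_real (a w (y i))) * (d j * of_real (a w (y j))))"
    using W(2) by (intro sum.cong refl) (simp add: a subset_iff sum_distrib_left mult_ac del: of_real_power)
  also have "\<dots> = (\<Sum>w\<in>W. \<Sum>i<k. \<Sum>j<k. cnj (d i * of_real (a w (y i))) * (d j * of_real (a w (y j))))"
    by (subst sum.swap, rule sum.cong[OF refl], subst sum.swap, rule refl)
  also have "\<dots> = (\<Sum>w\<in>W. cnj (\<Sum>i<k. d i * of_real (a w (y i))) * (\<Sum>j<k. d j * of_real (a w (y j))))"
    by (simp add: sum_product)
  also have "\<dots> = of_real (\<Sum>w\<in>W. (cmod (\<Sum>i<k. d i * of_real (a w (y i))))\<^sup>2)"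
    unfolding of_real_sum complex_norm_square by (simp add: mult.commute)
  finally have eq: "(\<Sum>i<k. \<Sum>j<k. cnj (d i) * d j * of_real (\<rho> ^ tree_dist (y i) (y j)))
      = of_real (\<Sum>w\<in>W. (cmod (\<Sum>i<k. d i * of_real (a w (y i))))\<^sup>2)" .
  show "(\<Sum>i<k. \<Sum>j<k. cnj (d i) * d j * of_real (\<rho> ^ tree_dist (y i) (y j))) \<in> \<real>\<^sub>\<ge>\<^sub>0"
    unfolding eq nonneg_Reals_of_real_iff by (intro sum_nonneg) simp
qed

end

section \<open>Treeings yield property (H)\<close>

locale treed_action = countable_borel_action \<Gamma> \<mu> \<phi>
  for \<Gamma> :: "('g, 'b) monoid_scheme" (structure) and \<mu> :: "'x measure" and \<phi> :: "'g \<Rightarrow> 'x \<Rightarrow> 'x" +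
  fixes U :: "'x set" and Q :: "('x \<times> 'x) set"
  assumes U: "U \<in> sets \<mu>" "emeasure \<mu> (space \<mu> - U) = 0"
    and Q: "treeing (reduction R U) Q"
begin

definition adj where "adj x y \<longleftrightarrow> (x, y) \<in> Q"

text \<open>The first group element carrying one endpoint to the other. Admitting either direction
  makes the index symmetric, and at a given vertex at most two edges share an index.\<close>

definition edge_index :: "'x \<Rightarrow> 'x \<Rightarrow> nat" where
  "edge_index x y = (LEAST i. y = \<phi> (enum i) x \<or> x = \<phi> (enum i) y)"

text \<open>With \<open>Suc\<close> every edge weighs at least 1, so the weight of a walk also
  bounds its number of edges.\<close>

definition edge_weight where "edge_weight x y = Suc (edge_index x y)"

lemma U_subset: "U \<subseteq> space \<mu>" using sets.sets_into_space[OF U(1)] .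

lemma units_reduction: "units (reduction R U) = U"
  using U_subset by (auto simp: reduction_def)

lemma arrows_reduction: "arrows (reduction R U) = restrict_space (arrows R) {\<gamma>. fst \<gamma> \<in> U \<and> snd \<gamma> \<in> U}"
  by (simp add: reduction_def)

lemma space_reduction: "space (arrows (reduction R U)) = {(x, y). x \<in> U \<and> y \<in> U \<and> y \<in> orbit_of x}"
  using U_subset unfolding arrows_reduction space_restrict_space space_arrows_R by auto

lemma Q_sets: "Q \<in> sets (arrows R)"
proof -
  have "{\<gamma>. fst \<gamma> \<in> U \<and> snd \<gamma> \<in> U} \<inter> space (arrows R) = (U \<times> U) \<inter> {(x, y). x \<in> space \<mu> \<and> y \<in> orbit_of x}"
    by (auto simp: space_arrows_R)
  also have "\<dots> \<in> sets (arrows R)"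
  proof -
    have "(U \<times> U) \<inter> {(x, y). x \<in> space \<mu> \<and> y \<in> orbit_of x} \<in> sets (\<mu> \<Otimes>\<^sub>M \<mu>)"
      by (intro sets.Int pair_measureI U(1) orbit_pairs_sets)
    moreover have "{(x, y). x \<in> space \<mu> \<and> y \<in> orbit_of x} \<inter> space (\<mu> \<Otimes>\<^sub>M \<mu>) \<in> sets (\<mu> \<Otimes>\<^sub>M \<mu>)"
      by (intro sets.Int sets.top orbit_pairs_sets)
    ultimately show ?thesis unfolding arrows_R by (simp only: sets_restrict_space_iff Int_lower2 simp_thms)
  qed
  finally have "{\<gamma>. fst \<gamma> \<in> U \<and> snd \<gamma> \<in> U} \<inter> space (arrows R) \<in> sets (arrows R)" .
  moreover have "Q \<in> sets (restrict_space (arrows R) {\<gamma>. fst \<gamma> \<in> U \<and> snd \<gamma> \<in> U})"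
    using Q unfolding treeing_def arrows_reduction by blast
  ultimately show ?thesis by (simp add: sets_restrict_space_iff)
qed

lemma Q_subset: "adj x y \<Longrightarrow> x \<in> U \<and> y \<in> U \<and> y \<in> orbit_of x"
proof -
  assume "adj x y"
  moreover have "Q \<subseteq> space (arrows (reduction R U))"
    by (rule sets.sets_into_space) (use Q in \<open>simp add: treeing_def\<close>)
  ultimately show ?thesis unfolding adj_def space_reduction by auto
qed

lemma fibre: "x \<in> U \<Longrightarrow> rng_fibre (reduction R U) x = Pair x ` (orbit_of x \<inter> U)"
  unfolding rng_fibre_def space_reduction by (auto simp: reduction_def)

lemma tree: "x \<in> U \<Longrightarrow> tree_graph (Pair x ` (orbit_of x \<inter> U)) (\<lambda>\<gamma>1 \<gamma>2. adj (snd \<gamma>1) (snd \<gamma>2))"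
proof -
  assume x: "x \<in> U"
  have "tree_graph (rng_fibre (reduction R U) x)
      (\<lambda>\<gamma>1 \<gamma>2. comp (reduction R U) (arr_inv (reduction R U) \<gamma>1) \<gamma>2 \<in> Q)"
    using Q x unfolding treeing_def units_reduction by blast
  moreover have "comp (reduction R U) (arr_inv (reduction R U) \<gamma>1) \<gamma>2 = (snd \<gamma>1, snd \<gamma>2)" for \<gamma>1 \<gamma>2
    by (cases \<gamma>1) (simp add: reduction_def)
  ultimately show ?thesis unfolding fibre[OF x] adj_def by simp
qed

lemma walk_in_orbit:
  assumes x: "x \<in> U"
  shows "successively adj q \<Longrightarrow> q \<noteq> [] \<Longrightarrow> hd q \<in> orbit_of x \<inter> U \<Longrightarrow> set q \<subseteq> orbit_of x \<inter> U"
proof (induction q)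
  case (Cons a q)
  show ?case
  proof (cases q)
    case Nil
    then show ?thesis using Cons.prems by simp
  next
    case (Cons b q')
    then have ab: "adj a b" "successively adj q" using Cons.prems(1) by auto
    obtain g where g: "g \<in> carrier \<Gamma>" "a = \<phi> g x" using Cons.prems(3) by auto
    have "b \<in> orbit_of a" "b \<in> U" using Q_subset[OF ab(1)] by auto
    moreover have "x \<in> space \<mu>" using x U_subset by blast
    ultimately have "b \<in> orbit_of x" using orbit_of_translate[OF g(1), of x] unfolding g(2) by blast
    then show ?thesis using Cons.IH ab(2) \<open>b \<in> U\<close> Cons.prems(3) Cons by auto
  qed
qed simp

text \<open>The tree condition concerns single range fibres, where adjacency is just membership of
  the pair of sources in \<open>Q\<close>. A loop or cycle on the space stays in one orbit and lifts
  to the fibre over its first vertex.\<close>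

sublocale forest adj edge_weight
proof
  fix x y assume "adj x y"
  moreover have "arr_inv (reduction R U) ` Q = Q" using Q by (simp add: treeing_def)
  then have "prod.swap ` Q = Q" by (simp add: reduction_def)
  ultimately show "adj y x" unfolding adj_def by (metis image_eqI swap_simp)
next
  fix x show "\<not> adj x x"
  proof
    assume a: "adj x x"
    then have x: "x \<in> U" using Q_subset by blast
    then have "(x, x) \<in> Pair x ` (orbit_of x \<inter> U)" using mem_orbit_of U_subset by blast
    moreover have "\<forall>u\<in>Pair x ` (orbit_of x \<inter> U). \<not> adj (snd u) (snd u)"
      using tree[OF x] unfolding tree_graph_def by blast
    ultimately show False using a by force
  qed
next
  fix p :: "'x list"
  show "\<not> (3 \<le> length p \<and> distinct p \<and> successively adj p \<and> adj (last p) (hd p))"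
  proof
    assume p: "3 \<le> length p \<and> distinct p \<and> successively adj p \<and> adj (last p) (hd p)"
    define x where "x = hd p"
    have x: "x \<in> U" using p Q_subset by (auto simp: x_def)
    have "hd p \<in> orbit_of x \<inter> U" using mem_orbit_of x U_subset by (auto simp: x_def)
    moreover have "p \<noteq> []" using p by auto
    ultimately have sp: "set p \<subseteq> orbit_of x \<inter> U" using p by (intro walk_in_orbit[OF x]) auto
    define q where "q = map (Pair x) p"
    have "set q \<subseteq> Pair x ` (orbit_of x \<inter> U)" "3 \<le> length q" "distinct q"
      "successively (\<lambda>\<gamma>1 \<gamma>2. adj (snd \<gamma>1) (snd \<gamma>2)) q" "adj (snd (last q)) (snd (hd q))"
      using p sp \<open>p \<noteq> []\<close> by (auto simp: q_def distinct_map inj_on_def successively_map last_map hd_map)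
    then show False using tree[OF x] unfolding tree_graph_def by blast
  qed
next
  fix x y show "edge_weight x y = edge_weight y x"
    by (simp add: edge_weight_def edge_index_def disj_commute)
qed

lemma connected:
  assumes x: "x \<in> U" and y: "y \<in> orbit_of x" "y \<in> U"
  shows "(x, y) \<in> {(a, b). adj a b}\<^sup>*"
proof -
  let ?V = "Pair x ` (orbit_of x \<inter> U)"
  have "(x, x) \<in> ?V" "(x, y) \<in> ?V" using x y mem_orbit_of U_subset by blast+
  then have "((x, x), (x, y)) \<in> {(a, b). a \<in> ?V \<and> b \<in> ?V \<and> adj (snd a) (snd b)}\<^sup>*"
    using tree[OF x] unfolding tree_graph_def by blast
  then have "(snd (x, x), snd (x, y)) \<in> {(a, b). adj a b}\<^sup>*"
    by (induction rule: rtrancl_induct) (auto intro: rtrancl_into_rtrancl)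
  then show ?thesis by simp
qed

section \<open>Reaching points of bounded tree distance by words in the group\<close>

definition letters where "letters r = enum ` {..<r} \<union> (\<lambda>i. inv (enum i)) ` {..<r}"

primrec words :: "nat \<Rightarrow> nat \<Rightarrow> 'g set" where
  "words r 0 = {\<one>}"
| "words r (Suc n) = words r n \<union> (\<lambda>(a, b). a \<otimes> b) ` (words r n \<times> letters r)"

lemma words_finite: "finite (words r n)"
  by (induction n) (simp_all add: letters_def)

lemma words_carrier: "words r n \<subseteq> carrier \<Gamma>"
  by (induction n) (auto simp: letters_def)

lemma one_in_words: "\<one> \<in> words r n"
  by (induction n) simp_all

lemma edge_step:
  assumes "adj x y" "edge_weight x y \<le> r"
  shows "\<exists>g \<in> letters r. y = \<phi> g x"
proof -
  have xy: "x \<in> space \<mu>" "y \<in> space \<mu>" "y \<in> orbit_of x" using Q_subset[OF assms(1)] U_subset by auto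
  then obtain g where "g \<in> carrier \<Gamma>" "y = \<phi> g x" by auto
  then have "\<exists>i. y = \<phi> (enum i) x \<or> x = \<phi> (enum i) y" using range_enum by (metis imageE)
  then have "y = \<phi> (enum (edge_index x y)) x \<or> x = \<phi> (enum (edge_index x y)) y"
    unfolding edge_index_def by (rule LeastI_ex)
  moreover have "edge_index x y < r" using assms(2) by (simp add: edge_weight_def)
  moreover have "y = \<phi> (inv (enum i)) x" if "x = \<phi> (enum i) y" for i
    using that act_inv(1)[OF enum_in xy(2), of i] by simp
  ultimately show ?thesis unfolding letters_def by blast
qed

text \<open>Weight at most \<open>n\<close> allows at most \<open>n\<close> edges, and
  \<open>n \<le> r\<close> makes the index of each of them less than \<open>r\<close>; so every edge
  is traversed by a letter from a fixed finite set that does not depend on the starting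
  point.\<close>

lemma walk_words:
  assumes "reduced_walk adj p" "hd p \<in> space \<mu>" "walk_weight edge_weight p \<le> n" "n \<le> r"
  shows "\<exists>g\<in>words r n. last p = \<phi> g (hd p)"
  using assms
proof (induction p arbitrary: n)
  case (Cons x p)
  show ?case
  proof (cases p)
    case Nil
    then show ?thesis using one_in_words Cons.prems(2) by (force simp: act_one)
  next
    case (Cons y q)
    have a: "adj x y" using Cons.prems(1) Cons by (auto dest: reduced_walk_adj)
    have w: "edge_weight x y + walk_weight edge_weight p \<le> n" using Cons.prems(3) Cons by simp
    then obtain m where n: "n = Suc m" by (cases n) (auto simp: edge_weight_def)
    have wp: "walk_weight edge_weight p \<le> m" using w n by (simp add: edge_weight_def)
    have y: "y \<in> space \<mu>" using Q_subset[OF a] U_subset by auto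
    have rp: "reduced_walk adj p" using Cons.prems(1) by (rule reduced_walk_tl) (simp add: Cons)
    obtain g where g: "g \<in> words r m" "last p = \<phi> g y"
      using Cons.IH[OF rp _ wp] y Cons Cons.prems(4) n by auto
    obtain h where h: "h \<in> letters r" "y = \<phi> h x"
      using edge_step[OF a, of r] w Cons.prems(4) by auto
    have "h \<in> carrier \<Gamma>" using h(1) by (auto simp: letters_def)
    moreover have "g \<in> carrier \<Gamma>" using g(1) words_carrier by blast
    ultimately have "last (x # p) = \<phi> (g \<otimes> h) x"
      using g(2) h(2) Cons.prems(2) Cons by (simp add: act_mult)
    moreover have "g \<otimes> h \<in> words r n" unfolding n words.simps using g(1) h(1) by blast
    ultimately show ?thesis by auto
  qed
qed simp

text \<open>The points whose whole orbit lies in \<open>U\<close>. The treeing connects only the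
  part of an orbit inside \<open>U\<close>, so the tree distance is meaningful for all arrows only
  over this invariant conull set.\<close>

definition core where "core = {x \<in> space \<mu>. \<forall>g\<in>carrier \<Gamma>. \<phi> g x \<in> U}"

lemma core_sets: "core \<in> sets \<mu>"
  unfolding core_def
proof (rule sets.sets_Collect_countable_All'[OF _ countable_group])
  fix g assume "g \<in> carrier \<Gamma>"
  from measurable_sets[OF action_measurable[OF this] U(1)]
  show "{x \<in> space \<mu>. \<phi> g x \<in> U} \<in> sets \<mu>" by (simp add: vimage_def Int_def conj_commute)
qed

lemma AE_core: "AE x in \<mu>. x \<in> core"
proof -
  have "space \<mu> - U \<in> null_sets \<mu>" using U by (intro null_setsI) auto
  then have "AE x in \<mu>. x \<notin> space \<mu> - U" by (rule AE_not_in)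
  then have "AE x in \<mu>. x \<in> U" using AE_space by eventually_elim auto
  then have "AE x in \<mu>. \<phi> g x \<in> U" if "g \<in> carrier \<Gamma>" for g by (rule AE_act[OF that])
  then have "AE x in \<mu>. \<forall>g\<in>carrier \<Gamma>. \<phi> g x \<in> U" by (simp add: AE_ball_countable[OF countable_group])
  then show ?thesis using AE_space by eventually_elim (simp add: core_def)
qed

lemma core_orbit:
  assumes "x \<in> core"
  shows "x \<in> space \<mu>" "x \<in> U" "y \<in> orbit_of x \<Longrightarrow> y \<in> core"
proof -
  show x: "x \<in> space \<mu>" using assms by (simp add: core_def)
  have "\<phi> \<one> x \<in> U" using assms \<Gamma>.one_closed unfolding core_def by blast
  then show "x \<in> U" using act_one[OF x] by simp
  assume "y \<in> orbit_of x"
  then obtain h where "h \<in> carrier \<Gamma>" "y = \<phi> h x" by auto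
  then show "y \<in> core" using assms x by (auto simp: core_def act_closed simp flip: act_mult)
qed

lemma core_connected: "x \<in> core \<Longrightarrow> y \<in> orbit_of x \<Longrightarrow> (x, y) \<in> {(a, b). adj a b}\<^sup>*"
  using core_orbit by (intro connected) blast+

section \<open>Measurability of the tree distance\<close>

lemma sets_adj:
  assumes "g \<in> carrier \<Gamma>" "h \<in> carrier \<Gamma>"
  shows "{x \<in> space \<mu>. adj (\<phi> g x) (\<phi> h x)} \<in> sets \<mu>"
  using measurable_sets[OF measurable_translate_pair[OF assms] Q_sets]
  by (simp add: adj_def vimage_def Int_def conj_commute)

lemma sets_reduced_walk:
  "set hs \<subseteq> carrier \<Gamma> \<Longrightarrow> {x \<in> space \<mu>. reduced_walk adj (map (translates x) hs)} \<in> sets \<mu>"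
proof (induction hs rule: induct_list012)
  case (3 g h hs)
  have a: "{x \<in> space \<mu>. adj (\<phi> g x) (\<phi> h x)} \<in> sets \<mu>" using 3 by (intro sets_adj) auto
  show ?case
  proof (cases hs)
    case Nil
    then show ?thesis using a by simp
  next
    case (Cons k ks)
    have "{x \<in> space \<mu>. \<phi> g x = \<phi> k x} \<in> sets \<mu>"
      using 3 Cons by (intro sets_pair_eq action_measurable) auto
    then have "{x \<in> space \<mu>. \<phi> g x \<noteq> \<phi> k x} \<in> sets \<mu>" by (rule sets.sets_Collect_neg)
    moreover have "{x \<in> space \<mu>. reduced_walk adj (map (translates x) (h # hs))} \<in> sets \<mu>" using 3 by simp
    ultimately have "{x \<in> space \<mu>. adj (\<phi> g x) (\<phi> h x) \<and> \<phi> g x \<noteq> \<phi> k x \<and>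
        reduced_walk adj (map (translates x) (h # hs))} \<in> sets \<mu>"
      using a by (intro sets.sets_Collect_conj)
    then show ?thesis using Cons by simp
  qed
qed simp_all

lemma measurable_edge_weight:
  assumes "g \<in> carrier \<Gamma>" "h \<in> carrier \<Gamma>"
  shows "(\<lambda>x. edge_weight (\<phi> g x) (\<phi> h x)) \<in> \<mu> \<rightarrow>\<^sub>M count_space UNIV"
proof -
  have "Measurable.pred \<mu> (\<lambda>x. \<phi> h x = \<phi> (enum i) (\<phi> g x) \<or> \<phi> g x = \<phi> (enum i) (\<phi> h x))" for i
    unfolding pred_def using assms
    by (intro sets.sets_Collect_disj sets_pair_eq measurable_compose[OF action_measurable action_measurable]
      action_measurable) auto
  then have "(\<lambda>x. edge_index (\<phi> g x) (\<phi> h x)) \<in> \<mu> \<rightarrow>\<^sub>M count_space UNIV"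
    unfolding edge_index_def by (rule measurable_Least)
  then show ?thesis unfolding edge_weight_def by (rule measurable_compose) simp
qed

lemma measurable_walk_weight:
  "set hs \<subseteq> carrier \<Gamma> \<Longrightarrow> (\<lambda>x. walk_weight edge_weight (map (translates x) hs)) \<in> \<mu> \<rightarrow>\<^sub>M count_space UNIV"
proof (induction hs rule: induct_list012)
  case (3 g h hs)
  have "(\<lambda>x. edge_weight (\<phi> g x) (\<phi> h x)) \<in> \<mu> \<rightarrow>\<^sub>M count_space UNIV"
    using 3 by (intro measurable_edge_weight) auto
  moreover have "(\<lambda>x. walk_weight edge_weight (map (translates x) (h # hs))) \<in> \<mu> \<rightarrow>\<^sub>M count_space UNIV"
    using 3 by simp
  ultimately have "(\<lambda>x. edge_weight (\<phi> g x) (\<phi> h x) + walk_weight edge_weight (map (translates x) (h # hs))) \<in> \<mu> \<rightarrow>\<^sub>M count_space UNIV"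
    by measurable
  then show ?case by simp
qed simp_all

lemma measurable_fst_R: "fst \<in> arrows R \<rightarrow>\<^sub>M \<mu>" and measurable_snd_R: "snd \<in> arrows R \<rightarrow>\<^sub>M \<mu>"
  unfolding arrows_R by (intro measurable_restrict_space1 measurable_fst measurable_snd)+

text \<open>A geodesic from \<open>x\<close> is traced by a list of group elements applied to
  \<open>x\<close>. There are countably many such lists, and for each of them being reduced, having
  weight \<open>k\<close> and having the right endpoints are measurable conditions.\<close>

lemma sets_tree_dist:
  "{\<gamma> \<in> space (arrows R). fst \<gamma> \<in> core \<and> tree_dist (fst \<gamma>) (snd \<gamma>) = k} \<in> sets (arrows R)"
proof -
  define A where "A = (\<lambda>hs. {x \<in> space \<mu>. x \<in> core \<and> reduced_walk adj (map (translates x) hs) \<and>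
    walk_weight edge_weight (map (translates x) hs) = k})"
  define L where "L = lists (carrier \<Gamma>) - {[]}"
  have L: "set hs \<subseteq> carrier \<Gamma>" "hd hs \<in> carrier \<Gamma>" "last hs \<in> carrier \<Gamma>" if "hs \<in> L" for hs
    using that by (auto simp: L_def lists_eq_set)
  have A: "A hs \<in> sets \<mu>" if "hs \<in> L" for hs
    unfolding A_def
  proof (intro sets.sets_Collect_conj sets_reduced_walk L(1)[OF that])
    show "{x \<in> space \<mu>. x \<in> core} \<in> sets \<mu>" using core_sets by measurable
    show "{x \<in> space \<mu>. walk_weight edge_weight (map (translates x) hs) = k} \<in> sets \<mu>"
      using measurable_walk_weight[OF L(1)[OF that]] by measurable
  qed
  let ?B = "\<lambda>hs. {\<gamma> \<in> space (arrows R). fst \<gamma> \<in> A hs \<and> \<phi> (hd hs) (fst \<gamma>) = fst \<gamma> \<and> \<phi> (last hs) (fst \<gamma>) = snd \<gamma>}"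
  have "{\<gamma> \<in> space (arrows R). fst \<gamma> \<in> core \<and> tree_dist (fst \<gamma>) (snd \<gamma>) = k} =
    (\<Union>hs\<in>L. ?B hs)"
    (is "?l = ?r")
  proof
    show "?l \<subseteq> ?r"
    proof
      fix \<gamma> assume \<gamma>: "\<gamma> \<in> ?l"
      obtain x y where xy: "\<gamma> = (x, y)" by (cases \<gamma>)
      have x: "x \<in> core" "y \<in> orbit_of x" "tree_dist x y = k" using \<gamma> by (auto simp: xy space_arrows_R)
      obtain p where p: "reduced_walk adj p" "hd p = x" "last p = y"
        using reduced_walk_exists[OF core_connected[OF x(1,2)]] by blast
      have ne: "p \<noteq> []" using p(1) by auto
      have "set p \<subseteq> orbit_of x \<inter> U"
        using core_orbit[OF x(1)] mem_orbit_of p(2)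
        by (intro walk_in_orbit reduced_walk_successively[OF p(1)] ne) auto
      then have "p \<in> map (translates x) ` lists (carrier \<Gamma>)" by (auto simp: lists_image[symmetric])
      then obtain hs where hs: "set hs \<subseteq> carrier \<Gamma>" "p = map (translates x) hs" by (auto simp: lists_eq_set)
      have "hs \<noteq> []" using hs ne by auto
      then have "hs \<in> L" "\<phi> (hd hs) x = x" "\<phi> (last hs) x = y"
        using hs p by (auto simp: L_def lists_eq_set hd_map last_map)
      moreover have "x \<in> A hs"
        using x p hs(2) core_orbit(1)[OF x(1)] tree_dist_eq[OF p(1)] by (simp add: A_def)
      ultimately show "\<gamma> \<in> ?r" using \<gamma> by (auto simp: xy)
    qed
    show "?r \<subseteq> ?l"
    proof
      fix \<gamma> assume "\<gamma> \<in> ?r"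
      then obtain hs where hs: "hs \<in> L" "\<gamma> \<in> space (arrows R)" "fst \<gamma> \<in> A hs"
        "\<phi> (hd hs) (fst \<gamma>) = fst \<gamma>" "\<phi> (last hs) (fst \<gamma>) = snd \<gamma>" by blast
      have "tree_dist (fst \<gamma>) (snd \<gamma>) = k"
        using tree_dist_eq[of "map (\<lambda>h. \<phi> h (fst \<gamma>)) hs"] hs by (simp add: A_def L_def hd_map last_map)
      then show "\<gamma> \<in> ?l" using hs by (simp add: A_def)
    qed
  qed
  also have "\<dots> \<in> sets (arrows R)"
  proof (rule sets.countable_UN')
    show "countable L" unfolding L_def using countable_group by (intro countable_Diff countable_lists)
  next
    have "?B hs \<in> sets (arrows R)"
      if hs: "hs \<in> L" for hs
    proof (intro sets.sets_Collect_conj sets_pair_eq measurable_fst_R measurable_snd_R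
        measurable_compose[OF measurable_fst_R action_measurable] L hs)
      show "{\<gamma> \<in> space (arrows R). fst \<gamma> \<in> A hs} \<in> sets (arrows R)"
        using measurable_sets[OF measurable_fst_R A[OF hs]] by (simp add: vimage_def Int_def conj_commute)
    qed
    then show "?B ` L \<subseteq> sets (arrows R)"
      by blast
  qed
  finally show ?thesis .
qed

section \<open>The tree kernels that witness property (H)\<close>

definition rate :: "nat \<Rightarrow> real" where "rate n = exp (- 1 / (real n + 1))"

lemma rate_bounds: "0 < rate n" "rate n < 1"
  by (simp_all add: rate_def)

text \<open>Over the null complement of \<open>core\<close> the indicator of the diagonal keeps the
  value 1 on all units and adds at most one arrow per source to a level set.\<close>

definition tree_kernel :: "nat \<Rightarrow> 'x \<times> 'x \<Rightarrow> complex" where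
  "tree_kernel n \<gamma> = (if fst \<gamma> \<in> core then of_real (rate n ^ tree_dist (fst \<gamma>) (snd \<gamma>))
     else of_bool (fst \<gamma> = snd \<gamma>))"

lemma measurable_tree_kernel: "tree_kernel n \<in> borel_measurable (arrows R)"
proof -
  have c: "{\<gamma> \<in> space (arrows R). fst \<gamma> \<in> core} \<in> sets (arrows R)"
    using measurable_sets[OF measurable_fst_R core_sets] by (simp add: vimage_def Int_def conj_commute)
  have e: "{\<gamma> \<in> space (arrows R). fst \<gamma> = snd \<gamma>} \<in> sets (arrows R)"
    by (rule sets_pair_eq[OF measurable_fst_R measurable_snd_R])
  \<comment> \<open>A code in the natural numbers that determines the kernel together with
    membership in \<open>core\<close>, so measurability can be checked on its countably many
    values.\<close>
  define d where "d = (\<lambda>\<gamma>. if fst \<gamma> \<in> core then Suc (tree_dist (fst \<gamma>) (snd \<gamma>)) else of_bool (fst \<gamma> \<noteq> snd \<gamma>))"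
  have "d -` {k} \<inter> space (arrows R) \<in> sets (arrows R)" for k
  proof -
    have "d -` {k} \<inter> space (arrows R) =
      (if k = 0 then {} else {\<gamma> \<in> space (arrows R). fst \<gamma> \<in> core \<and> tree_dist (fst \<gamma>) (snd \<gamma>) = k - 1})
      \<union> {\<gamma> \<in> space (arrows R). \<not> fst \<gamma> \<in> core \<and> (if k = 0 then fst \<gamma> = snd \<gamma> else k = 1 \<and> \<not> fst \<gamma> = snd \<gamma>)}"
      by (auto simp: d_def split: if_splits)
    also have "\<dots> \<in> sets (arrows R)"
      using sets_tree_dist c e
      by (cases "k = 0"; cases "k = 1") (simp_all add: sets.sets_Collect_conj sets.sets_Collect_neg sets.Un)
    finally show ?thesis .
  qed
  then have d: "d \<in> arrows R \<rightarrow>\<^sub>M count_space UNIV"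
    by (simp add: measurable_count_space_eq2_countable)
  let ?f = "\<lambda>\<gamma>. if fst \<gamma> \<in> core then complex_of_real (rate n ^ (d \<gamma> - 1)) else (if d \<gamma> = 0 then 1 else 0)"
  have "?f
      \<in> borel_measurable (arrows R)"
  proof (rule measurable_If)
    show "(\<lambda>\<gamma>. complex_of_real (rate n ^ (d \<gamma> - 1))) \<in> borel_measurable (arrows R)"
      by (rule measurable_compose[OF d]) simp
    show "(\<lambda>\<gamma>. if d \<gamma> = 0 then 1 else 0 :: complex) \<in> borel_measurable (arrows R)"
      by (rule measurable_compose[OF d, of "\<lambda>k. if k = 0 then 1 else 0"]) simp
  qed (rule c)
  moreover have "?f
      = tree_kernel n"
    by (auto simp: tree_kernel_def d_def fun_eq_iff)
  ultimately show ?thesis by simp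
qed

lemma tree_kernel_pos_def: "positive_definite_fun R \<mu> (tree_kernel n)"
  unfolding positive_definite_fun_def
proof (intro conjI measurable_tree_kernel bexI[of _ "space \<mu> - core"] ballI allI impI)
  have "AE x in \<mu>. x \<notin> space \<mu> - core" using AE_core by eventually_elim simp
  then show "space \<mu> - core \<in> null_sets \<mu>"
    using AE_iff_null_sets[OF sets.Diff[OF sets.top core_sets]] by simp
next
  fix x k and \<gamma> :: "nat \<Rightarrow> 'x \<times> 'x"
  assume "x \<in> units R - (space \<mu> - core)" and \<gamma>: "\<forall>i<k. \<gamma> i \<in> rng_fibre R x"
  then have x: "x \<in> core" by auto
  define y where "y = (\<lambda>i. snd (\<gamma> i))"
  have y: "y i \<in> orbit_of x" "y i \<in> core" if "i < k" for i
    using \<gamma> that core_orbit(3)[OF x] by (auto simp: y_def rng_fibre_def space_arrows_R)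
  have "positive_semidefinite_mat k (\<lambda>i j. of_real (rate n ^ tree_dist (y i) (y j)))"
    using core_connected[OF x y(1)] rate_bounds[of n] by (intro tree_kernel_positive_semidefinite) auto
  moreover have "tree_kernel n (comp R (arr_inv R (\<gamma> i)) (\<gamma> j)) = of_real (rate n ^ tree_dist (y i) (y j))"
    if "i < k" for i j
    using y(2)[OF that] by (cases "\<gamma> i") (simp add: tree_kernel_def y_def)
  ultimately show "positive_semidefinite_mat k (\<lambda>i j. tree_kernel n (comp R (arr_inv R (\<gamma> i)) (\<gamma> j)))"
    unfolding positive_semidefinite_mat_def by simp
qed

text \<open>A value above \<open>\<epsilon>\<close> bounds the tree distance, so the range of the
  arrow is the image of its source under one of finitely many words. The size of the level set in a
  source fibre is thus bounded uniformly.\<close>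

lemma tree_kernel_level_finite:
  assumes "0 < \<epsilon>"
  shows "groupoid_measure R \<mu> {\<gamma> \<in> space (arrows R). cmod (tree_kernel n \<gamma>) > \<epsilon>} < \<infinity>"
proof -
  define \<rho> where "\<rho> = rate n"
  have \<rho>: "0 < \<rho>" "\<rho> < 1" by (simp_all add: \<rho>_def rate_bounds)
  \<comment> \<open>\<open>r\<close> later bounds both the length of the words and the number of
    group elements used as letters.\<close>
  obtain r where r: "\<rho> ^ r < \<epsilon>" using real_arch_pow_inv[OF assms \<rho>(2)] by blast
  define E where "E = {\<gamma> \<in> space (arrows R). cmod (tree_kernel n \<gamma>) > \<epsilon>}"
  have fibre_E: "E \<inter> src_fibre R x \<subseteq> (\<lambda>g. (\<phi> g x, x)) ` words r r" if x: "x \<in> space \<mu>" for x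
  proof
    fix \<gamma> assume "\<gamma> \<in> E \<inter> src_fibre R x"
    then obtain y where \<gamma>: "\<gamma> = (y, x)" "(y, x) \<in> space (arrows R)" "cmod (tree_kernel n (y, x)) > \<epsilon>"
      by (cases \<gamma>) (auto simp: E_def src_fibre_def)
    have xy: "y \<in> space \<mu>" "x \<in> orbit_of y" using \<gamma>(2) by (auto simp: space_arrows_R)
    show "\<gamma> \<in> (\<lambda>g. (\<phi> g x, x)) ` words r r"
    proof (cases "y \<in> core")
      case False
      then have "y = x" using \<gamma>(3) assms by (cases "y = x") (auto simp: tree_kernel_def)
      then show ?thesis using \<gamma>(1) one_in_words act_one[OF x] by force
    next
      case True
      obtain p where p: "reduced_walk adj p" "hd p = y" "last p = x"
        using reduced_walk_exists[OF core_connected[OF True xy(2)]] by blast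
      have "p \<noteq> []" using p(1) by auto
      have "\<rho> ^ tree_dist y x > \<epsilon>"
        using \<gamma>(3) True \<rho>(1) by (simp add: tree_kernel_def \<rho>_def norm_power)
      moreover have "\<rho> ^ tree_dist y x \<le> \<rho> ^ r" if "r \<le> tree_dist y x"
        using that \<rho> by (intro power_decreasing) auto
      ultimately have "tree_dist y x \<le> r" using r by linarith
      \<comment> \<open>The walk is reversed because the measure sums over arrows with fixed source
        \<open>x\<close>, so the words must start at \<open>x\<close>.\<close>
      then have "walk_weight edge_weight (rev p) \<le> r"
        using tree_dist_eq[OF p(1)] p c_sym by (simp add: walk_weight_rev)
      moreover have "reduced_walk adj (rev p)" using adj_sym p(1) by (rule reduced_walk_rev)
      moreover have "hd (rev p) = x" "last (rev p) = y" using p(2,3) \<open>p \<noteq> []\<close> by (simp_all add: hd_rev last_rev)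
      ultimately have "\<exists>g\<in>words r r. y = \<phi> g x" using walk_words[of "rev p" r r] x by simp
      then show ?thesis using \<gamma>(1) by blast
    qed
  qed
  have "groupoid_measure R \<mu> E \<le> (\<integral>\<^sup>+x. of_nat (card (words r r)) \<partial>\<mu>)"
    unfolding groupoid_measure_def groupoid_integral_def
  proof (rule nn_integral_mono)
    fix x assume x: "x \<in> space \<mu>"
    have fin: "finite (E \<inter> src_fibre R x)" using finite_subset[OF fibre_E[OF x]] words_finite by blast
    have "(\<integral>\<^sup>+\<gamma>. indicator E \<gamma> \<partial>count_space (src_fibre R x)) = (\<Sum>\<gamma>\<in>E \<inter> src_fibre R x. indicator E \<gamma>)"
      by (rule nn_integral_count_space'[OF fin]) (auto simp: indicator_def)
    also have "\<dots> = of_nat (card (E \<inter> src_fibre R x))" by (simp add: indicator_def Int_assoc[symmetric] Int_commute)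
    also have "\<dots> \<le> of_nat (card ((\<lambda>g. (\<phi> g x, x)) ` words r r))"
      using card_mono[OF finite_imageI[OF words_finite] fibre_E[OF x]] by simp
    also have "\<dots> \<le> of_nat (card (words r r))" using card_image_le[OF words_finite] by simp
    finally show "(\<integral>\<^sup>+\<gamma>. indicator E \<gamma> \<partial>count_space (src_fibre R x)) \<le> of_nat (card (words r r))" .
  qed
  also have "\<dots> < \<infinity>" by (simp add: emeasure_space_1 of_nat_less_top)
  finally show ?thesis unfolding E_def .
qed

lemma tree_kernel_tendsto: "fst \<gamma> \<in> core \<Longrightarrow> (\<lambda>n. tree_kernel n \<gamma>) \<longlonglongrightarrow> 1"
proof -
  assume "fst \<gamma> \<in> core"
  then have eq: "tree_kernel n \<gamma> = of_real (rate n ^ tree_dist (fst \<gamma>) (snd \<gamma>))" for n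
    by (simp add: tree_kernel_def)
  have "(\<lambda>n. - 1 / (real n + 1)) \<longlonglongrightarrow> 0"
    using tendsto_minus[OF LIMSEQ_inverse_real_of_nat] by (simp add: inverse_eq_divide add.commute)
  then have "(\<lambda>n. complex_of_real (rate n ^ tree_dist (fst \<gamma>) (snd \<gamma>))) \<longlonglongrightarrow>
      complex_of_real (exp 0 ^ tree_dist (fst \<gamma>) (snd \<gamma>))"
    unfolding rate_def by (intro tendsto_of_real tendsto_power tendsto_exp)
  then show ?thesis unfolding eq by simp
qed

lemma property_H_R: "property_H R \<mu>"
  unfolding property_H_def
proof (intro exI[of _ tree_kernel] conjI allI impI tree_kernel_pos_def tree_kernel_level_finite)
  fix n show "AE x in \<mu>. tree_kernel n (unit_arrow R x) = 1"
    by (rule AE_I2) (simp add: tree_kernel_def tree_dist_self)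
next
  \<comment> \<open>\<open>N\<close> is described by the range, its measure by the source; both give
    null sets because \<open>core\<close> is invariant.\<close>
  define N where "N = {\<gamma> \<in> space (arrows R). \<not> fst \<gamma> \<in> core}"
  have "{\<gamma> \<in> space (arrows R). fst \<gamma> \<in> core} \<in> sets (arrows R)"
    using measurable_sets[OF measurable_fst_R core_sets] by (simp add: vimage_def Int_def conj_commute)
  then have N: "N \<in> sets (arrows R)" unfolding N_def by (rule sets.sets_Collect_neg)
  have "groupoid_measure R \<mu> N = (\<integral>\<^sup>+x. 0 \<partial>\<mu>)"
    unfolding groupoid_measure_def groupoid_integral_def
  proof (rule nn_integral_cong_AE, use AE_core in eventually_elim)
    fix x assume x: "x \<in> core"
    have "indicator N \<gamma> = (0 :: ennreal)" if "\<gamma> \<in> src_fibre R x" for \<gamma>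
    proof -
      obtain y where y: "\<gamma> = (y, x)" "y \<in> space \<mu>" "x \<in> orbit_of y"
        using \<open>\<gamma> \<in> src_fibre R x\<close> by (cases \<gamma>) (auto simp: src_fibre_def space_arrows_R)
      obtain g where "g \<in> carrier \<Gamma>" "x = \<phi> g y" using y(3) by blast
      then have "orbit_of x = orbit_of y" using orbit_of_translate y(2) by simp
      then have "y \<in> core" using mem_orbit_of[OF y(2)] core_orbit(3)[OF x] by blast
      then show ?thesis using y(1) by (simp add: N_def)
    qed
    then have "(\<integral>\<^sup>+\<gamma>. indicator N \<gamma> \<partial>count_space (src_fibre R x)) = (\<integral>\<^sup>+\<gamma>. 0 \<partial>count_space (src_fibre R x))"
      by (intro nn_integral_cong) simp
    then show "(\<integral>\<^sup>+\<gamma>. indicator N \<gamma> \<partial>count_space (src_fibre R x)) = 0" by simp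
  qed
  then show "\<exists>N\<in>sets (arrows R). groupoid_measure R \<mu> N = 0 \<and>
      (\<forall>\<gamma>\<in>space (arrows R) - N. (\<lambda>n. tree_kernel n \<gamma>) \<longlonglongrightarrow> 1)"
    using N by (intro bexI[of _ N]) (auto simp: N_def intro: tree_kernel_tendsto)
qed

end

theorem corollary9p4:
  fixes \<Gamma> :: "('g, 'b) monoid_scheme"
    and \<mu> :: "'x measure"
    and \<phi> :: "'g \<Rightarrow> 'x \<Rightarrow> 'x"
  assumes "group \<Gamma>"
    and "countable (carrier \<Gamma>)"
    and "property_T \<Gamma>"
    and "standard_borel \<mu>"
    and "prob_space \<mu>"
    and "diffuse \<mu>"
    and "pmp_action \<Gamma> \<mu> \<phi>"
    and "ergodic_action \<Gamma> \<mu> \<phi>"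
  shows "\<not> property_H (orbit_groupoid \<Gamma> \<mu> \<phi>) \<mu> \<and> \<not> treeable (orbit_groupoid \<Gamma> \<mu> \<phi>) \<mu>"
proof -
  interpret pmp_action \<Gamma> \<mu> \<phi> by fact
  interpret countable_borel_action \<Gamma> \<mu> \<phi>
    by unfold_locales (use assms in auto)
  have notH: "\<not> property_H (orbit_groupoid \<Gamma> \<mu> \<phi>) \<mu>"
    using not_property_H[OF \<open>property_T \<Gamma>\<close> AE_infinite_orbit[OF \<open>diffuse \<mu>\<close> \<open>ergodic_action \<Gamma> \<mu> \<phi>\<close>]]
    unfolding R_def .
  moreover have "\<not> treeable (orbit_groupoid \<Gamma> \<mu> \<phi>) \<mu>"
  proof
    assume "treeable (orbit_groupoid \<Gamma> \<mu> \<phi>) \<mu>"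
    then obtain U Q where "U \<in> sets \<mu>" "emeasure \<mu> (space \<mu> - U) = 0" "treeing (reduction R U) Q"
      unfolding treeable_def R_def by blast
    then interpret treed_action \<Gamma> \<mu> \<phi> U Q by unfold_locales
    show False using property_H_R notH unfolding R_def by blast
  qed
  ultimately show ?thesis by blast
qed

end
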